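(* Let $a,b,d,\alpha>0$ with $\frac{a^2}{4}\ge b$, $n\in\mathbb{N}$, and $\phi(x)=(\frac{\alpha}{\pi})^{n/2}e^{-\alpha|x|^2}$, $x\in\mathbb{R}^n$. (i) If $\frac{a^2}{4}>b$: the problem $\mathcal{L}_1\psi=\lambda\psi$ is spectrally stable if $d\ge s_0(a,b)\frac{c_1^2}{4\alpha}$ and spectrally unstable if $0<d<s_0(a,b)\frac{c_1^2}{4\alpha}$, where $s_0(a,b)$ is the unique zero in $(0,1)$ of $g(s)=-s\ln s+s-\frac{b}{c_1^2}$; the problem $\mathcal{L}_2\psi=\lambda\psi$ is spectrally unstable. (ii) If $\frac{a^2}{4}=b$: for $k=1,2$ the problem $\mathcal{L}_k\psi=\lambda\psi$ is spectrally stable if $d\ge\frac{b}{4\alpha}$ and spectrally unstable if $0<d<\frac{b}{4\alpha}$.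
   Context: $c_1=\frac{a}{2}+\sqrt{\frac{a^2}{4}-b}$, $c_2=\frac{a}{2}-\sqrt{\frac{a^2}{4}-b}$ are the constant solutions of $\partial_t u=d\Delta u+u^2\bigl(a-\int_{\mathbb{R}^n}\phi(x-y)u(y,t)dy\bigr)-bu$. Linearizing about $c_k$ via $u=c_k+\psi(x)e^{-\lambda t}$ gives $\mathcal{L}_k\psi=-d\Delta\psi+c_k^2\int_{\mathbb{R}^n}\phi(x-y)\psi(y)dy-b\psi$, $k=1,2$, self-adjoint on $L^2(\mathbb{R}^n)$ with domain $H^2(\mathbb{R}^n)$. The problem $\mathcal{L}_k\psi=\lambda\psi$ is spectrally stable if $\sigma(\mathcal{L}_k)\subseteq[0,\infty)$ and spectrally unstable if $\sigma(\mathcal{L}_k)$ contains some $\lambda<0$. When $\frac{a^2}{4}>b$, $g(s)=-s\ln s+s-\frac{b}{c_1^2}$ has exactly one zero $s_0(a,b)$ in $(0,1)$. *)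

theory Defs
  imports "HOL-Analysis.Analysis"
begin

definition pd :: "'n::finite \<Rightarrow> (real^'n \<Rightarrow> real) \<Rightarrow> real^'n \<Rightarrow> real" where
  "pd i f x = deriv (\<lambda>t. f (x + t *\<^sub>R axis i 1)) 0"

definition pds :: "'n::finite list \<Rightarrow> (real^'n \<Rightarrow> real) \<Rightarrow> real^'n \<Rightarrow> real" where
  "pds is f = foldr pd is f"

definition smooth_fun :: "(real^'n::finite \<Rightarrow> real) \<Rightarrow> bool" where
  "smooth_fun f \<longleftrightarrow>
     (\<forall>is. continuous_on UNIV (pds is f) \<and>
       (\<forall>i x. (\<lambda>t. pds is f (x + t *\<^sub>R axis i 1)) differentiable (at 0)))"

definition test_fun :: "(real^'n::finite \<Rightarrow> real) \<Rightarrow> bool" where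
  "test_fun f \<longleftrightarrow> smooth_fun f \<and> bounded {x. f x \<noteq> 0}"

definition L2 :: "(real^'n::finite \<Rightarrow> complex) \<Rightarrow> bool" where
  "L2 u \<longleftrightarrow> u \<in> borel_measurable lebesgue \<and> integrable lebesgue (\<lambda>x. (cmod (u x))\<^sup>2)"

definition L2norm :: "(real^'n::finite \<Rightarrow> complex) \<Rightarrow> real" where
  "L2norm u = sqrt (LINT x|lebesgue. (cmod (u x))\<^sup>2)"

definition weak_pd :: "'n::finite \<Rightarrow> (real^'n \<Rightarrow> complex) \<Rightarrow> (real^'n \<Rightarrow> complex) \<Rightarrow> bool" where
  "weak_pd i u v \<longleftrightarrow>
     (\<forall>\<phi>. test_fun \<phi> \<longrightarrow>
        (LINT x|lebesgue. u x * complex_of_real (pd i \<phi> x)) =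
        - (LINT x|lebesgue. v x * complex_of_real (\<phi> x)))"

definition H2_with :: "(real^'n::finite \<Rightarrow> complex) \<Rightarrow> ('n \<Rightarrow> real^'n \<Rightarrow> complex)
                       \<Rightarrow> ('n \<Rightarrow> 'n \<Rightarrow> real^'n \<Rightarrow> complex) \<Rightarrow> bool" where
  "H2_with u v w \<longleftrightarrow> L2 u \<and>
     (\<forall>i. L2 (v i) \<and> weak_pd i u (v i)) \<and>
     (\<forall>i j. L2 (w i j) \<and> weak_pd j (v i) (w i j))"

definition H2 :: "(real^'n::finite \<Rightarrow> complex) \<Rightarrow> bool" where
  "H2 u \<longleftrightarrow> (\<exists>v w. H2_with u v w)"

definition gauss :: "real \<Rightarrow> real^'n::finite \<Rightarrow> real" where
  "gauss \<alpha> x = (\<alpha> / pi) powr (real CARD('n) / 2) * exp (- \<alpha> * (norm x)\<^sup>2)"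

definition conv :: "(real^'n::finite \<Rightarrow> real) \<Rightarrow> (real^'n \<Rightarrow> complex) \<Rightarrow> real^'n \<Rightarrow> complex" where
  "conv \<phi> u x = (LINT y|lebesgue. complex_of_real (\<phi> (x - y)) * u y)"

definition opEq :: "real \<Rightarrow> real \<Rightarrow> (real^'n::finite \<Rightarrow> real) \<Rightarrow> real
                     \<Rightarrow> (real^'n \<Rightarrow> complex) \<Rightarrow> (real^'n \<Rightarrow> complex) \<Rightarrow> bool" where
  "opEq d c \<phi> b u f \<longleftrightarrow>
     (\<exists>v w. H2_with u v w \<and>
        (AE x in lebesgue. f x =
            - complex_of_real d * (\<Sum>i\<in>UNIV. w i i x)
            + complex_of_real (c\<^sup>2) * conv \<phi> u x
            - complex_of_real b * u x))"

text \<open>Resolvent set of the closed operator L with domain H^2 on L^2: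
  L - \<lambda> : H^2 \<rightarrow> L^2 is onto and has a bounded inverse.\<close>
definition resolvent_set :: "real \<Rightarrow> real \<Rightarrow> (real^'n::finite \<Rightarrow> real) \<Rightarrow> real \<Rightarrow> complex set" where
  "resolvent_set d c \<phi> b = {z.
     (\<forall>f. L2 f \<longrightarrow> (\<exists>u. opEq d c \<phi> b u (\<lambda>x. f x + z * u x))) \<and>
     (\<exists>C. \<forall>u f. opEq d c \<phi> b u f \<longrightarrow> L2norm u \<le> C * L2norm (\<lambda>x. f x - z * u x))}"

definition op_spectrum :: "real \<Rightarrow> real \<Rightarrow> (real^'n::finite \<Rightarrow> real) \<Rightarrow> real \<Rightarrow> complex set" where
  "op_spectrum d c \<phi> b = UNIV - resolvent_set d c \<phi> b"

definition spectrally_stable :: "real \<Rightarrow> real \<Rightarrow> (real^'n::finite \<Rightarrow> real) \<Rightarrow> real \<Rightarrow> bool" where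
  "spectrally_stable d c \<phi> b \<longleftrightarrow>
     op_spectrum d c \<phi> b \<subseteq> {z. Im z = 0 \<and> Re z \<ge> 0}"

definition spectrally_unstable :: "real \<Rightarrow> real \<Rightarrow> (real^'n::finite \<Rightarrow> real) \<Rightarrow> real \<Rightarrow> bool" where
  "spectrally_unstable d c \<phi> b \<longleftrightarrow>
     (\<exists>l::real. l < 0 \<and> complex_of_real l \<in> op_spectrum d c \<phi> b)"

definition c1 :: "real \<Rightarrow> real \<Rightarrow> real" where
  "c1 a b = a / 2 + sqrt (a\<^sup>2 / 4 - b)"

definition c2 :: "real \<Rightarrow> real \<Rightarrow> real" where
  "c2 a b = a / 2 - sqrt (a\<^sup>2 / 4 - b)"

definition gfun :: "real \<Rightarrow> real \<Rightarrow> real \<Rightarrow> real" where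
  "gfun a b s = - s * ln s + s - b / (c1 a b)\<^sup>2"

definition s0 :: "real \<Rightarrow> real \<Rightarrow> real" where
  "s0 a b = (THE s. 0 < s \<and> s < 1 \<and> gfun a b s = 0)"

end

theory Submission
  imports Defs "HOL-Probability.Probability"
begin

text \<open>
  The Fourier transform turns the operator into multiplication by
  \<open>m \<xi> = 4 \<pi>\<^sup>2 d |\<xi>|\<^sup>2 + c\<^sup>2 exp (- \<pi>\<^sup>2 |\<xi>|\<^sup>2 / \<alpha>) - b\<close>, so its spectrum is the closed range of \<open>m\<close>:
  if \<open>m\<close> avoids a neighbourhood of \<open>z\<close> then dividing by \<open>m - z\<close> inverts the operator, and if
  \<open>m \<xi>\<^sub>0 = z\<close> then functions with transform concentrated near \<open>\<xi>\<^sub>0\<close> are approximate eigenfunctions.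
  With \<open>\<rho> = \<pi>\<^sup>2 |\<xi>|\<^sup>2 / \<alpha>\<close> the multiplier is the convex function \<open>4 \<alpha> d \<rho> + c\<^sup>2 exp (- \<rho>) - b\<close>, whose
  minimum over \<open>\<rho> \<ge> 0\<close> is at \<open>\<rho> = - ln s\<close> for \<open>s = 4 \<alpha> d / c\<^sup>2 < 1\<close>, with value
  \<open>c\<^sup>2 (s - s ln s) - b\<close>, and at \<open>\<rho> = 0\<close> otherwise.

  Plancherel's identity for bounded functions of bounded support comes from Gaussian regularisation.
  A weak derivative is identified with multiplication by \<open>2 \<pi> \<i> \<xi>\<^sub>i\<close> by testing against translates of a
  bump function, which is a statement about convolutions.
\<close>

subsection \<open>Square-integrable functions\<close>

text \<open>The factor 2 pi in the exponent makes the transform an isometry with no constant in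
  front, which is why the multiplier carries \<open>pi\<^sup>2\<close>. On \<open>L2\<close> the
  transform is fixed by duality against bounded functions of bounded support; Parseval combined with
  conjugation then yields the inverse, hence surjectivity, without an inversion integral. The
  obstacle is the domain. \<open>H2\<close> is tested only with compactly supported functions, whose
  transforms, zero aside, are not compactly supported, so weak derivatives cannot be read off
  directly at a frequency. Convolving with a bump helps only where its transform is nonzero, and a
  single transform may vanish somewhere; countably many dilates of a nonnegative bump leave no
  frequency uncovered. In the other direction a solution lies in \<open>H2\<close> once |xi|^2 h is
  square integrable, which division by m - z provides because m grows quadratically. Only two halves
  of the spectral identity are used: if m is nonnegative, every z outside [0, infinity) is in the
  resolvent set; a negative value of m is in the spectrum because the bounded-inverse condition
  fails there.\<close>

lemma L2_measurable [measurable_dest]: "L2 u \<Longrightarrow> u \<in> borel_measurable lebesgue"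
  by (simp add: L2_def)

lemma L2_integrable: "L2 u \<Longrightarrow> integrable lebesgue (\<lambda>x. (cmod (u x))\<^sup>2)"
  by (simp add: L2_def)

lemma L2_bound:
  assumes "integrable lebesgue g" "u \<in> borel_measurable lebesgue"
    and "AE x in lebesgue. (cmod (u x))\<^sup>2 \<le> g x"
  shows "L2 u"
  unfolding L2_def
proof
  show "integrable lebesgue (\<lambda>x. (cmod (u x))\<^sup>2)"
    by (rule Bochner_Integration.integrable_bound[OF assms(1)]) (use assms in auto)
qed fact

lemma L2_add:
  assumes "L2 f" "L2 g" shows "L2 (\<lambda>x. f x + g x)"
proof (rule L2_bound)
  show "integrable lebesgue (\<lambda>x. 2 * (cmod (f x))\<^sup>2 + 2 * (cmod (g x))\<^sup>2)"
    using assms by (simp add: L2_def)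
  show "(\<lambda>x. f x + g x) \<in> borel_measurable lebesgue" using assms by (auto simp: L2_def)
  have "(cmod (f x + g x))\<^sup>2 \<le> 2 * (cmod (f x))\<^sup>2 + 2 * (cmod (g x))\<^sup>2" for x
  proof -
    have "(cmod (f x + g x))\<^sup>2 \<le> (cmod (f x) + cmod (g x))\<^sup>2"
      by (intro power_mono norm_triangle_ineq) simp
    also have "\<dots> \<le> 2 * (cmod (f x))\<^sup>2 + 2 * (cmod (g x))\<^sup>2"
      using zero_le_power2[of "cmod (f x) - cmod (g x)"] by (simp add: power2_eq_square algebra_simps)
    finally show ?thesis .
  qed
  then show "AE x in lebesgue. (cmod (f x + g x))\<^sup>2 \<le> 2 * (cmod (f x))\<^sup>2 + 2 * (cmod (g x))\<^sup>2"
    by simp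
qed

lemma L2_mult_bounded:
  assumes "L2 f" "k \<in> borel_measurable lebesgue" "\<And>x. cmod (k x) \<le> M"
  shows "L2 (\<lambda>x. k x * f x)"
proof (rule L2_bound)
  show "integrable lebesgue (\<lambda>x. M\<^sup>2 * (cmod (f x))\<^sup>2)" using assms by (simp add: L2_def)
  show "(\<lambda>x. k x * f x) \<in> borel_measurable lebesgue" using assms by (auto simp: L2_def)
  show "AE x in lebesgue. (cmod (k x * f x))\<^sup>2 \<le> M\<^sup>2 * (cmod (f x))\<^sup>2"
    using assms(3) by (auto simp: norm_mult power_mult_distrib intro!: mult_right_mono power_mono)
qed

lemma L2_cmult: "L2 f \<Longrightarrow> L2 (\<lambda>x. c * f x)"
  by (rule L2_mult_bounded[where M = "cmod c"]) auto

lemma L2_diff: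
  assumes "L2 f" "L2 g" shows "L2 (\<lambda>x. f x - g x)"
  using L2_add[OF assms(1) L2_cmult[OF assms(2), of "-1"]] by simp

lemma L2_zero: "L2 (\<lambda>x. 0)" by (simp add: L2_def)

lemma L2_cnj: "L2 f \<Longrightarrow> L2 (\<lambda>x. cnj (f x))"
  unfolding L2_def by (auto simp: complex_mod_cnj intro: borel_measurable_continuous_on[OF continuous_on_cnj])

lemma L2_cong_AE:
  assumes "L2 f" "g \<in> borel_measurable lebesgue" "AE x in lebesgue. f x = g x"
  shows "L2 g"
  by (rule L2_bound[OF L2_integrable[OF assms(1)] assms(2)]) (use assms(3) in auto)

lemma L2norm_cong_AE:
  assumes "L2 f" "L2 g" "AE x in lebesgue. f x = g x" shows "L2norm f = L2norm g"
  unfolding L2norm_def using assms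
  by (intro arg_cong[where f = sqrt] integral_cong_AE) auto

lemma L2norm_nonneg: "L2norm f \<ge> 0"
  by (simp add: L2norm_def)

lemma L2norm_sq: "(L2norm f)\<^sup>2 = (LINT x|lebesgue. (cmod (f x))\<^sup>2)"
  by (simp add: L2norm_def)

lemma L2norm_minus_commute: "L2norm (\<lambda>x. f x - g x) = L2norm (\<lambda>x. g x - f x)"
  by (simp add: L2norm_def norm_minus_commute)

lemma L2_norm_mult_integrable:
  assumes "L2 f" "L2 g" shows "integrable lebesgue (\<lambda>x. cmod (f x) * cmod (g x))"
proof (rule Bochner_Integration.integrable_bound)
  show "integrable lebesgue (\<lambda>x. (cmod (f x))\<^sup>2 + (cmod (g x))\<^sup>2)"
    using assms by (simp add: L2_def)
  show "(\<lambda>x. cmod (f x) * cmod (g x)) \<in> borel_measurable lebesgue" using assms by (auto simp: L2_def)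
  have "cmod (f x) * cmod (g x) \<le> (cmod (f x))\<^sup>2 + (cmod (g x))\<^sup>2" for x
    using sum_squares_bound[of "cmod (f x)" "cmod (g x)"]
      mult_nonneg_nonneg[OF norm_ge_zero[of "f x"] norm_ge_zero[of "g x"]] by linarith
  then show "AE x in lebesgue. norm (cmod (f x) * cmod (g x)) \<le> norm ((cmod (f x))\<^sup>2 + (cmod (g x))\<^sup>2)"
    by simp
qed

lemma L2_mult_integrable:
  assumes "L2 f" "L2 g" shows "integrable lebesgue (\<lambda>x. f x * g x)"
  by (rule Bochner_Integration.integrable_bound[OF L2_norm_mult_integrable[OF assms]])
     (use assms in \<open>auto simp: L2_def norm_mult\<close>)

text \<open>Integrating the weighted inequality 2ab <= (q/p) a^2 + (p/q) b^2, with p and q the two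
  norms, gives their product. The norms are enlarged by e so that the weights make sense when a norm
  is 0; then e tends to 0 from above.\<close>

lemma Cauchy_Schwarz_norm:
  assumes "L2 f" "L2 g"
  shows "(LINT x|lebesgue. cmod (f x) * cmod (g x)) \<le> L2norm f * L2norm g"
proof -
  let ?A = "L2norm f" and ?B = "L2norm g"
  have le: "(LINT x|lebesgue. cmod (f x) * cmod (g x)) \<le> (?A + e) * (?B + e)" if e: "e > 0" for e
  proof -
    define p q where "p = ?A + e" and "q = ?B + e"
    have p: "p > 0" "?A \<le> p" and q: "q > 0" "?B \<le> q"
      using e L2norm_nonneg[of f] L2norm_nonneg[of g] by (auto simp: p_def q_def)
    have amgm: "a * b \<le> (q / p * a\<^sup>2 + p / q * b\<^sup>2) / 2" for a b :: real
    proof -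
      have "0 \<le> (q * a - p * b)\<^sup>2 / (2 * p * q)" using p q by simp
      also have "\<dots> = (q / p * a\<^sup>2 + p / q * b\<^sup>2) / 2 - a * b"
        using p q by (simp add: power2_eq_square field_simps)
      finally show ?thesis by simp
    qed
    have "(LINT x|lebesgue. cmod (f x) * cmod (g x))
        \<le> (LINT x|lebesgue. (q / p * (cmod (f x))\<^sup>2 + p / q * (cmod (g x))\<^sup>2) / 2)"
      by (rule integral_mono[OF L2_norm_mult_integrable[OF assms]])
         (use assms amgm in \<open>auto simp: L2_def\<close>)
    also have "\<dots> = (q / p * ?A\<^sup>2 + p / q * ?B\<^sup>2) / 2"
      unfolding L2norm_sq using assms by (simp add: L2_def)
    also have "\<dots> \<le> (q / p * p\<^sup>2 + p / q * q\<^sup>2) / 2"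
      using p q L2norm_nonneg[of f] L2norm_nonneg[of g]
      by (intro divide_right_mono add_mono mult_left_mono power_mono) auto
    also have "\<dots> = p * q" using p q by (simp add: power2_eq_square field_simps)
    finally show ?thesis by (simp add: p_def q_def)
  qed
  have "((\<lambda>e. (?A + e) * (?B + e)) \<longlongrightarrow> (?A + 0) * (?B + 0)) (at_right 0)"
    by (intro tendsto_intros)
  moreover have "\<forall>\<^sub>F e in at_right 0. (LINT x|lebesgue. cmod (f x) * cmod (g x)) \<le> (?A + e) * (?B + e)"
    unfolding eventually_at_right_field using le by (auto intro: exI[of _ 1])
  ultimately show ?thesis
    using tendsto_lowerbound[of _ _ "at_right (0::real)"] by auto
qed

lemma Cauchy_Schwarz_L2:
  assumes "L2 f" "L2 g"
  shows "cmod (LINT x|lebesgue. f x * g x) \<le> L2norm f * L2norm g"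
proof -
  have "cmod (LINT x|lebesgue. f x * g x) \<le> (LINT x|lebesgue. cmod (f x * g x))"
    by (rule integral_norm_bound)
  also have "\<dots> \<le> L2norm f * L2norm g" using Cauchy_Schwarz_norm[OF assms] by (simp add: norm_mult)
  finally show ?thesis .
qed

lemma L2norm_triangle:
  assumes "L2 f" "L2 g"
  shows "L2norm (\<lambda>x. f x + g x) \<le> L2norm f + L2norm g"
proof (rule power2_le_imp_le)
  have "(L2norm (\<lambda>x. f x + g x))\<^sup>2 
      \<le> (LINT x|lebesgue. (cmod (f x))\<^sup>2 + 2 * (cmod (f x) * cmod (g x)) + (cmod (g x))\<^sup>2)"
    unfolding L2norm_sq
  proof (rule integral_mono)
    show "(cmod (f x + g x))\<^sup>2 \<le> (cmod (f x))\<^sup>2 + 2 * (cmod (f x) * cmod (g x)) + (cmod (g x))\<^sup>2" for x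
      using power_mono[OF norm_triangle_ineq[of "f x" "g x"], of 2]
      by (simp add: power2_eq_square algebra_simps)
  qed (use assms L2_integrable[OF L2_add[OF assms]] L2_norm_mult_integrable[OF assms] in \<open>auto simp: L2_def\<close>)
  also have "\<dots> = (L2norm f)\<^sup>2 + 2 * (LINT x|lebesgue. cmod (f x) * cmod (g x)) + (L2norm g)\<^sup>2"
    unfolding L2norm_sq using assms L2_norm_mult_integrable[OF assms] by (simp add: L2_def)
  also have "\<dots> \<le> (L2norm f + L2norm g)\<^sup>2"
    using Cauchy_Schwarz_norm[OF assms] by (simp add: power2_eq_square algebra_simps)
  finally show "(L2norm (\<lambda>x. f x + g x))\<^sup>2 \<le> (L2norm f + L2norm g)\<^sup>2" .
qed (simp add: L2norm_nonneg)

lemma L2norm_diff_triangle: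
  assumes "L2 f" "L2 g" "L2 h"
  shows "L2norm (\<lambda>x. f x - h x) \<le> L2norm (\<lambda>x. f x - g x) + L2norm (\<lambda>x. g x - h x)"
  using L2norm_triangle[OF L2_diff[OF assms(1,2)] L2_diff[OF assms(2,3)]] by simp

lemma L2norm_tendsto:
  assumes "\<And>k. L2 (f k)" "L2 F" "(\<lambda>k. L2norm (\<lambda>x. f k x - F x)) \<longlonglongrightarrow> 0"
  shows "(\<lambda>k. L2norm (f k)) \<longlonglongrightarrow> L2norm F"
proof (rule LIM_zero_cancel, rule Lim_null_comparison[OF _ assms(3)])
  have "\<bar>L2norm (f k) - L2norm F\<bar> \<le> L2norm (\<lambda>x. f k x - F x)" for k
    using L2norm_diff_triangle[OF assms(1)[of k] assms(2) L2_zero]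
      L2norm_diff_triangle[OF assms(2) assms(1)[of k] L2_zero] L2norm_minus_commute[of "f k" F] by auto
  then show "\<forall>\<^sub>F k in sequentially. norm (L2norm (f k) - L2norm F) \<le> L2norm (\<lambda>x. f k x - F x)"
    by simp
qed

lemma L2_integral_tendsto:
  assumes "\<And>k. L2 (f k)" "L2 F" "L2 g" "(\<lambda>k. L2norm (\<lambda>x. f k x - F x)) \<longlonglongrightarrow> 0"
  shows "(\<lambda>k. LINT x|lebesgue. f k x * g x) \<longlonglongrightarrow> (LINT x|lebesgue. F x * g x)"
proof (rule LIM_zero_cancel, rule Lim_null_comparison)
  have "cmod ((LINT x|lebesgue. f k x * g x) - (LINT x|lebesgue. F x * g x))
       \<le> L2norm (\<lambda>x. f k x - F x) * L2norm g" for k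
  proof -
    have "(LINT x|lebesgue. f k x * g x) - (LINT x|lebesgue. F x * g x)
        = (LINT x|lebesgue. (f k x - F x) * g x)"
      unfolding left_diff_distrib
      by (subst Bochner_Integration.integral_diff) (auto intro: L2_mult_integrable assms)
    then show ?thesis using Cauchy_Schwarz_L2[OF L2_diff[OF assms(1,2)] assms(3)] by simp
  qed
  then show "\<forall>\<^sub>F k in sequentially. cmod ((LINT x|lebesgue. f k x * g x) - (LINT x|lebesgue. F x * g x))
       \<le> L2norm (\<lambda>x. f k x - F x) * L2norm g" by simp
  show "(\<lambda>k. L2norm (\<lambda>x. f k x - F x) * L2norm g) \<longlonglongrightarrow> 0"
    using tendsto_mult_right[OF assms(4), of "L2norm g"] by simp
qed

section \<open>Completeness of the space of square-integrable functions (Riesz-Fischer)\<close>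

lemma nn_integral_L2:
  assumes "L2 f" shows "(\<integral>\<^sup>+x. ennreal ((cmod (f x))\<^sup>2) \<partial>lebesgue) = ennreal ((L2norm f)\<^sup>2)"
  unfolding L2norm_sq using assms by (intro nn_integral_eq_integral) (auto simp: L2_def)

text \<open>Membership and a norm bound are obtained together from a nonnegative integral, the form
  in which Fatou and Tonelli deliver them.\<close>

lemma L2_if_nn_integral:
  assumes "f \<in> borel_measurable lebesgue"
    and "(\<integral>\<^sup>+x. ennreal ((cmod (f x))\<^sup>2) \<partial>lebesgue) \<le> ennreal (B\<^sup>2)" "B \<ge> 0"
  shows "L2 f" "L2norm f \<le> B"
proof -
  show "L2 f" unfolding L2_def
    using assms(1) le_less_trans[OF assms(2)] by (auto simp: integrable_iff_bounded)
  from assms(2) have "(L2norm f)\<^sup>2 \<le> B\<^sup>2"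
    unfolding nn_integral_L2[OF \<open>L2 f\<close>] by (simp add: ennreal_le_iff)
  then show "L2norm f \<le> B" using assms(3) by (rule power2_le_imp_le)
qed

theorem L2_complete:
  assumes L: "\<And>k. L2 (f k)"
    and cauchy: "\<And>e. e > 0 \<Longrightarrow> \<exists>N. \<forall>m\<ge>N. \<forall>n\<ge>N. L2norm (\<lambda>x. f m x - f n x) < e"
  obtains F where "L2 F" "(\<lambda>k. L2norm (\<lambda>x. f k x - F x)) \<longlonglongrightarrow> 0"
proof -
  note [measurable] = L2_measurable[OF L]
  have "\<exists>N. \<forall>m\<ge>N. \<forall>n\<ge>N. L2norm (\<lambda>x. f m x - f n x) < (1/4)^k" for k :: nat
    by (rule cauchy) simp
  then obtain N where N: "\<And>k m n. m \<ge> N k \<Longrightarrow> n \<ge> N k \<Longrightarrow> L2norm (\<lambda>x. f m x - f n x) < (1/4)^k"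
    by metis
  \<comment> \<open>A partial sum dominates every \<open>N j\<close> with j <= k, so
    \<open>N\<close> itself may be non-monotone.\<close>
  define r where "r k = (\<Sum>j\<le>k. N j)" for k
  have rN: "r k \<ge> N j" if "j \<le> k" for j k
    unfolding r_def using that by (intro member_le_sum) auto
  define D where "D k x = cmod (f (r (Suc k)) x - f (r k) x)" for k x
  have [measurable]: "D k \<in> borel_measurable lebesgue" for k unfolding D_def by measurable
  \<comment> \<open>The squared step is at most (1/16)^k, so after inserting the weight 2^k a
    summable (1/8)^k remains; the weight pays for passing from squares to absolute values
    below.\<close>
  have Dint: "(\<integral>\<^sup>+x. ennreal (2^k * (D k x)\<^sup>2) \<partial>lebesgue) \<le> ennreal ((1/8)^k)" for k
  proof -
    have "(\<integral>\<^sup>+x. ennreal (2^k * (D k x)\<^sup>2) \<partial>lebesgue) = ennreal (2^k) * (\<integral>\<^sup>+x. ennreal ((D k x)\<^sup>2) \<partial>lebesgue)"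
      by (subst nn_integral_cmult[symmetric]) (auto simp: ennreal_mult)
    also have "\<dots> = ennreal (2^k) * ennreal ((L2norm (\<lambda>x. f (r (Suc k)) x - f (r k) x))\<^sup>2)"
      unfolding D_def by (subst nn_integral_L2) (auto intro: L2_diff L)
    also have "\<dots> \<le> ennreal (2^k) * ennreal (((1/4)^k)\<^sup>2)"
      using N[OF rN[of k "Suc k"] rN[of k k]]
      by (intro mult_left_mono ennreal_leI power_mono) (auto simp: L2norm_nonneg)
    also have "\<dots> = ennreal (2^k * ((1/4)^k)\<^sup>2)" by (simp add: ennreal_mult)
    also have "2^k * ((1/4)^k)\<^sup>2 = ((1/8)^k :: real)"
      by (simp add: power2_eq_square flip: power_mult_distrib)
    finally show ?thesis .
  qed
  have "(\<integral>\<^sup>+x. (\<Sum>k. ennreal (2^k * (D k x)\<^sup>2)) \<partial>lebesgue)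
      = (\<Sum>k. \<integral>\<^sup>+x. ennreal (2^k * (D k x)\<^sup>2) \<partial>lebesgue)"
    by (rule nn_integral_suminf) auto
  also have "\<dots> \<le> (\<Sum>k. ennreal ((1/8)^k))" by (intro suminf_le Dint) auto
  also have "\<dots> < \<infinity>" by (subst suminf_ennreal2) (auto simp: summable_geometric)
  finally have "AE x in lebesgue. (\<Sum>k. ennreal (2^k * (D k x)\<^sup>2)) \<noteq> \<infinity>"
    by (intro nn_integral_PInf_AE) auto
  then have conv: "AE x in lebesgue. convergent (\<lambda>k. f (r k) x)"
  proof (rule AE_mp, intro AE_I2 impI)
    fix x assume "(\<Sum>k. ennreal (2^k * (D k x)\<^sup>2)) \<noteq> \<infinity>"
    then have s1: "summable (\<lambda>k. 2^k * (D k x)\<^sup>2)" by (intro summable_suminf_not_top) auto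
    have s2: "summable (\<lambda>k. (1/2::real)^k)" by (rule summable_geometric) simp
    have "summable (\<lambda>k. f (r (Suc k)) x - f (r k) x)"
    proof (rule summable_comparison_test'[OF summable_divide[OF summable_add[OF s2 s1], of 2]])
      fix k :: nat
      \<comment> \<open>Expanding this square bounds 2D by (1/2)^k + 2^k D^2, so the weighted square
        sum controls the sum of the increments themselves.\<close>
      have "0 \<le> 2^k * (D k x - (1/2)^k)\<^sup>2" by simp
      also have "\<dots> = (1/2)^k + 2^k * (D k x)\<^sup>2 - 2 * D k x"
        by (simp add: power2_eq_square algebra_simps power_divide)
      finally show "norm (f (r (Suc k)) x - f (r k) x) \<le> ((1/2)^k + 2^k * (D k x)\<^sup>2) / 2"
        by (simp add: D_def)
    qed
    then have "convergent (\<lambda>n. \<Sum>k<n. f (r (Suc k)) x - f (r k) x)"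
      by (simp add: summable_iff_convergent)
    then have "convergent (\<lambda>n. f (r n) x - f (r 0) x)" by (simp only: sum_lessThan_telescope[of "\<lambda>k. f (r k) x"])
    then show "convergent (\<lambda>k. f (r k) x)" by (simp add: convergent_diff_const_right_iff)
  qed
  define F where "F x = lim (\<lambda>k. f (r k) x)" for x
  have [measurable]: "F \<in> borel_measurable lebesgue" unfolding F_def by measurable
  \<comment> \<open>Fatou in the second index along the subsequence, with m kept free: this gives
    convergence of the whole sequence and not just of the subsequence.\<close>
  have Fbound: "L2 (\<lambda>x. f m x - F x) \<and> L2norm (\<lambda>x. f m x - F x) \<le> (1/4)^k" if m: "m \<ge> N k" for m k
  proof -
    have "(\<integral>\<^sup>+x. ennreal ((cmod (f m x - F x))\<^sup>2) \<partial>lebesgue)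
        \<le> (\<integral>\<^sup>+x. liminf (\<lambda>j. ennreal ((cmod (f m x - f (r j) x))\<^sup>2)) \<partial>lebesgue)"
    proof (rule nn_integral_mono_AE, rule AE_mp[OF conv], intro AE_I2 impI)
      fix x assume "convergent (\<lambda>k. f (r k) x)"
      then have "(\<lambda>k. f (r k) x) \<longlonglongrightarrow> F x" unfolding F_def by (simp add: convergent_LIMSEQ_iff)
      then have "(\<lambda>j. ennreal ((cmod (f m x - f (r j) x))\<^sup>2)) \<longlonglongrightarrow> ennreal ((cmod (f m x - F x))\<^sup>2)"
        by (intro tendsto_ennrealI tendsto_intros)
      from lim_imp_Liminf[OF _ this]
      show "ennreal ((cmod (f m x - F x))\<^sup>2) \<le> liminf (\<lambda>j. ennreal ((cmod (f m x - f (r j) x))\<^sup>2))"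
        by simp
    qed
    also have "\<dots> \<le> liminf (\<lambda>j. \<integral>\<^sup>+x. ennreal ((cmod (f m x - f (r j) x))\<^sup>2) \<partial>lebesgue)"
      by (rule nn_integral_liminf) auto
    also have "\<dots> \<le> liminf (\<lambda>j. ennreal (((1/4)^k)\<^sup>2))"
    proof (rule Liminf_mono)
      show "\<forall>\<^sub>F j in sequentially. (\<integral>\<^sup>+x. ennreal ((cmod (f m x - f (r j) x))\<^sup>2) \<partial>lebesgue) \<le> ennreal (((1/4)^k)\<^sup>2)"
        using eventually_ge_at_top[of k]
      proof eventually_elim
        case (elim j)
        then show ?case
          using N[OF m rN[OF elim]]
          by (subst nn_integral_L2) (auto intro!: L2_diff L ennreal_leI power_mono simp: L2norm_nonneg)
      qed
    qed
    also have "\<dots> = ennreal (((1/4)^k)\<^sup>2)" by (intro lim_imp_Liminf) auto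
    finally have *: "(\<integral>\<^sup>+x. ennreal ((cmod (f m x - F x))\<^sup>2) \<partial>lebesgue) \<le> ennreal (((1/4)^k)\<^sup>2)" .
    show ?thesis using L2_if_nn_integral[OF _ *] by auto
  qed
  have "L2 F" using L2_diff[OF L[of "N 0"] conjunct1[OF Fbound[of 0 "N 0"]]] by simp
  moreover have "(\<lambda>k. L2norm (\<lambda>x. f k x - F x)) \<longlonglongrightarrow> 0"
  proof (rule LIMSEQ_I)
    fix e :: real assume "e > 0"
    then obtain k where k: "(1/4)^k < e" using real_arch_pow_inv[of e "1/4"] by auto
    show "\<exists>no. \<forall>n\<ge>no. norm (L2norm (\<lambda>x. f n x - F x) - 0) < e"
      using Fbound[of k] k by (intro exI[of _ "N k"]) (fastforce simp: L2norm_nonneg)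
  qed
  ultimately show ?thesis by (rule that)
qed

subsection \<open>Integration on the Borel space\<close>

text \<open>Measurability in \<open>L2\<close> refers to the completed measure, while Fubini and
  affine substitutions below run on \<open>lborel\<close> with Borel functions; this replacement is
  the bridge.\<close>

lemma L2_Borel_version:
  assumes "L2 u"
  obtains u' where "u' \<in> borel_measurable borel" "AE x in lebesgue. u x = u' x" "L2 u'"
proof -
  have m: "(\<lambda>x. Re (u x)) \<in> borel_measurable lebesgue" "(\<lambda>x. Im (u x)) \<in> borel_measurable lebesgue"
    using L2_measurable[OF assms] by auto
  obtain p q where pq: "p \<in> borel_measurable lborel" "AE x in lborel. Re (u x) = p x"
      "q \<in> borel_measurable lborel" "AE x in lborel. Im (u x) = q x"
    using completion_ex_borel_measurable_real[OF m(1)] completion_ex_borel_measurable_real[OF m(2)] by blast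
  define u' where "u' x = Complex (p x) (q x)" for x
  have u': "u' \<in> borel_measurable borel"
    using pq(1,3) by (simp add: borel_measurable_complex_iff u'_def)
  have ae: "AE x in lebesgue. u x = u' x"
    by (rule AE_completion) (use pq in \<open>auto simp: u'_def complex_eq_iff elim: eventually_elim2\<close>)
  have "u' \<in> borel_measurable lebesgue" using u' by (simp add: measurable_completion)
  with that[OF u' ae] L2_cong_AE[OF assms _ ae] show ?thesis by blast
qed

text \<open>The cases c = 1 and c = -1 are translations and point reflections, the only
  substitutions that convolutions require.\<close>

lemma distr_lborel_isometry:
  fixes t :: "'a::euclidean_space"
  assumes "\<bar>c\<bar> = 1"
  shows "distr lborel borel (\<lambda>x. t + c *\<^sub>R x) = (lborel :: 'a measure)"
  using lborel_affine[of c t] assms by (auto simp: density_1)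

lemma lborel_integral_isometry:
  fixes f :: "'a::euclidean_space \<Rightarrow> 'b::{banach, second_countable_topology}"
  assumes "f \<in> borel_measurable borel"
  shows "(LINT x|lborel. f (t + x)) = (LINT x|lborel. f x)"
    and "(LINT x|lborel. f (t - x)) = (LINT x|lborel. f x)"
    and "integrable lborel (\<lambda>x. f (t + x)) \<longleftrightarrow> integrable lborel f"
    and "integrable lborel (\<lambda>x. f (t - x)) \<longleftrightarrow> integrable lborel f"
  using integral_distr[of "\<lambda>x. t + 1 *\<^sub>R x" lborel borel f] integral_distr[of "\<lambda>x. t + (-1) *\<^sub>R x" lborel borel f]
    integrable_distr_eq[of "\<lambda>x. t + 1 *\<^sub>R x" lborel borel f] 
    integrable_distr_eq[of "\<lambda>x. t + (-1) *\<^sub>R x" lborel borel f]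
    distr_lborel_isometry[of 1 t] distr_lborel_isometry[of "-1" t] assms
  by (auto simp del: lborel_distr_plus)

lemma nn_integral_lborel_isometry:
  fixes f :: "'a::euclidean_space \<Rightarrow> ennreal"
  assumes "f \<in> borel_measurable borel"
  shows "(\<integral>\<^sup>+x. f (t + x) \<partial>lborel) = (\<integral>\<^sup>+x. f x \<partial>lborel)"
    and "(\<integral>\<^sup>+x. f (t - x) \<partial>lborel) = (\<integral>\<^sup>+x. f x \<partial>lborel)"
  using nn_integral_distr[of "\<lambda>x. t + 1 *\<^sub>R x" lborel borel f] nn_integral_distr[of "\<lambda>x. t + (-1) *\<^sub>R x" lborel borel f]
    distr_lborel_isometry[of 1 t] distr_lborel_isometry[of "-1" t] assms
  by (auto simp del: lborel_distr_plus)

text \<open>Supplies the hypothesis of Fubini when two integrable functions are coupled by a bounded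
  kernel: a character in the multiplication formula, a shifted bounded function in the
  autocorrelation.\<close>

lemma integrable_lborel_pair_mult:
  fixes f g :: "'a::euclidean_space \<Rightarrow> complex"
  assumes f: "integrable lborel f" and g: "integrable lborel g"
    and K: "K \<in> borel_measurable (lborel \<Otimes>\<^sub>M lborel)" "\<And>p. cmod (K p) \<le> 1"
  shows "integrable (lborel \<Otimes>\<^sub>M lborel) (\<lambda>(x, y). f x * g y * K (x, y))"
proof (rule Bochner_Integration.integrable_bound)
  have [measurable]: "f \<in> borel_measurable borel" "g \<in> borel_measurable borel"
    using f g by auto
  show "integrable (lborel \<Otimes>\<^sub>M lborel) (\<lambda>(x, y). f x * g y)"
  proof (rule lborel_pair.Fubini_integrable)
    show "integrable lborel (\<lambda>x. LINT y|lborel. norm (case (x, y) of (x, y) \<Rightarrow> f x * g y))"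
      using f by (simp add: norm_mult)
    show "AE x in lborel. integrable lborel (\<lambda>y. case (x, y) of (x, y) \<Rightarrow> f x * g y)"
      using g by simp
  qed measurable
  show "(\<lambda>(x, y). f x * g y * K (x, y)) \<in> borel_measurable (lborel \<Otimes>\<^sub>M lborel)"
    using K(1) by measurable
  have "cmod (f x * g y * K (x, y)) \<le> cmod (f x * g y)" for x y
    using mult_left_mono[OF K(2)[of "(x, y)"] norm_ge_zero[of "f x * g y"]] by (simp add: norm_mult)
  then show "AE p in lborel \<Otimes>\<^sub>M lborel. norm (case p of (x, y) \<Rightarrow> f x * g y * K (x, y))
      \<le> norm (case p of (x, y) \<Rightarrow> f x * g y)"
    by (auto simp: split_beta)
qed

text \<open>Lebesgue measure is the image of the product of one-dimensional measures under the map
  from coordinates to vectors. This reduces the Gaussian integral to dimension one.\<close>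

lemma lborel_integral_Basis_prod:
  fixes f :: "'a::euclidean_space \<Rightarrow> real \<Rightarrow> complex"
  assumes "\<And>b. b \<in> Basis \<Longrightarrow> integrable lborel (f b)"
  shows "(LINT x|lborel. (\<Prod>b\<in>Basis. f b (x \<bullet> b))) = (\<Prod>b\<in>Basis. LINT x|lborel. f b x)"
    and "integrable lborel (\<lambda>x. \<Prod>b\<in>Basis. f b (x \<bullet> b))"
proof -
  interpret product_sigma_finite "\<lambda>_::'a. lborel :: real measure" by standard
  have [measurable]: "f b \<in> borel_measurable borel" if "b \<in> Basis" for b using assms[OF that] by auto
  have [measurable]: "(\<lambda>x::'a. \<Prod>b\<in>Basis. f b (x \<bullet> b)) \<in> borel_measurable borel" by measurable
  let ?T = "\<lambda>g::'a\<Rightarrow>real. \<Sum>b\<in>Basis. g b *\<^sub>R b"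
  have [measurable]: "?T \<in> (\<Pi>\<^sub>M b\<in>Basis. lborel) \<rightarrow>\<^sub>M borel" by measurable
  have eq: "(\<Prod>b\<in>Basis. f b (?T g \<bullet> b)) = (\<Prod>b\<in>Basis. f b (g b))" for g
    by (intro prod.cong) (auto simp: inner_sum_left inner_Basis if_distrib cong: if_cong)
  show "(LINT x|lborel. (\<Prod>b\<in>Basis. f b (x \<bullet> b))) = (\<Prod>b\<in>Basis. LINT x|lborel. f b x)"
    by (subst lborel_eq, subst integral_distr) (use assms in \<open>simp_all add: eq product_integral_prod\<close>)
  show "integrable lborel (\<lambda>x. \<Prod>b\<in>Basis. f b (x \<bullet> b))"
    by (subst lborel_eq, subst integrable_distr_eq) (use assms in \<open>simp_all add: eq product_integrable_prod\<close>)
qed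

subsection \<open>The Fourier integral\<close>

text \<open>Meaningful for integrable \<open>f\<close>; on square-integrable functions it is
  extended by the relation \<open>FT\<close>.\<close>

definition ft :: "(real^'n::finite \<Rightarrow> complex) \<Rightarrow> real^'n \<Rightarrow> complex" where
  "ft f \<xi> = (LINT x|lborel. f x * cis (- 2 * pi * (x \<bullet> \<xi>)))"

lemma borel_measurable_cis [measurable]: "f \<in> borel_measurable M \<Longrightarrow> (\<lambda>x. cis (f x)) \<in> borel_measurable M"
  by (rule borel_measurable_continuous_on[OF continuous_on_cis[OF continuous_on_id]])

lemma integrable_mult_cis:
  fixes f :: "'a::euclidean_space \<Rightarrow> complex"
  assumes "integrable lborel f" "g \<in> borel_measurable borel"
  shows "integrable lborel (\<lambda>x. f x * cis (g x))"
  by (rule Bochner_Integration.integrable_bound[OF assms(1)]) (use assms in \<open>auto simp: norm_mult\<close>)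

lemma ft_bound:
  assumes "integrable lborel f" shows "cmod (ft f \<xi>) \<le> (LINT x|lborel. cmod (f x))"
proof -
  have "cmod (ft f \<xi>) \<le> (LINT x|lborel. cmod (f x * cis (- 2 * pi * (x \<bullet> \<xi>))))"
    unfolding ft_def by (rule integral_norm_bound)
  then show ?thesis by (simp add: norm_mult)
qed

lemma continuous_on_ft:
  assumes "integrable lborel f" shows "continuous_on UNIV (ft f)"
proof (rule continuous_at_imp_continuous_on, intro ballI, rule continuous_at_sequentiallyI)
  fix \<xi> and X :: "nat \<Rightarrow> real^'a" assume X: "X \<longlonglongrightarrow> \<xi>"
  have [measurable]: "f \<in> borel_measurable borel" using assms by auto
  show "(\<lambda>n. ft f (X n)) \<longlonglongrightarrow> ft f \<xi>"
    unfolding ft_def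
  proof (rule integral_dominated_convergence)
    show "integrable lborel (\<lambda>x. cmod (f x))" using assms by simp
    show "AE x in lborel. (\<lambda>n. f x * cis (- 2 * pi * (x \<bullet> X n))) \<longlonglongrightarrow> f x * cis (- 2 * pi * (x \<bullet> \<xi>))"
      using X by (intro AE_I2 tendsto_intros)
  qed (auto simp: norm_mult)
qed

lemma borel_measurable_ft: "integrable lborel f \<Longrightarrow> ft f \<in> borel_measurable borel"
  by (rule borel_measurable_continuous_onI[OF continuous_on_ft])

lemma ft_mult_formula:
  assumes f: "integrable lborel f" and g: "integrable lborel g"
  shows "(LINT x|lborel. ft f x * g x) = (LINT x|lborel. f x * ft g x)"
proof -
  have [measurable]: "f \<in> borel_measurable borel" "g \<in> borel_measurable borel"
    using f g by auto
  have "integrable (lborel \<Otimes>\<^sub>M lborel) (\<lambda>(x, y). f x * g y * (\<lambda>(x, y). cis (- 2 * pi * (x \<bullet> y))) (x, y))"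
    by (rule integrable_lborel_pair_mult[OF f g]) (auto simp: split_beta)
  then have "integrable (lborel \<Otimes>\<^sub>M lborel) (\<lambda>(x, y). f x * g y * cis (- 2 * pi * (x \<bullet> y)))" by simp
  from lborel_pair.Fubini_integral[OF this]
  have "(LINT y|lborel. LINT x|lborel. f x * cis (- 2 * pi * (x \<bullet> y)) * g y)
      = (LINT x|lborel. LINT y|lborel. f x * (g y * cis (- 2 * pi * (y \<bullet> x))))"
    by (simp add: mult_ac inner_commute)
  then show ?thesis unfolding ft_def
    by (subst (asm) integral_mult_left_zero, subst (asm) integral_mult_right_zero)
qed

text \<open>Multiplying \<open>g\<close> by a character shifts its transform, so the multiplication
  formula applies to \<open>k\<close> and the modulated \<open>g\<close>. Both the Gaussian
  regularisation and the convolution theorem rest on this identity.\<close>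

lemma ft_ft_mult:
  assumes k: "integrable lborel k" and g: "integrable lborel g"
  shows "ft (\<lambda>\<xi>. ft k \<xi> * g \<xi>) y = (LINT x|lborel. k x * ft g (x + y))"
proof -
  have [measurable]: "g \<in> borel_measurable borel" using g by auto
  have "ft (\<lambda>\<xi>. ft k \<xi> * g \<xi>) y = (LINT \<xi>|lborel. ft k \<xi> * (g \<xi> * cis (- 2 * pi * (\<xi> \<bullet> y))))"
    unfolding ft_def by (simp add: mult_ac)
  also have "\<dots> = (LINT x|lborel. k x * ft (\<lambda>\<xi>. g \<xi> * cis (- 2 * pi * (\<xi> \<bullet> y))) x)"
    by (intro ft_mult_formula k integrable_mult_cis g) measurable
  also have "(\<lambda>x. ft (\<lambda>\<xi>. g \<xi> * cis (- 2 * pi * (\<xi> \<bullet> y))) x) = (\<lambda>x. ft g (x + y))"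
    unfolding ft_def by (simp add: mult.assoc cis_mult inner_add_right algebra_simps)
  finally show ?thesis .
qed

subsection \<open>Gaussians\<close>

lemma char_gaussian_real:
  fixes \<alpha> t :: real
  assumes "\<alpha> > 0"
  shows "(LINT x|lborel. complex_of_real (sqrt (\<alpha> / pi) * exp (- \<alpha> * x\<^sup>2)) * cis (- 2 * pi * (x * t)))
      = complex_of_real (exp (- pi\<^sup>2 * t\<^sup>2 / \<alpha>))"
    and "integrable lborel (\<lambda>x. complex_of_real (sqrt (\<alpha> / pi) * exp (- \<alpha> * x\<^sup>2)) * cis (- 2 * pi * (x * t)))"
proof -
  \<comment> \<open>The substitution x -> c x turns alpha x^2 into half a square, so the integral
    becomes the characteristic function of the standard normal law at \<open>s\<close>.\<close>
  define c where "c = sqrt (2 * \<alpha>)"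
  define s where "s = - 2 * pi * t / c"
  have c: "c > 0" "c\<^sup>2 = 2 * \<alpha>" using assms by (auto simp: c_def)
  let ?h = "\<lambda>x. complex_of_real (std_normal_density x) * cis (s * x)"
  have eq: "complex_of_real (sqrt (\<alpha> / pi) * exp (- \<alpha> * x\<^sup>2)) * cis (- 2 * pi * (x * t))
      = c *\<^sub>R ?h (0 + c * x)" for x
  proof -
    have "sqrt (\<alpha> / pi) = c * (1 / sqrt (2 * pi))"
      unfolding c_def by (simp add: real_sqrt_divide real_sqrt_mult field_simps)
    moreover have "(c * x)\<^sup>2 / 2 = \<alpha> * x\<^sup>2" using c(2) by (simp add: power_mult_distrib)
    moreover have "s * (c * x) = - 2 * pi * (x * t)" using c(1) by (simp add: s_def)
    ultimately have "sqrt (\<alpha> / pi) * exp (- \<alpha> * x\<^sup>2) = c * std_normal_density (0 + c * x)"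
        "s * (0 + c * x) = - 2 * pi * (x * t)"
      unfolding std_normal_density_def by (simp_all add: mult.assoc[symmetric])
    then show ?thesis
      by (simp only: scaleR_conv_of_real of_real_mult mult.assoc)
  qed
  have int: "integrable lborel ?h"
    using integrable_normal_density[of 1 0]
    by (intro integrable_mult_cis integrable_of_real) (simp, measurable)
  have "(LINT x|lborel. ?h x) = char std_normal_distribution s"
    unfolding char_def by (subst integral_density) (auto simp: scaleR_conv_of_real cis_conv_exp mult.commute[of s])
  also have "\<dots> = complex_of_real (exp (- s\<^sup>2 / 2))" by (simp add: char_std_normal_distribution)
  also have "- s\<^sup>2 / 2 = - pi\<^sup>2 * t\<^sup>2 / \<alpha>" using c assms by (simp add: s_def power_divide power_mult_distrib field_simps)
  finally have *: "(LINT x|lborel. ?h x) = complex_of_real (exp (- pi\<^sup>2 * t\<^sup>2 / \<alpha>))" .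
  show "(LINT x|lborel. complex_of_real (sqrt (\<alpha> / pi) * exp (- \<alpha> * x\<^sup>2)) * cis (- 2 * pi * (x * t)))
      = complex_of_real (exp (- pi\<^sup>2 * t\<^sup>2 / \<alpha>))"
    unfolding eq *[symmetric] using lborel_integral_real_affine[of c ?h 0] c by simp
  show "integrable lborel (\<lambda>x. complex_of_real (sqrt (\<alpha> / pi) * exp (- \<alpha> * x\<^sup>2)) * cis (- 2 * pi * (x * t)))"
    unfolding eq using lborel_integrable_real_affine[OF int, of c 0] c by simp
qed

lemma gauss_eq_prod:
  fixes x \<xi> :: "real^'n::finite"
  assumes "\<alpha> > 0"
  shows "complex_of_real (gauss \<alpha> x) * cis (- 2 * pi * (x \<bullet> \<xi>))
     = (\<Prod>b\<in>Basis. complex_of_real (sqrt (\<alpha> / pi) * exp (- \<alpha> * (x \<bullet> b)\<^sup>2)) * cis (- 2 * pi * ((x \<bullet> b) * (\<xi> \<bullet> b))))"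
proof -
  have "(\<alpha> / pi) powr (real CARD('n) / 2) = sqrt (\<alpha> / pi) ^ CARD('n)"
    using assms by (simp add: powr_half_sqrt[symmetric] powr_power field_simps)
  moreover have "(norm x)\<^sup>2 = (\<Sum>b\<in>Basis. (x \<bullet> b)\<^sup>2)"
    unfolding power2_norm_eq_inner by (subst euclidean_inner) (simp add: power2_eq_square)
  moreover have "cis (- 2 * pi * (x \<bullet> \<xi>)) = (\<Prod>b\<in>Basis. cis (- 2 * pi * ((x \<bullet> b) * (\<xi> \<bullet> b))))"
  proof -
    have "cis (\<Sum>b\<in>A. f b) = (\<Prod>b\<in>A. cis (f b))" for A :: "(real^'n) set" and f
      by (induction A rule: infinite_finite_induct) (auto simp: cis_mult[symmetric])
    then show ?thesis by (subst euclidean_inner) (simp add: sum_distrib_left)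
  qed
  ultimately show ?thesis
    by (simp add: gauss_def prod.distrib exp_sum sum_negf[symmetric] sum_distrib_left)
qed

lemma
  fixes \<xi> :: "real^'n::finite"
  assumes "\<alpha> > 0"
  shows ft_gauss: "ft (\<lambda>x. complex_of_real (gauss \<alpha> x)) \<xi> = complex_of_real (exp (- pi\<^sup>2 * (norm \<xi>)\<^sup>2 / \<alpha>))"
    and integrable_gauss: "integrable lborel (gauss \<alpha> :: real^'n \<Rightarrow> real)"
proof -
  have "ft (\<lambda>x. complex_of_real (gauss \<alpha> x)) \<xi> = (\<Prod>b\<in>Basis. complex_of_real (exp (- pi\<^sup>2 * (\<xi> \<bullet> b)\<^sup>2 / \<alpha>)))"
    unfolding ft_def gauss_eq_prod[OF assms]
    by (subst lborel_integral_Basis_prod) (use char_gaussian_real[OF assms] in auto)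
  also have "\<dots> = complex_of_real (exp (\<Sum>b\<in>Basis. - pi\<^sup>2 * (\<xi> \<bullet> b)\<^sup>2 / \<alpha>))"
    by (simp only: exp_sum[OF finite_Basis] of_real_prod)
  also have "(\<Sum>b\<in>Basis. - pi\<^sup>2 * (\<xi> \<bullet> b)\<^sup>2 / \<alpha>) = - pi\<^sup>2 * (norm \<xi>)\<^sup>2 / \<alpha>"
    by (simp only: power2_norm_eq_inner euclidean_inner[of \<xi> \<xi>] power2_eq_square[of "_ \<bullet> _"] 
        sum_divide_distrib[symmetric] sum_distrib_left[symmetric])
  finally show "ft (\<lambda>x. complex_of_real (gauss \<alpha> x)) \<xi> = complex_of_real (exp (- pi\<^sup>2 * (norm \<xi>)\<^sup>2 / \<alpha>))" .
  have "integrable lborel (\<lambda>x::real^'n. complex_of_real (gauss \<alpha> x) * cis (- 2 * pi * (x \<bullet> 0)))"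
    unfolding gauss_eq_prod[OF assms]
    by (rule lborel_integral_Basis_prod) (use char_gaussian_real(2)[OF assms, of 0] in simp)
  then show "integrable lborel (gauss \<alpha> :: real^'n \<Rightarrow> real)"
    by (simp add: complex_of_real_integrable_eq)
qed

text \<open>Up to the constant \<open>p\<close> this function is the Gaussian with parameter pi^2 /
  alpha, and alpha -> pi^2 / alpha is an involution; Fourier inversion for Gaussians thus follows
  from \<open>ft_gauss\<close> alone.\<close>

lemma
  fixes x :: "real^'n::finite"
  assumes "\<alpha> > 0"
  shows ft_exp_norm: "ft (\<lambda>\<xi>. complex_of_real (exp (- pi\<^sup>2 * (norm \<xi>)\<^sup>2 / \<alpha>))) x = complex_of_real (gauss \<alpha> x)"
    and integrable_exp_norm: "integrable lborel (\<lambda>\<xi>::real^'n. exp (- pi\<^sup>2 * (norm \<xi>)\<^sup>2 / \<alpha>))"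
proof -
  define p where "p = (pi / \<alpha>) powr (real CARD('n) / 2)"
  have p: "p > 0" "(\<alpha> / pi) powr (real CARD('n) / 2) = 1 / p"
    using assms by (auto simp: p_def powr_divide)
  have E: "exp (- pi\<^sup>2 * (norm \<xi>)\<^sup>2 / \<alpha>) = (1 / p) * gauss (pi\<^sup>2 / \<alpha>) \<xi>" for \<xi> :: "real^'n"
    using p by (simp add: gauss_def p_def power2_eq_square)
  have pos: "pi\<^sup>2 / \<alpha> > 0" using assms by simp
  show "integrable lborel (\<lambda>\<xi>::real^'n. exp (- pi\<^sup>2 * (norm \<xi>)\<^sup>2 / \<alpha>))"
    unfolding E by (intro integrable_mult_right integrable_gauss pos)
  have "ft (\<lambda>\<xi>. complex_of_real (exp (- pi\<^sup>2 * (norm \<xi>)\<^sup>2 / \<alpha>))) x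
      = complex_of_real (1 / p) * ft (\<lambda>x. complex_of_real (gauss (pi\<^sup>2 / \<alpha>) x)) x"
    unfolding E ft_def of_real_mult mult.assoc by (rule integral_mult_right_zero)
  also have "\<dots> = complex_of_real (gauss \<alpha> x)"
    using assms p(2) by (subst ft_gauss[OF pos]) (simp add: gauss_def)
  finally show "ft (\<lambda>\<xi>. complex_of_real (exp (- pi\<^sup>2 * (norm \<xi>)\<^sup>2 / \<alpha>))) x = complex_of_real (gauss \<alpha> x)" .
qed

lemma integral_gauss: "\<alpha> > 0 \<Longrightarrow> (LINT x|lborel. (gauss \<alpha> :: real^'n::finite \<Rightarrow> real) x) = 1"
  using ft_gauss[of \<alpha> 0] by (simp add: ft_def flip: of_real_eq_iff)

lemma borel_measurable_cnj [measurable]: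
  "f \<in> borel_measurable M \<Longrightarrow> (\<lambda>x. cnj (f x)) \<in> borel_measurable M"
  by (rule borel_measurable_continuous_on[OF continuous_on_cnj[OF continuous_on_id]])

lemma integrable_mult_bounded:
  fixes f :: "'a \<Rightarrow> complex"
  assumes "integrable M f" "g \<in> borel_measurable M" "\<And>x. cmod (g x) \<le> C"
  shows "integrable M (\<lambda>x. f x * g x)"
proof (rule Bochner_Integration.integrable_bound[OF integrable_mult_right[OF assms(1), of "complex_of_real C"]])
  have "norm (f x * g x) \<le> norm (complex_of_real C * f x)" for x
    using mult_left_mono[OF order_trans[OF assms(3)[of x] abs_ge_self] norm_ge_zero[of "f x"]]
    by (simp add: norm_mult mult.commute)
  then show "AE x in M. norm (f x * g x) \<le> norm (complex_of_real C * f x)" by simp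
qed (use assms in auto)

subsection \<open>Bounded functions with bounded support\<close>

text \<open>The test class: small enough to lie in both L1 and L2, large enough to contain the
  truncations of every Borel function, and stable under multiplication by any continuous function,
  in particular by transforms.\<close>

definition bcs :: "(real^'n::finite \<Rightarrow> complex) \<Rightarrow> bool" where
  "bcs f \<longleftrightarrow> f \<in> borel_measurable borel \<and> bounded (range f) \<and> bounded {x. f x \<noteq> 0}"

lemma bcs_measurable: "bcs f \<Longrightarrow> f \<in> borel_measurable borel"
  by (simp add: bcs_def)

lemma bcs_bound:
  assumes "bcs f"
  obtains M R where "M > 0" "R > 0" "\<And>x. cmod (f x) \<le> M" "\<And>x. cmod (f x) \<le> M * indicator (cball 0 R) x"
proof -
  obtain M where M: "M > 0" "\<And>x. cmod (f x) \<le> M"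
    using assms by (auto simp: bcs_def bounded_pos)
  obtain R where R: "R > 0" "\<And>x. f x \<noteq> 0 \<Longrightarrow> norm x \<le> R"
    using assms by (auto simp: bcs_def bounded_pos)
  have "cmod (f x) \<le> M * indicator (cball 0 R) x" for x
    using M R(2)[of x] by (cases "f x = 0") (auto simp: indicator_def)
  with that M R(1) show ?thesis by blast
qed

lemma cball_in_sets_borel [measurable]: "cball c R \<in> sets borel"
  by (simp add: borel_closed)

lemma integrable_indicator_cball:
  "integrable lborel (\<lambda>x. M * indicator (cball c R) x :: real)" for c :: "'a::euclidean_space"
  by (intro integrable_mult_right integrable_real_indicator) (use emeasure_bounded_finite[OF bounded_cball] in auto)

lemma bcs_integrable: assumes "bcs f" shows "integrable lborel f"
proof -
  obtain M R where "\<And>x. cmod (f x) \<le> M * indicator (cball 0 R) x" using bcs_bound[OF assms] by metis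
  then show ?thesis
    by (intro Bochner_Integration.integrable_bound[OF integrable_indicator_cball[of M 0 R]])
       (use bcs_measurable[OF assms] in \<open>auto intro!: AE_I2 order_trans[OF _ abs_ge_self]\<close>)
qed

lemma bcs_L2: assumes "bcs f" shows "L2 f"
proof -
  obtain M R where M: "M > 0" "\<And>x. cmod (f x) \<le> M * indicator (cball 0 R) x"
    using bcs_bound[OF assms] by metis
  show ?thesis
  proof (rule L2_bound)
    show "integrable lebesgue (\<lambda>x. M\<^sup>2 * indicator (cball 0 R) x :: real)"
      using integrable_indicator_cball[of "M\<^sup>2" 0 R]
      by (subst integrable_completion) auto
    show "f \<in> borel_measurable lebesgue" using bcs_measurable[OF assms] by (simp add: measurable_completion)
    have "(cmod (f x))\<^sup>2 \<le> M\<^sup>2 * indicator (cball 0 R) x" for x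
      using power_mono[OF M(2)[of x], of 2] by (auto simp: indicator_def split: if_splits)
    then show "AE x in lebesgue. (cmod (f x))\<^sup>2 \<le> M\<^sup>2 * indicator (cball 0 R) x" by simp
  qed
qed

lemma bcs_mult_continuous:
  assumes "bcs g" "continuous_on UNIV k"
  shows "bcs (\<lambda>x. k x * g x)"
proof -
  obtain M R where M: "M > 0" "\<And>x. cmod (g x) \<le> M" "\<And>x. cmod (g x) \<le> M * indicator (cball 0 R) x"
    using bcs_bound[OF assms(1)] by metis
  have "bounded (k ` cball 0 R)"
    using assms(2) by (intro compact_imp_bounded compact_continuous_image) (auto intro: continuous_on_subset)
  then obtain B where B: "B > 0" "\<And>x. x \<in> cball 0 R \<Longrightarrow> cmod (k x) \<le> B"
    unfolding bounded_pos by blast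
  have "cmod (k x * g x) \<le> B * M" for x
  proof (cases "x \<in> cball 0 R")
    case True
    then show ?thesis unfolding norm_mult using B M by (intro mult_mono) auto
  next
    case False
    then have "g x = 0" using M(3)[of x] by simp
    then show ?thesis using B(1) M(1) by simp
  qed
  then have "bounded (range (\<lambda>x. k x * g x))" unfolding bounded_iff by auto
  moreover have "bounded {x. k x * g x \<noteq> 0}"
    using assms(1) by (auto simp: bcs_def intro: bounded_subset)
  ultimately show ?thesis
    using assms borel_measurable_continuous_onI[OF assms(2)] by (auto simp: bcs_def)
qed

lemma bcs_cnj: "bcs f \<Longrightarrow> bcs (\<lambda>x. cnj (f x))"
  unfolding bcs_def
  by (auto simp: bounded_iff)

lemma bcs_cmult: "bcs f \<Longrightarrow> bcs (\<lambda>x. c * f x)"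
  by (rule bcs_mult_continuous) auto

lemma bcs_diff:
  assumes "bcs f" "bcs g" shows "bcs (\<lambda>x. f x - g x)"
  unfolding bcs_def
proof (intro conjI)
  show "(\<lambda>x. f x - g x) \<in> borel_measurable borel" using assms by (auto simp: bcs_def)
  show "bounded (range (\<lambda>x. f x - g x))" using assms by (intro bounded_minus_comp) (auto simp: bcs_def)
  have "bounded ({x. f x \<noteq> 0} \<union> {x. g x \<noteq> 0})" using assms by (auto simp: bcs_def)
  then show "bounded {x. f x - g x \<noteq> 0}" by (rule bounded_subset) auto
qed

subsection \<open>Plancherel's identity\<close>

lemma continuous_approximation:
  fixes f :: "'a::euclidean_space \<Rightarrow> complex"
  assumes f: "f \<in> borel_measurable borel" and M: "\<And>x. cmod (f x) \<le> M" and "e > 0"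
  obtains G where "continuous_on UNIV G" "\<And>x. cmod (G x) \<le> M"
    "(LINT x|lborel. indicator (cball 0 R) x * cmod (f x - G x)) < e"
proof -
  have M0: "M \<ge> 0" using M[of 0] norm_ge_zero order_trans by blast
  have "f measurable_on UNIV"
    by (rule lebesgue_measurable_imp_measurable_on) (use f in \<open>auto simp: measurable_completion\<close>)
  then obtain N g where N: "negligible N" and g: "\<And>n. continuous_on UNIV (g n)"
    and lim: "\<And>x. x \<notin> N \<Longrightarrow> (\<lambda>n. g n x) \<longlonglongrightarrow> f x"
    unfolding measurable_on_def by auto
  \<comment> \<open>Projecting onto the ball of radius M preserves the limits, since the values of
    \<open>f\<close> lie in that ball, and supplies the uniform bound for dominated
    convergence.\<close>
  define G where "G n x = closest_point (cball 0 M) (g n x)" for n x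
  have "continuous_on UNIV (closest_point (cball (0::complex) M))"
    using M0 by (intro continuous_on_closest_point) auto
  then have Gc: "continuous_on UNIV (G n)" for n
    unfolding G_def using continuous_on_compose2[OF _ g] by blast
  have GM: "cmod (G n x) \<le> M" for n x
    unfolding G_def using closest_point_in_set[of "cball (0::complex) M"] M0 by (auto simp: mem_cball_0)
  have Glim: "(\<lambda>n. G n x) \<longlonglongrightarrow> f x" if "x \<notin> N" for x
  proof -
    have "isCont (closest_point (cball 0 M)) (f x)"
      using M0 by (intro continuous_at_closest_point) auto
    from isCont_tendsto_compose[OF this lim[OF that]]
    have "(\<lambda>n. G n x) \<longlonglongrightarrow> closest_point (cball 0 M) (f x)" by (simp add: G_def)
    then show ?thesis using M[of x] by (subst (asm) closest_point_self) (auto simp: mem_cball_0)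
  qed
  obtain N' where N': "N' \<in> null_sets lborel" "N \<subseteq> N'"
    using N by (auto simp: negligible_iff_null_sets null_sets_completion_iff2)
  have [measurable]: "G n \<in> borel_measurable borel" for n by (rule borel_measurable_continuous_onI[OF Gc])
  note [measurable] = f
  have "(\<lambda>n. LINT x|lborel. indicator (cball 0 R) x * cmod (f x - G n x)) \<longlonglongrightarrow> (LINT x|(lborel::'a measure). 0)"
  proof (rule integral_dominated_convergence)
    show "integrable lborel (\<lambda>x. (2 * M) * indicator (cball 0 R) x :: real)"
      by (rule integrable_indicator_cball)
    show "AE x in lborel. (\<lambda>n. indicator (cball 0 R) x * cmod (f x - G n x)) \<longlonglongrightarrow> 0"
    proof (rule AE_I'[OF N'(1)], rule subsetI, rule ccontr)
      fix x assume x: "x \<in> {x \<in> space lborel. \<not> (\<lambda>n. indicator (cball 0 R) x * cmod (f x - G n x)) \<longlonglongrightarrow> 0}"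
        and "x \<notin> N'"
      then have "(\<lambda>n. G n x) \<longlonglongrightarrow> f x" using Glim N' by auto
      then have "(\<lambda>n. indicator (cball 0 R) x * cmod (f x - G n x)) \<longlonglongrightarrow> indicator (cball 0 R) x * cmod (f x - f x)"
        by (intro tendsto_intros)
      with x show False by simp
    qed
    have "cmod (f x - G n x) \<le> 2 * M" for x n
      using norm_triangle_ineq4[of "f x" "G n x"] M[of x] GM[of n x] by linarith
    then show "AE x in lborel. norm (indicator (cball 0 R) x * cmod (f x - G n x)) \<le> (2 * M) * indicator (cball 0 R) x" for n
      by (intro AE_I2) (auto simp: indicator_def)
  qed auto
  then have "\<forall>\<^sub>F n in sequentially. (LINT x|lborel. indicator (cball 0 R) x * cmod (f x - G n x)) < e"
    using \<open>e > 0\<close> by (intro order_tendstoD) auto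
  then obtain n where "(LINT x|lborel. indicator (cball 0 R) x * cmod (f x - G n x)) < e"
    by (auto dest: eventually_happens)
  with that[of "G n"] Gc GM show ?thesis by blast
qed

text \<open>Since \<open>f\<close> is merely measurable, continuity under translation is borrowed
  from a continuous \<open>G\<close> close to it in L1 on a ball. The radius R + 1 leaves room for
  shifts with |w| < 1.\<close>

lemma autocorrelation_continuous_0:
  fixes f :: "real^'n::finite \<Rightarrow> complex"
  assumes "bcs f" "e > 0"
  shows "\<exists>\<delta>>0. \<forall>w. norm w < \<delta> \<longrightarrow>
    cmod ((LINT y|lborel. f y * cnj (f (y - w))) - (LINT y|lborel. f y * cnj (f y))) < e"
proof -
  obtain M R where M: "M > 0" "R > 0" "\<And>x. cmod (f x) \<le> M" "\<And>x. cmod (f x) \<le> M * indicator (cball 0 R) x"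
    using bcs_bound[OF assms(1)] by metis
  note [measurable] = bcs_measurable[OF assms(1)]
  have fi: "integrable lborel f" by (rule bcs_integrable[OF assms(1)])
  define V where "V = (LINT x|lborel. indicator (cball (0::real^'n) R) x :: real)"
  have V: "V \<ge> 0" unfolding V_def by simp
  \<comment> \<open>The final error is M times two approximation integrals, each contributing less
    than e/4, plus M e' V <= e/4. V + 1 keeps the denominator positive.\<close>
  define e' where "e' = e / (4 * M * (V + 1))"
  have e': "e' > 0" using assms(2) M V by (simp add: e'_def)
  have "M * (e' * V) = e / 4 * (V / (V + 1))" using M(1) by (simp add: e'_def)
  also have "\<dots> \<le> e / 4 * 1" using assms(2) V by (intro mult_left_mono) auto
  finally have e'V: "M * (e' * V) \<le> e / 4" by simp
  obtain G where G: "continuous_on UNIV G" "\<And>x. cmod (G x) \<le> M"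
    and GI: "(LINT x|lborel. indicator (cball 0 (R+1)) x * cmod (f x - G x)) < e / (4 * M)"
    using continuous_approximation[OF bcs_measurable[OF assms(1)] M(3), of "e / (4 * M)" "R + 1"] assms(2) M by auto
  have [measurable]: "G \<in> borel_measurable borel" by (rule borel_measurable_continuous_onI[OF G(1)])
  define H where "H x = indicator (cball 0 (R+1)) x * cmod (f x - G x)" for x
  have [measurable]: "H \<in> borel_measurable borel" unfolding H_def by measurable
  have Hint: "integrable lborel H"
  proof (rule Bochner_Integration.integrable_bound[OF integrable_indicator_cball[of "2*M" 0 "R+1"]])
    have "cmod (f x - G x) \<le> 2 * M" for x
      using norm_triangle_ineq4[of "f x" "G x"] M(3)[of x] G(2)[of x] by linarith
    then show "AE x in lborel. norm (H x) \<le> norm ((2 * M) * indicator (cball 0 (R + 1)) x :: real)"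
      using M(1) by (intro AE_I2) (auto simp: H_def indicator_def)
  qed simp
  have "uniformly_continuous_on (cball 0 (R+1)) G"
    using G(1) by (intro compact_uniformly_continuous) (auto intro: continuous_on_subset)
  then obtain \<delta> where \<delta>: "\<delta> > 0"
    "\<And>x y. x \<in> cball 0 (R+1) \<Longrightarrow> y \<in> cball 0 (R+1) \<Longrightarrow> dist x y < \<delta> \<Longrightarrow> dist (G x) (G y) < e'"
    using e' unfolding uniformly_continuous_on_def by metis
  show ?thesis
  proof (intro exI[of _ "min \<delta> 1"] conjI allI impI)
    fix w :: "real^'n" assume w: "norm w < min \<delta> 1"
    have fw: "integrable lborel (\<lambda>y. f y * cnj (f (y - w)))"
      by (rule integrable_mult_bounded[OF fi, of _ M]) (use M in auto)
    have f0: "integrable lborel (\<lambda>y. f y * cnj (f y))"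
      by (rule integrable_mult_bounded[OF fi, of _ M]) (use M in auto)
    \<comment> \<open>In order: |f - G| at y - w, the oscillation of \<open>G\<close> between y - w
      and y, and |f - G| at y.\<close>
    let ?\<psi> = "\<lambda>y. M * (H (- w + y) + e' * indicator (cball 0 R) y + H y)"
    have Hw: "integrable lborel (\<lambda>y. H (- w + y))" by (subst lborel_integral_isometry(3)) (use Hint in auto)
    have pt: "cmod (f y * cnj (f (y - w)) - f y * cnj (f y)) \<le> ?\<psi> y" for y
    proof (cases "y \<in> cball 0 R")
      case False
      then have "f y = 0" using M(4)[of y] by simp
      then show ?thesis using M(1) e' by (auto simp: H_def indicator_def)
    next
      case True
      have "norm (y - w) \<le> norm y + norm w" by (rule norm_triangle_ineq4)
      then have in1: "y - w \<in> cball 0 (R+1)" "y \<in> cball 0 (R+1)" using True w by auto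
      have "dist (G (y - w)) (G y) < e'" using w by (intro \<delta>(2) in1) (auto simp: dist_norm)
      then have "cmod (f (y - w) - f y) \<le> H (y - w) + e' + H y"
        using norm_triangle_ineq[of "f (y - w) - G (y - w)" "G (y - w) - G y + (G y - f y)"]
          norm_triangle_ineq[of "G (y - w) - G y" "G y - f y"] in1
        by (simp add: H_def dist_norm norm_minus_commute)
      moreover have "cmod (f y * cnj (f (y - w)) - f y * cnj (f y)) = cmod (f y) * cmod (f (y - w) - f y)"
        by (metis complex_cnj_diff complex_mod_cnj norm_mult right_diff_distrib)
      ultimately show ?thesis using M(3)[of y] M(1) True by (auto intro!: mult_mono)
    qed
    have "cmod ((LINT y|lborel. f y * cnj (f (y - w))) - (LINT y|lborel. f y * cnj (f y)))
        = cmod (LINT y|lborel. f y * cnj (f (y - w)) - f y * cnj (f y))"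
      using fw f0 by simp
    also have "\<dots> \<le> (LINT y|lborel. cmod (f y * cnj (f (y - w)) - f y * cnj (f y)))"
      by (rule integral_norm_bound)
    also have "\<dots> \<le> (LINT y|lborel. ?\<psi> y)"
    proof (rule integral_mono[OF _ _ pt])
      show "integrable lborel ?\<psi>"
        by (intro integrable_mult_right Bochner_Integration.integrable_add Hint Hw integrable_indicator_cball)
    qed (use fw f0 in auto)
    also have "\<dots> = M * ((LINT y|lborel. H y) + e' * V + (LINT y|lborel. H y))"
      using Hint Hw integrable_indicator_cball[of 1 "0::real^'n" R] lborel_integral_isometry(1)[of H "-w"]
      by (simp add: V_def)
    also have "\<dots> < e"
    proof -
      have "M * (LINT y|lborel. H y) < e / 4" using GI M(1) by (simp add: H_def field_simps)
      then show ?thesis using e'V assms(2) by (simp add: distrib_left)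
    qed
    finally show "cmod ((LINT y|lborel. f y * cnj (f (y - w))) - (LINT y|lborel. f y * cnj (f y))) < e" .
  qed (use \<delta> in auto)
qed

text \<open>Makes |ft f|^2 a product of two transforms, to which the multiplication formula
  applies.\<close>

lemma ft_cnj_reflect:
  assumes [measurable]: "f \<in> borel_measurable borel"
  shows "ft (\<lambda>x. cnj (f (- x))) \<xi> = cnj (ft f \<xi>)"
proof -
  have "ft (\<lambda>x. cnj (f (- x))) \<xi> = (LINT x|lborel. cnj (f (0 - x)) * cis (- 2 * pi * (x \<bullet> \<xi>)))"
    by (simp add: ft_def)
  also have "\<dots> = (LINT x|lborel. cnj (f (0 - x) * cis (- 2 * pi * ((0 - x) \<bullet> \<xi>))))"
    by (simp add: cis_cnj)
  also have "\<dots> = (LINT x|lborel. cnj (f x * cis (- 2 * pi * (x \<bullet> \<xi>))))"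
    by (rule lborel_integral_isometry(2)) measurable
  finally show ?thesis by (simp only: ft_def Bochner_Integration.integral_cnj)
qed

lemma gauss_nonneg: "gauss \<alpha> x \<ge> 0"
  by (simp add: gauss_def)

lemma borel_measurable_gauss [measurable]: "gauss \<alpha> \<in> borel_measurable borel"
  unfolding gauss_def by measurable

text \<open>Half of the exponent becomes a factor decaying in alpha, the other half survives as a
  Gaussian of mass 1; the power of 2 compares the two normalisations. Tails are thus bounded without
  computing a tail integral.\<close>

lemma gauss_tail:
  fixes w :: "real^'n::finite"
  assumes "\<alpha> > 0" "norm w \<ge> \<delta>" "\<delta> > 0"
  shows "gauss \<alpha> w \<le> 2 powr (real CARD('n) / 2) * exp (- \<alpha> * \<delta>\<^sup>2 / 2) * gauss (\<alpha> / 2) w"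
proof -
  have "\<alpha> * \<delta>\<^sup>2 \<le> \<alpha> * (norm w)\<^sup>2" using assms by (intro mult_left_mono power_mono) auto
  then have "exp (- \<alpha> * (norm w)\<^sup>2) \<le> exp (- \<alpha> * \<delta>\<^sup>2 / 2) * exp (- (\<alpha> / 2) * (norm w)\<^sup>2)"
    unfolding exp_add[symmetric] by simp
  moreover have "(\<alpha> / pi) powr (real CARD('n) / 2)
      = 2 powr (real CARD('n) / 2) * (\<alpha> / 2 / pi) powr (real CARD('n) / 2)"
    using assms(1) by (simp add: powr_mult[symmetric])
  ultimately have "gauss \<alpha> w \<le> (2 powr (real CARD('n) / 2) * (\<alpha> / 2 / pi) powr (real CARD('n) / 2))
      * (exp (- \<alpha> * \<delta>\<^sup>2 / 2) * exp (- (\<alpha> / 2) * (norm w)\<^sup>2))"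
    unfolding gauss_def by (intro mult_mono) auto
  then show ?thesis by (simp add: gauss_def mult_ac)
qed

lemma gauss_approximate_identity:
  fixes A :: "real^'n::finite \<Rightarrow> complex"
  assumes [measurable]: "A \<in> borel_measurable borel" and C: "\<And>w. cmod (A w) \<le> C"
    and cont: "\<And>e. e > 0 \<Longrightarrow> \<exists>\<delta>>0. \<forall>w. norm w < \<delta> \<longrightarrow> cmod (A w - A 0) < e"
  shows "(\<lambda>n. LINT w|lborel. complex_of_real (gauss (real (Suc n)) w) * A w) \<longlonglongrightarrow> A 0"
proof (rule LIMSEQ_I)
  fix e :: real assume e: "e > 0"
  obtain \<delta> where \<delta>: "\<delta> > 0" "\<And>w. norm w < \<delta> \<Longrightarrow> cmod (A w - A 0) < e / 2" using cont[of "e/2"] e by auto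
  \<comment> \<open>2C bounds |A w - A 0|, and the power of 2 is the one from
    \<open>gauss_tail\<close>.\<close>
  define B where "B = 2 * C * 2 powr (real CARD('n) / 2)"
  have C0: "C \<ge> 0" using C[of 0] norm_ge_zero order_trans by blast
  have "(\<lambda>n. B * exp (- real (Suc n) * \<delta>\<^sup>2 / 2)) \<longlonglongrightarrow> 0"
  proof -
    have "(\<lambda>n. exp (- \<delta>\<^sup>2 / 2) ^ Suc n) \<longlonglongrightarrow> 0"
      using \<delta>(1) by (intro LIMSEQ_Suc[OF LIMSEQ_power_zero]) simp
    moreover have "exp (- \<delta>\<^sup>2 / 2) ^ Suc n = exp (- real (Suc n) * \<delta>\<^sup>2 / 2)" for n
      by (subst exp_of_nat_mult[symmetric]) (simp add: algebra_simps)
    ultimately show ?thesis using tendsto_mult_right_zero by fastforce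
  qed
  then have "\<forall>\<^sub>F n in sequentially. B * exp (- real (Suc n) * \<delta>\<^sup>2 / 2) < e / 2"
    using e by (intro order_tendstoD) auto
  then obtain N where N: "\<And>n. n \<ge> N \<Longrightarrow> B * exp (- real (Suc n) * \<delta>\<^sup>2 / 2) < e / 2"
    by (auto simp: eventually_sequentially)
  show "\<exists>no. \<forall>n\<ge>no. norm ((LINT w|lborel. complex_of_real (gauss (real (Suc n)) w) * A w) - A 0) < e"
  proof (intro exI[of _ N] allI impI)
    fix n assume n: "n \<ge> N"
    let ?\<alpha> = "real (Suc n)"
    have \<alpha>: "?\<alpha> > 0" "?\<alpha> / 2 > 0" by auto
    have gi: "integrable lborel (\<lambda>w::real^'n. complex_of_real (gauss ?\<alpha> w))"
      by (intro integrable_of_real integrable_gauss \<alpha>)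
    have Ai: "integrable lborel (\<lambda>w. complex_of_real (gauss ?\<alpha> w) * A w)"
      by (rule integrable_mult_bounded[OF gi _ C]) simp
    have "(LINT w|lborel. complex_of_real (gauss ?\<alpha> w) * A w) - A 0
        = (LINT w|lborel. complex_of_real (gauss ?\<alpha> w) * A w - complex_of_real (gauss ?\<alpha> w) * A 0)"
      using Ai gi integral_gauss[OF \<alpha>(1), where 'n='n] by (subst Bochner_Integration.integral_diff) auto
    then have "norm ((LINT w|lborel. complex_of_real (gauss ?\<alpha> w) * A w) - A 0)
       \<le> (LINT w|lborel. norm (complex_of_real (gauss ?\<alpha> w) * A w - complex_of_real (gauss ?\<alpha> w) * A 0))"
      using integral_norm_bound by simp
    also have "\<dots> \<le> (LINT w|lborel. e / 2 * gauss ?\<alpha> w + B * exp (- ?\<alpha> * \<delta>\<^sup>2 / 2) * gauss (?\<alpha> / 2) (w::real^'n))"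
    proof (rule integral_mono)
      fix w :: "real^'n"
      have n1: "norm (complex_of_real (gauss ?\<alpha> w) * A w - complex_of_real (gauss ?\<alpha> w) * A 0)
          = gauss ?\<alpha> w * cmod (A w - A 0)"
        unfolding right_diff_distrib[symmetric] norm_mult by (simp add: gauss_nonneg)
      show "norm (complex_of_real (gauss ?\<alpha> w) * A w - complex_of_real (gauss ?\<alpha> w) * A 0)
         \<le> e / 2 * gauss ?\<alpha> w + B * exp (- ?\<alpha> * \<delta>\<^sup>2 / 2) * gauss (?\<alpha> / 2) w"
      proof (cases "norm w < \<delta>")
        case True
        have "gauss ?\<alpha> w * cmod (A w - A 0) \<le> gauss ?\<alpha> w * (e / 2)"
          using \<delta>(2)[OF True] by (intro mult_left_mono gauss_nonneg) simp
        moreover have "B * exp (- ?\<alpha> * \<delta>\<^sup>2 / 2) * gauss (?\<alpha> / 2) w \<ge> 0"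
          using C0 by (intro mult_nonneg_nonneg gauss_nonneg) (auto simp: B_def)
        ultimately show ?thesis unfolding n1 by (simp add: mult.commute)
      next
        case False
        have "cmod (A w - A 0) \<le> 2 * C" using norm_triangle_ineq4[of "A w" "A 0"] C[of w] C[of 0] by linarith
        then have "gauss ?\<alpha> w * cmod (A w - A 0)
            \<le> (2 powr (real CARD('n) / 2) * exp (- ?\<alpha> * \<delta>\<^sup>2 / 2) * gauss (?\<alpha> / 2) w) * (2 * C)"
          using False by (intro mult_mono gauss_tail \<delta> \<alpha>) (auto intro!: mult_nonneg_nonneg gauss_nonneg)
        moreover have "e / 2 * gauss ?\<alpha> w \<ge> 0" using e by (simp add: gauss_nonneg)
        ultimately show ?thesis unfolding n1 B_def by (simp add: mult_ac)
      qed
    next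
      show "integrable lborel (\<lambda>w::real^'n. e / 2 * gauss ?\<alpha> w + B * exp (- ?\<alpha> * \<delta>\<^sup>2 / 2) * gauss (?\<alpha> / 2) w)"
        by (intro Bochner_Integration.integrable_add integrable_mult_right integrable_gauss \<alpha>)
    qed (use Ai gi in auto)
    also have "\<dots> = e / 2 + B * exp (- ?\<alpha> * \<delta>\<^sup>2 / 2)"
      using integrable_gauss[OF \<alpha>(1), where 'n='n] integrable_gauss[OF \<alpha>(2), where 'n='n]
        integral_gauss[OF \<alpha>(1), where 'n='n] integral_gauss[OF \<alpha>(2), where 'n='n]
      by (subst Bochner_Integration.integral_add) auto
    also have "\<dots> < e" using N[OF n] by simp
    finally show "norm ((LINT w|lborel. complex_of_real (gauss ?\<alpha> w) * A w) - A 0) < e" .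
  qed
qed

text \<open>The multiplication formula moves the transform off \<open>f\<close>; the other factor
  becomes a Gaussian average of translates of conj f, and exchanging integrals leaves the
  autocorrelation. The Gaussian weight makes the left side converge before \<open>ft f\<close> is
  known to be square integrable.\<close>

lemma ft_sq_gaussian_mean:
  fixes f :: "real^'n::finite \<Rightarrow> complex"
  assumes "bcs f" "\<alpha> > 0"
  shows "(LINT \<xi>|lborel. ft f \<xi> * cnj (ft f \<xi>) * complex_of_real (exp (- pi\<^sup>2 * (norm \<xi>)\<^sup>2 / \<alpha>)))
    = (LINT w|lborel. complex_of_real (gauss \<alpha> w) * (LINT y|lborel. f y * cnj (f (y - w))))"
proof -
  obtain M where M: "M > 0" "\<And>x. cmod (f x) \<le> M" using bcs_bound[OF assms(1)] by metis
  note [measurable] = bcs_measurable[OF assms(1)]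
  have fi: "integrable lborel f" by (rule bcs_integrable[OF assms(1)])
  note [measurable] = borel_measurable_ft[OF fi]
  define k where "k x = cnj (f (- x))" for x
  let ?E = "\<lambda>\<xi>::real^'n. complex_of_real (exp (- pi\<^sup>2 * (norm \<xi>)\<^sup>2 / \<alpha>))"
  have [measurable]: "k \<in> borel_measurable borel" unfolding k_def by measurable
  have ki: "integrable lborel k"
    using lborel_integral_isometry(4)[of f 0] fi unfolding k_def by simp
  have kE: "ft k = (\<lambda>\<xi>. cnj (ft f \<xi>))" unfolding k_def by (rule ext) (rule ft_cnj_reflect, measurable)
  have Ei: "integrable lborel ?E" by (intro integrable_of_real integrable_exp_norm assms)
  have gi: "integrable lborel (\<lambda>w::real^'n. complex_of_real (gauss \<alpha> w))"
    by (intro integrable_of_real integrable_gauss assms)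
  have kEi: "integrable lborel (\<lambda>\<xi>. ft k \<xi> * ?E \<xi>)"
    using integrable_mult_bounded[OF Ei _ ft_bound[OF ki]] borel_measurable_ft[OF ki] by (simp add: mult.commute)
  have "(LINT \<xi>|lborel. ft f \<xi> * cnj (ft f \<xi>) * ?E \<xi>) = (LINT \<xi>|lborel. ft f \<xi> * (ft k \<xi> * ?E \<xi>))"
    by (simp add: kE mult.assoc)
  also have "\<dots> = (LINT y|lborel. f y * ft (\<lambda>\<xi>. ft k \<xi> * ?E \<xi>) y)"
    by (rule ft_mult_formula[OF fi kEi])
  also have "\<dots> = (LINT y|lborel. f y * (LINT w|lborel. complex_of_real (gauss \<alpha> w) * cnj (f (y - w))))"
  proof (intro Bochner_Integration.integral_cong refl arg_cong2[where f = "(*)"])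
    fix y
    have "ft (\<lambda>\<xi>. ft k \<xi> * ?E \<xi>) y = (LINT x|lborel. k x * complex_of_real (gauss \<alpha> (x + y)))"
      unfolding ft_ft_mult[OF ki Ei] ft_exp_norm[OF assms(2)] ..
    also have "\<dots> = (LINT w|lborel. k (- y + w) * complex_of_real (gauss \<alpha> ((- y + w) + y)))"
      by (rule lborel_integral_isometry(1)[symmetric]) measurable
    finally show "ft (\<lambda>\<xi>. ft k \<xi> * ?E \<xi>) y = (LINT w|lborel. complex_of_real (gauss \<alpha> w) * cnj (f (y - w)))"
      by (simp add: k_def mult.commute)
  qed
  also have "\<dots> = (LINT y|lborel. LINT w|lborel. f y * (complex_of_real (gauss \<alpha> w) * cnj (f (y - w))))"
    by simp
  also have "\<dots> = (LINT w|lborel. LINT y|lborel. f y * (complex_of_real (gauss \<alpha> w) * cnj (f (y - w))))"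
  proof (rule lborel_pair.Fubini_integral[symmetric])
    \<comment> \<open>The kernel has to be bounded by 1, so conj f is divided by M here and M is
      multiplied back afterwards.\<close>
    have "integrable (lborel \<Otimes>\<^sub>M lborel) (\<lambda>(y, w). f y * complex_of_real (gauss \<alpha> w) * (\<lambda>(y, w). cnj (f (y - w)) / M) (y, w))"
      by (rule integrable_lborel_pair_mult[OF fi gi])
         (use M in \<open>auto simp: split_beta norm_divide\<close>)
    from integrable_mult_right[OF this, of "complex_of_real M"]
    show "integrable (lborel \<Otimes>\<^sub>M lborel) (\<lambda>(y, w). f y * (complex_of_real (gauss \<alpha> w) * cnj (f (y - w))))"
      using M(1) by (simp add: case_prod_unfold mult_ac)
  qed
  also have "\<dots> = (LINT w|lborel. complex_of_real (gauss \<alpha> w) * (LINT y|lborel. f y * cnj (f (y - w))))"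
    by (simp add: mult.left_commute[of "f _"])
  finally show ?thesis .
qed

text \<open>As alpha tends to infinity, the regularised integrals of |ft f|^2 increase to the full
  one while the Gaussian means tend to the autocorrelation at 0, the squared norm of
  \<open>f\<close>. Monotone convergence yields integrability and value at once.\<close>

theorem plancherel_bcs:
  fixes f :: "real^'n::finite \<Rightarrow> complex"
  assumes "bcs f"
  shows "L2 (ft f)" "L2norm (ft f) = L2norm f"
proof -
  obtain M where M: "M > 0" "\<And>x. cmod (f x) \<le> M" using bcs_bound[OF assms(1)] by metis
  note [measurable] = bcs_measurable[OF assms(1)]
  have fi: "integrable lborel f" by (rule bcs_integrable[OF assms(1)])
  note [measurable] = borel_measurable_ft[OF fi]
  define A where "A w = (LINT y|lborel. f y * cnj (f (y - w)))" for w
  have [measurable]: "A \<in> borel_measurable borel" unfolding A_def by measurable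
  have Abound: "cmod (A w) \<le> (LINT y|lborel. cmod (f y) * M)" for w
  proof -
    have "cmod (A w) \<le> (LINT y|lborel. cmod (f y * cnj (f (y - w))))"
      unfolding A_def by (rule integral_norm_bound)
    also have "\<dots> \<le> (LINT y|lborel. cmod (f y) * M)"
    proof (rule integral_mono)
      show "integrable lborel (\<lambda>y. cmod (f y * cnj (f (y - w))))"
        by (intro integrable_norm integrable_mult_bounded[OF fi, of _ M]) (use M in auto)
    qed (use fi M in \<open>auto simp: norm_mult intro!: mult_left_mono\<close>)
    finally show ?thesis .
  qed
  let ?E = "\<lambda>n (\<xi>::real^'n). exp (- pi\<^sup>2 * (norm \<xi>)\<^sup>2 / real (Suc n))"
  have "(\<lambda>n. LINT w|lborel. complex_of_real (gauss (real (Suc n)) w) * A w) \<longlonglongrightarrow> A 0"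
    by (rule gauss_approximate_identity[OF _ Abound])
       (use autocorrelation_continuous_0[OF assms] in \<open>auto simp: A_def\<close>)
  moreover have "(LINT w|lborel. complex_of_real (gauss (real (Suc n)) w) * A w)
      = complex_of_real (LINT \<xi>|lborel. (cmod (ft f \<xi>))\<^sup>2 * ?E n \<xi>)" for n
    unfolding A_def
  proof (subst ft_sq_gaussian_mean[OF assms, symmetric])
    have "ft f \<xi> * cnj (ft f \<xi>) * complex_of_real (?E n \<xi>) = complex_of_real ((cmod (ft f \<xi>))\<^sup>2 * ?E n \<xi>)" for \<xi>
      by (simp only: of_real_mult complex_norm_square)
    then show "(LINT \<xi>|lborel. ft f \<xi> * cnj (ft f \<xi>) * complex_of_real (?E n \<xi>))
        = complex_of_real (LINT \<xi>|lborel. (cmod (ft f \<xi>))\<^sup>2 * ?E n \<xi>)"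
      by (simp only: integral_complex_of_real)
  qed simp
  moreover have "A 0 = complex_of_real (LINT y|lborel. (cmod (f y))\<^sup>2)"
    by (simp only: A_def complex_norm_square[symmetric] integral_complex_of_real diff_zero)
  ultimately have lim: "(\<lambda>n. LINT \<xi>|lborel. (cmod (ft f \<xi>))\<^sup>2 * ?E n \<xi>) \<longlonglongrightarrow> (LINT y|lborel. (cmod (f y))\<^sup>2)"
    by (simp only: tendsto_of_real_iff)
  have Ei: "integrable lborel (\<lambda>\<xi>. (cmod (ft f \<xi>))\<^sup>2 * ?E n \<xi>)" for n
  proof (rule Bochner_Integration.integrable_bound)
    show "integrable lborel (\<lambda>\<xi>. (LINT x|lborel. cmod (f x))\<^sup>2 * ?E n \<xi>)"
      by (intro integrable_mult_right integrable_exp_norm) simp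
    show "AE \<xi> in lborel. norm ((cmod (ft f \<xi>))\<^sup>2 * ?E n \<xi>) \<le> norm ((LINT x|lborel. cmod (f x))\<^sup>2 * ?E n \<xi>)"
      using ft_bound[OF fi] by (auto intro!: mult_right_mono power_mono)
  qed measurable
  have mono: "AE \<xi> in lborel. mono (\<lambda>n. (cmod (ft f \<xi>))\<^sup>2 * ?E n \<xi>)"
    by (intro AE_I2 monoI mult_left_mono) (auto intro!: divide_left_mono mult_pos_pos)
  have ptlim: "AE \<xi> in lborel. (\<lambda>n. (cmod (ft f \<xi>))\<^sup>2 * ?E n \<xi>) \<longlonglongrightarrow> (cmod (ft f \<xi>))\<^sup>2"
  proof (intro AE_I2)
    fix \<xi> :: "real^'n"
    have "(\<lambda>n. exp (- pi\<^sup>2 * (norm \<xi>)\<^sup>2 / real (Suc n))) \<longlonglongrightarrow> exp 0"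
      by (intro tendsto_exp LIMSEQ_Suc[OF lim_const_over_n])
    from tendsto_mult_left[OF this] show "(\<lambda>n. (cmod (ft f \<xi>))\<^sup>2 * ?E n \<xi>) \<longlonglongrightarrow> (cmod (ft f \<xi>))\<^sup>2" by simp
  qed
  have res: "integrable lborel (\<lambda>\<xi>. (cmod (ft f \<xi>))\<^sup>2)"
      "(LINT \<xi>|lborel. (cmod (ft f \<xi>))\<^sup>2) = (LINT y|lborel. (cmod (f y))\<^sup>2)"
    using integral_monotone_convergence_nonneg[OF Ei mono _ ptlim lim] by auto
  show "L2 (ft f)" unfolding L2_def using res(1)
    by (auto simp: integrable_completion intro: measurable_completion)
  show "L2norm (ft f) = L2norm f" unfolding L2norm_def using res(2) by (simp add: integral_completion)
qed

subsection \<open>The Fourier transform on square-integrable functions\<close>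

definition trunc :: "nat \<Rightarrow> (real^'n::finite \<Rightarrow> complex) \<Rightarrow> real^'n \<Rightarrow> complex" where
  "trunc k f x = (if norm x \<le> real k \<and> cmod (f x) \<le> real k then f x else 0)"

lemma bcs_trunc:
  assumes [measurable]: "f \<in> borel_measurable borel" shows "bcs (trunc k f)"
  unfolding bcs_def
proof (intro conjI)
  show "trunc k f \<in> borel_measurable borel" unfolding trunc_def by measurable
  show "bounded (range (trunc k f))" unfolding bounded_iff trunc_def by (auto intro!: exI[of _ "real k"])
  show "bounded {x. trunc k f x \<noteq> 0}" unfolding bounded_iff trunc_def
    by (auto intro!: exI[of _ "real k"] split: if_splits)
qed

lemma trunc_eventually: "\<forall>\<^sub>F k in sequentially. trunc k f x = f x"
proof -
  obtain N :: nat where N: "max (norm x) (cmod (f x)) \<le> real N" using real_arch_simple by blast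
  have "trunc k f x = f x" if "k \<ge> N" for k
    using N that by (auto simp: trunc_def)
  then show ?thesis by (auto simp: eventually_sequentially)
qed

lemma trunc_tendsto:
  assumes "f \<in> borel_measurable borel" "L2 f"
  shows "(\<lambda>k. L2norm (\<lambda>x. trunc k f x - f x)) \<longlonglongrightarrow> 0"
proof -
  have [measurable]: "f \<in> borel_measurable lebesgue" using assms(2) by (rule L2_measurable)
  have [measurable]: "trunc k f \<in> borel_measurable lebesgue" for k
    using bcs_L2[OF bcs_trunc[OF assms(1)]] by (rule L2_measurable)
  have "(\<lambda>k. LINT x|lebesgue. (cmod (trunc k f x - f x))\<^sup>2) \<longlonglongrightarrow> (LINT x|(lebesgue::(real^'a) measure). 0)"
  proof (rule integral_dominated_convergence)
    show "integrable lebesgue (\<lambda>x. (cmod (f x))\<^sup>2)" using assms(2) by (rule L2_integrable)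
    have "(\<lambda>k. (cmod (trunc k f x - f x))\<^sup>2) \<longlonglongrightarrow> 0" for x
      by (rule tendsto_eventually) (use trunc_eventually[of f x] in eventually_elim, simp)
    then show "AE x in lebesgue. (\<lambda>k. (cmod (trunc k f x - f x))\<^sup>2) \<longlonglongrightarrow> 0" by simp
    show "AE x in lebesgue. norm ((cmod (trunc k f x - f x))\<^sup>2) \<le> (cmod (f x))\<^sup>2" for k
      by (intro AE_I2) (auto simp: trunc_def)
  qed auto
  from tendsto_real_sqrt[OF this] show ?thesis by (simp add: L2norm_def)
qed

lemma L2norm_eq_0_AE:
  assumes "L2 f" "L2norm f = 0" shows "AE x in lebesgue. f x = 0"
proof -
  have "(LINT x|lebesgue. (cmod (f x))\<^sup>2) = 0" using assms(2) by (simp add: L2norm_def)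
  then have "AE x in lebesgue. (cmod (f x))\<^sup>2 = 0"
    by (subst (asm) integral_nonneg_eq_0_iff_AE[OF L2_integrable[OF assms(1)]]) auto
  then show ?thesis by simp
qed

text \<open>Testing against the conjugate of a truncation of \<open>h\<close> gives the squared norm
  of that truncation; countably many truncations exhaust \<open>h\<close>.\<close>

lemma L2_weakly_zero:
  assumes "L2 h" and z: "\<And>g. bcs g \<Longrightarrow> (LINT x|lebesgue. h x * g x) = 0"
  shows "AE x in lebesgue. h x = 0"
proof -
  obtain h' where h': "h' \<in> borel_measurable borel" "AE x in lebesgue. h x = h' x" "L2 h'"
    by (rule L2_Borel_version[OF assms(1)])
  have "AE x in lebesgue. trunc k h' x = 0" for k
  proof (rule L2norm_eq_0_AE)
    have b: "bcs (trunc k h')" by (rule bcs_trunc[OF h'(1)])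
    then show "L2 (trunc k h')" by (rule bcs_L2)
    have "complex_of_real ((L2norm (trunc k h'))\<^sup>2) = (LINT x|lebesgue. trunc k h' x * cnj (trunc k h' x))"
      by (simp only: L2norm_sq complex_norm_square[symmetric] integral_complex_of_real)
    also have "\<dots> = (LINT x|lebesgue. h' x * cnj (trunc k h' x))"
      by (intro Bochner_Integration.integral_cong) (auto simp: trunc_def)
    also have "\<dots> = (LINT x|lebesgue. h x * cnj (trunc k h' x))"
      using L2_measurable[OF h'(3)] L2_measurable[OF assms(1)] L2_measurable[OF bcs_L2[OF bcs_cnj[OF b]]] h'(2)
      by (intro integral_cong_AE) auto
    also have "\<dots> = 0" by (rule z[OF bcs_cnj[OF b]])
    finally show "L2norm (trunc k h') = 0" by simp
  qed
  then have "AE x in lebesgue. \<forall>k. trunc k h' x = 0" by (simp add: AE_all_countable)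
  then show ?thesis using h'(2)
  proof eventually_elim
    case (elim x)
    then show ?case using trunc_eventually[of h' x] by (auto dest: eventually_happens)
  qed
qed

text \<open>Being a relation given by the multiplication formula, the transform is insensitive to null sets, and
  the convolution theorem is immediate because \<open>ft k\<close> times a test function is again a test function.\<close>

definition FT :: "(real^'n::finite \<Rightarrow> complex) \<Rightarrow> (real^'n \<Rightarrow> complex) \<Rightarrow> bool" where
  "FT f h \<longleftrightarrow> L2 f \<and> L2 h \<and>
     (\<forall>g. bcs g \<longrightarrow> (LINT x|lebesgue. h x * g x) = (LINT x|lebesgue. f x * ft g x))"

lemma FT_L2: "FT f h \<Longrightarrow> L2 f" "FT f h \<Longrightarrow> L2 h"
  by (auto simp: FT_def)

lemma FT_D: "FT f h \<Longrightarrow> bcs g \<Longrightarrow> (LINT x|lebesgue. h x * g x) = (LINT x|lebesgue. f x * ft g x)"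
  by (auto simp: FT_def)

lemma FT_bcs: assumes "bcs f" shows "FT f (ft f)"
  unfolding FT_def
proof (intro conjI allI impI)
  show "L2 f" "L2 (ft f)" by (fact bcs_L2[OF assms] plancherel_bcs(1)[OF assms])+
  fix g :: "real^'a \<Rightarrow> complex" assume g: "bcs g"
  have [measurable]: "f \<in> borel_measurable borel" "g \<in> borel_measurable borel"
    "ft f \<in> borel_measurable borel" "ft g \<in> borel_measurable borel"
    using assms g by (auto simp: bcs_measurable intro!: borel_measurable_ft bcs_integrable)
  show "(LINT x|lebesgue. ft f x * g x) = (LINT x|lebesgue. f x * ft g x)"
    using ft_mult_formula[OF bcs_integrable[OF assms] bcs_integrable[OF g]]
    by (simp add: integral_completion)
qed

lemma FT_add: assumes "FT f h" "FT f' h'" shows "FT (\<lambda>x. f x + f' x) (\<lambda>x. h x + h' x)"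
  unfolding FT_def
proof (intro conjI allI impI L2_add)
  fix g :: "real^'a \<Rightarrow> complex" assume g: "bcs g"
  show "(LINT x|lebesgue. (h x + h' x) * g x) = (LINT x|lebesgue. (f x + f' x) * ft g x)"
    unfolding distrib_right
    using FT_D[OF assms(1) g] FT_D[OF assms(2) g] assms bcs_L2[OF g] plancherel_bcs(1)[OF g]
    by (simp add: L2_mult_integrable FT_L2)
qed (use assms in \<open>auto simp: FT_L2\<close>)

lemma FT_cmult: assumes "FT f h" shows "FT (\<lambda>x. c * f x) (\<lambda>x. c * h x)"
  unfolding FT_def
proof (intro conjI allI impI L2_cmult)
  fix g :: "real^'a \<Rightarrow> complex" assume g: "bcs g"
  show "(LINT x|lebesgue. c * h x * g x) = (LINT x|lebesgue. c * f x * ft g x)"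
    using FT_D[OF assms g] by (simp add: mult.assoc)
qed (use assms in \<open>auto simp: FT_L2\<close>)

lemma FT_diff: assumes "FT f h" "FT f' h'" shows "FT (\<lambda>x. f x - f' x) (\<lambda>x. h x - h' x)"
  using FT_add[OF assms(1) FT_cmult[OF assms(2), of "-1"]] by simp

lemma FT_zero: "FT (\<lambda>x. 0) (\<lambda>x. 0)"
  by (simp add: FT_def L2_zero)

lemma FT_sum: "finite A \<Longrightarrow> (\<And>i. i \<in> A \<Longrightarrow> FT (f i) (h i)) \<Longrightarrow> FT (\<lambda>x. \<Sum>i\<in>A. f i x) (\<lambda>x. \<Sum>i\<in>A. h i x)"
  by (induction A rule: finite_induct) (auto intro: FT_add simp: FT_zero)

lemma FT_cong_AE:
  assumes "FT f h" "L2 f'" "L2 h'" "AE x in lebesgue. f x = f' x" "AE x in lebesgue. h x = h' x"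
  shows "FT f' h'"
  unfolding FT_def
proof (intro conjI allI impI)
  fix g :: "real^'a \<Rightarrow> complex" assume g: "bcs g"
  have m: "g \<in> borel_measurable lebesgue" "ft g \<in> borel_measurable lebesgue"
    using bcs_L2[OF g] plancherel_bcs(1)[OF g] by (auto simp: L2_measurable)
  have "(LINT x|lebesgue. h' x * g x) = (LINT x|lebesgue. h x * g x)"
    using assms m FT_L2[OF assms(1)] by (intro integral_cong_AE) (auto simp: L2_measurable)
  also have "\<dots> = (LINT x|lebesgue. f x * ft g x)" by (rule FT_D[OF assms(1) g])
  also have "\<dots> = (LINT x|lebesgue. f' x * ft g x)"
    using assms m FT_L2[OF assms(1)] by (intro integral_cong_AE) (auto simp: L2_measurable)
  finally show "(LINT x|lebesgue. h' x * g x) = (LINT x|lebesgue. f' x * ft g x)" .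
qed fact+

lemma FT_unique:
  assumes "FT f h" "FT f h'" shows "AE x in lebesgue. h x = h' x"
proof -
  have "AE x in lebesgue. h x - h' x = 0"
  proof (rule L2_weakly_zero)
    fix g :: "real^'a \<Rightarrow> complex" assume g: "bcs g"
    show "(LINT x|lebesgue. (h x - h' x) * g x) = 0"
      using FT_D[OF FT_diff[OF assms] g] by simp
  qed (use assms in \<open>auto intro: L2_diff FT_L2\<close>)
  then show ?thesis by simp
qed

text \<open>By Plancherel the transforms of the truncations form a Cauchy sequence, and the duality
  identity passes to the limit. The norm is recorded because it is known only for the limit built
  here; uniqueness carries it to every transform in \<open>FT_norm\<close>.\<close>

lemma FT_exists_isometric:
  assumes "L2 f" shows "\<exists>h. FT f h \<and> L2norm h = L2norm f"
proof -
  obtain f' where f': "f' \<in> borel_measurable borel" "AE x in lebesgue. f x = f' x" "L2 f'"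
    by (rule L2_Borel_version[OF assms])
  define p where "p k = trunc k f'" for k
  have b: "bcs (p k)" for k unfolding p_def by (rule bcs_trunc[OF f'(1)])
  have pf: "(\<lambda>k. L2norm (\<lambda>x. p k x - f' x)) \<longlonglongrightarrow> 0" unfolding p_def by (rule trunc_tendsto[OF f'(1,3)])
  have iso: "L2norm (\<lambda>x. ft (p m) x - ft (p n) x) = L2norm (\<lambda>x. p m x - p n x)" for m n
  proof -
    have d: "bcs (\<lambda>x. p m x - p n x)"
      by (rule bcs_diff[OF b b])
    have "AE x in lebesgue. ft (\<lambda>x. p m x - p n x) x = ft (p m) x - ft (p n) x"
      by (rule FT_unique[OF FT_bcs[OF d] FT_diff[OF FT_bcs[OF b] FT_bcs[OF b]]])
    then have "L2norm (ft (\<lambda>x. p m x - p n x)) = L2norm (\<lambda>x. ft (p m) x - ft (p n) x)"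
      by (intro L2norm_cong_AE L2_diff plancherel_bcs b d)
    with plancherel_bcs(2)[OF d] show ?thesis by simp
  qed
  obtain h where h: "L2 h" "(\<lambda>k. L2norm (\<lambda>x. ft (p k) x - h x)) \<longlonglongrightarrow> 0"
  proof (rule L2_complete[of "\<lambda>k. ft (p k)"])
    fix e :: real assume "e > 0"
    then have "\<forall>\<^sub>F k in sequentially. L2norm (\<lambda>x. p k x - f' x) < e / 2"
      using pf by (intro order_tendstoD) auto
    then obtain N where N: "\<And>k. k \<ge> N \<Longrightarrow> L2norm (\<lambda>x. p k x - f' x) < e / 2"
      by (auto simp: eventually_sequentially)
    have "L2norm (\<lambda>x. p m x - p n x) < e" if "m \<ge> N" "n \<ge> N" for m n
      using L2norm_diff_triangle[OF bcs_L2[OF b[of m]] f'(3) bcs_L2[OF b[of n]]] N[OF that(1)] N[OF that(2)]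
        L2norm_minus_commute[of f' "p n"] by linarith
    then show "\<exists>N. \<forall>m\<ge>N. \<forall>n\<ge>N. L2norm (\<lambda>x. ft (p m) x - ft (p n) x) < e" unfolding iso by blast
  qed (use plancherel_bcs(1)[OF b] in auto)
  have "FT f' h" unfolding FT_def
  proof (intro conjI allI impI f'(3) h(1))
    fix g :: "real^'a \<Rightarrow> complex" assume g: "bcs g"
    have "(\<lambda>k. LINT x|lebesgue. ft (p k) x * g x) \<longlonglongrightarrow> (LINT x|lebesgue. h x * g x)"
      by (rule L2_integral_tendsto[OF _ h(1) bcs_L2[OF g] h(2)]) (rule plancherel_bcs(1)[OF b])
    moreover have "(\<lambda>k. LINT x|lebesgue. p k x * ft g x) \<longlonglongrightarrow> (LINT x|lebesgue. f' x * ft g x)"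
      by (rule L2_integral_tendsto[OF _ f'(3) plancherel_bcs(1)[OF g] pf]) (rule bcs_L2[OF b])
    ultimately show "(LINT x|lebesgue. h x * g x) = (LINT x|lebesgue. f' x * ft g x)"
      unfolding FT_D[OF FT_bcs[OF b] g] by (rule LIMSEQ_unique)
  qed
  then have "FT f h" by (rule FT_cong_AE) (use assms h f'(2) in auto)
  moreover have "(\<lambda>k. L2norm (ft (p k))) \<longlonglongrightarrow> L2norm h"
    by (rule L2norm_tendsto[OF _ h]) (rule plancherel_bcs(1)[OF b])
  moreover have "(\<lambda>k. L2norm (p k)) \<longlonglongrightarrow> L2norm f'"
    by (rule L2norm_tendsto[OF _ f'(3) pf]) (rule bcs_L2[OF b])
  ultimately have "L2norm h = L2norm f'"
    unfolding plancherel_bcs(2)[OF b] by (blast intro: LIMSEQ_unique)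
  moreover have "L2norm f = L2norm f'" by (rule L2norm_cong_AE[OF assms f'(3,2)])
  ultimately show ?thesis using \<open>FT f h\<close> by auto
qed

lemma FT_norm: assumes "FT f h" shows "L2norm h = L2norm f"
proof -
  obtain h' where h': "FT f h'" "L2norm h' = L2norm f"
    using FT_exists_isometric[OF FT_L2(1)[OF assms]] by auto
  have "L2norm h = L2norm h'" by (rule L2norm_cong_AE) (use FT_unique[OF assms h'(1)] assms h' in \<open>auto simp: FT_L2\<close>)
  with h' show ?thesis by simp
qed

lemma FT_injective:
  assumes "FT f h" "FT f' h" shows "AE x in lebesgue. f x = f' x"
proof -
  have d: "FT (\<lambda>x. f x - f' x) (\<lambda>x. 0)" using FT_diff[OF assms] by simp
  have "AE x in lebesgue. f x - f' x = 0"
    by (rule L2norm_eq_0_AE) (use FT_L2[OF d] FT_norm[OF d] in \<open>auto simp: L2norm_def\<close>)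
  then show ?thesis by simp
qed

section \<open>Parseval's identity, inversion and surjectivity of the transform\<close>

lemma polarization_identity:
  "a * cnj b = (complex_of_real ((cmod (a + b))\<^sup>2) - complex_of_real ((cmod (a - b))\<^sup>2)
     + \<i> * (complex_of_real ((cmod (a + \<i> * b))\<^sup>2) - complex_of_real ((cmod (a - \<i> * b))\<^sup>2))) / 4"
  unfolding complex_norm_square by (simp add: algebra_simps)

lemma L2_polarization:
  assumes "L2 a" "L2 b"
  shows "(LINT x|lebesgue. a x * cnj (b x))
    = (complex_of_real ((L2norm (\<lambda>x. a x + b x))\<^sup>2) - complex_of_real ((L2norm (\<lambda>x. a x - b x))\<^sup>2)
     + \<i> * (complex_of_real ((L2norm (\<lambda>x. a x + \<i> * b x))\<^sup>2) - complex_of_real ((L2norm (\<lambda>x. a x - \<i> * b x))\<^sup>2))) / 4"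
proof -
  have int: "integrable lebesgue (\<lambda>x. complex_of_real ((cmod (a x + b x))\<^sup>2))"
    "integrable lebesgue (\<lambda>x. complex_of_real ((cmod (a x - b x))\<^sup>2))"
    "integrable lebesgue (\<lambda>x. complex_of_real ((cmod (a x + \<i> * b x))\<^sup>2))"
    "integrable lebesgue (\<lambda>x. complex_of_real ((cmod (a x - \<i> * b x))\<^sup>2))"
    by (intro integrable_of_real L2_integrable L2_add L2_diff L2_cmult assms)+
  show ?thesis
    unfolding polarization_identity[of "a _"] L2norm_sq integral_complex_of_real[symmetric]
    using int by simp
qed

text \<open>Each of the four norms in the polarization formula is preserved, since \<open>FT\<close>
  is linear and isometric.\<close>

theorem FT_parseval:
  assumes "FT f h" "FT g k"
  shows "(LINT x|lebesgue. f x * cnj (g x)) = (LINT x|lebesgue. h x * cnj (k x))"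
proof -
  note i = FT_cmult[OF assms(2), of \<i>]
  show ?thesis
    using FT_norm[OF FT_add[OF assms]] FT_norm[OF FT_diff[OF assms]]
      FT_norm[OF FT_add[OF assms(1) i]] FT_norm[OF FT_diff[OF assms(1) i]] assms
    by (simp add: L2_polarization FT_L2)
qed

text \<open>The inverse transform is conjugation, transform, conjugation: Parseval against the pair
  (g, ft g) is precisely the duality that defines \<open>FT\<close> for the conjugates. Surjectivity
  thereby reduces to existence.\<close>

lemma FT_inverse: assumes "FT f h" shows "FT (\<lambda>x. cnj (h x)) (\<lambda>x. cnj (f x))"
  unfolding FT_def
proof (intro conjI allI impI L2_cnj)
  fix g :: "real^'a \<Rightarrow> complex" assume g: "bcs g"
  have "(LINT x|lebesgue. cnj (f x) * g x) = cnj (LINT x|lebesgue. f x * cnj (g x))"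
    by (simp flip: Bochner_Integration.integral_cnj)
  also have "\<dots> = cnj (LINT x|lebesgue. h x * cnj (ft g x))"
    using FT_parseval[OF assms FT_bcs[OF g]] by simp
  also have "\<dots> = (LINT x|lebesgue. cnj (h x) * ft g x)"
    by (simp flip: Bochner_Integration.integral_cnj)
  finally show "(LINT x|lebesgue. cnj (f x) * g x) = (LINT x|lebesgue. cnj (h x) * ft g x)" .
qed (use assms in \<open>auto simp: FT_L2\<close>)

lemma FT_exists: "L2 f \<Longrightarrow> \<exists>h. FT f h"
  using FT_exists_isometric by blast

lemma FT_surjective: assumes "L2 h" shows "\<exists>f. FT f h"
proof -
  obtain k where "FT (\<lambda>x. cnj (h x)) k" using FT_exists[OF L2_cnj[OF assms]] by auto
  from FT_inverse[OF this] show ?thesis by auto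
qed

subsection \<open>Convolution\<close>

lemma conv_lborel:
  assumes "\<phi> \<in> borel_measurable borel" "u \<in> borel_measurable borel"
  shows "conv \<phi> u x = (LINT y|lborel. complex_of_real (\<phi> (x - y)) * u y)"
  unfolding conv_def by (rule integral_completion) (use assms in measurable)

lemma borel_measurable_conv:
  assumes [measurable]: "\<phi> \<in> borel_measurable borel" "u \<in> borel_measurable borel"
  shows "conv \<phi> u \<in> borel_measurable borel"
  unfolding conv_lborel[OF assms, abs_def] by measurable

text \<open>The integrand is split as sqrt|phi| times sqrt|phi| u. Cauchy-Schwarz in y bounds the
  squared convolution by K P, with K the L1 norm of phi, and Tonelli gives P the integral K times
  the squared norm of \<open>u\<close>; so P is finite almost everywhere.\<close>

lemma young_L1_L2:
  fixes \<phi> :: "real^'n::finite \<Rightarrow> real"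
  assumes \<phi>: "integrable lborel \<phi>" and um[measurable]: "u \<in> borel_measurable borel" and u: "L2 u"
  shows "L2 (conv \<phi> u)" "AE x in lborel. integrable lborel (\<lambda>y. complex_of_real (\<phi> (x - y)) * u y)"
proof -
  have \<phi>m[measurable]: "\<phi> \<in> borel_measurable borel" using \<phi> by auto
  define K where "K = (LINT x|lborel. \<bar>\<phi> x\<bar>)"
  have K: "K \<ge> 0" by (simp add: K_def)
  have Kx: "(\<integral>\<^sup>+y. ennreal \<bar>\<phi> (x - y)\<bar> \<partial>lborel) = ennreal K" "(\<integral>\<^sup>+x. ennreal \<bar>\<phi> (x - y)\<bar> \<partial>lborel) = ennreal K" for x y
  proof -
    have *: "(\<integral>\<^sup>+y. ennreal \<bar>\<phi> y\<bar> \<partial>lborel) = ennreal K"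
      unfolding K_def using \<phi> by (intro nn_integral_eq_integral) auto
    show "(\<integral>\<^sup>+y. ennreal \<bar>\<phi> (x - y)\<bar> \<partial>lborel) = ennreal K"
      using nn_integral_lborel_isometry(2)[of "\<lambda>y. ennreal \<bar>\<phi> y\<bar>" x] * by simp
    show "(\<integral>\<^sup>+x. ennreal \<bar>\<phi> (x - y)\<bar> \<partial>lborel) = ennreal K"
      using nn_integral_lborel_isometry(1)[of "\<lambda>y. ennreal \<bar>\<phi> y\<bar>" "- y"] * by simp
  qed
  define P where "P x = (\<integral>\<^sup>+y. ennreal (\<bar>\<phi> (x - y)\<bar> * (cmod (u y))\<^sup>2) \<partial>lborel)" for x
  have [measurable]: "P \<in> borel_measurable borel" unfolding P_def by measurable
  have "(\<integral>\<^sup>+x. P x \<partial>lborel) = (\<integral>\<^sup>+y. (\<integral>\<^sup>+x. ennreal (\<bar>\<phi> (x - y)\<bar> * (cmod (u y))\<^sup>2) \<partial>lborel) \<partial>lborel)"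
    unfolding P_def
    by (rule lborel_pair.Fubini'[symmetric]) measurable
  also have "\<dots> = (\<integral>\<^sup>+y. ennreal K * ennreal ((cmod (u y))\<^sup>2) \<partial>lborel)"
  proof (rule nn_integral_cong)
    fix y
    have "(\<integral>\<^sup>+x. ennreal (\<bar>\<phi> (x - y)\<bar> * (cmod (u y))\<^sup>2) \<partial>lborel)
       = (\<integral>\<^sup>+x. ennreal \<bar>\<phi> (x - y)\<bar> * ennreal ((cmod (u y))\<^sup>2) \<partial>lborel)"
      by (simp add: ennreal_mult)
    also have "\<dots> = ennreal K * ennreal ((cmod (u y))\<^sup>2)"
      by (subst nn_integral_multc) (simp_all add: Kx)
    finally show "(\<integral>\<^sup>+x. ennreal (\<bar>\<phi> (x - y)\<bar> * (cmod (u y))\<^sup>2) \<partial>lborel) = ennreal K * ennreal ((cmod (u y))\<^sup>2)" .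
  qed
  also have "\<dots> = ennreal K * ennreal ((L2norm u)\<^sup>2)"
    using nn_integral_L2[OF u] by (simp add: nn_integral_cmult nn_integral_completion)
  finally have Pint: "(\<integral>\<^sup>+x. P x \<partial>lborel) = ennreal (K * (L2norm u)\<^sup>2)" by (simp add: ennreal_mult K)
  have Pfin: "AE x in lborel. P x \<noteq> \<infinity>"
    by (rule nn_integral_PInf_AE) (simp_all add: Pint)
  have pt: "integrable lborel (\<lambda>y. complex_of_real (\<phi> (x - y)) * u y) \<and> ennreal ((cmod (conv \<phi> u x))\<^sup>2) \<le> ennreal K * P x"
    if "P x \<noteq> \<infinity>" for x
  proof -
    define p where "p y = complex_of_real (sqrt \<bar>\<phi> (x - y)\<bar>)" for y
    define q where "q y = p y * u y" for y
    have [measurable]: "p \<in> borel_measurable borel" "q \<in> borel_measurable borel"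
      unfolding p_def q_def by measurable
    have pm: "p \<in> borel_measurable lebesgue" "q \<in> borel_measurable lebesgue"
      by (simp_all add: measurable_completion)
    have p2: "(cmod (p y))\<^sup>2 = \<bar>\<phi> (x - y)\<bar>" "(cmod (q y))\<^sup>2 = \<bar>\<phi> (x - y)\<bar> * (cmod (u y))\<^sup>2"
      "cmod (p y) * cmod (q y) = cmod (complex_of_real (\<phi> (x - y)) * u y)" for y
      by (auto simp: p_def q_def norm_mult power_mult_distrib)
    have Lp: "L2 p" "L2norm p \<le> sqrt K"
      using L2_if_nn_integral[OF pm(1), of "sqrt K"] K Kx(1)[of x] by (auto simp: p2 nn_integral_completion)
    have "P x = ennreal ((sqrt (enn2real (P x)))\<^sup>2)"
      using that by (simp add: less_top)
    then have Lq: "L2 q" "L2norm q \<le> sqrt (enn2real (P x))"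
      using L2_if_nn_integral[OF pm(2), of "sqrt (enn2real (P x))"] by (auto simp: p2 nn_integral_completion P_def)
    have "integrable lebesgue (\<lambda>y. norm (complex_of_real (\<phi> (x - y)) * u y))"
      using L2_norm_mult_integrable[OF Lp(1) Lq(1)] by (simp add: p2)
    then have int: "integrable lborel (\<lambda>y. complex_of_real (\<phi> (x - y)) * u y)"
      by (subst (asm) integrable_completion, measurable) (simp add: integrable_norm_iff)
    have "cmod (conv \<phi> u x) \<le> (LINT y|lebesgue. cmod (p y) * cmod (q y))"
      unfolding p2 conv_def by (rule integral_norm_bound)
    also have "\<dots> \<le> L2norm p * L2norm q" by (rule Cauchy_Schwarz_norm[OF Lp(1) Lq(1)])
    also have "\<dots> \<le> sqrt K * sqrt (enn2real (P x))"
      using Lp(2) Lq(2) by (intro mult_mono) (auto simp: L2norm_nonneg K)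
    finally have "(cmod (conv \<phi> u x))\<^sup>2 \<le> (sqrt K * sqrt (enn2real (P x)))\<^sup>2" by (rule power_mono) simp
    also have "\<dots> = K * enn2real (P x)" using K by (simp add: power_mult_distrib)
    finally have "ennreal ((cmod (conv \<phi> u x))\<^sup>2) \<le> ennreal (K * enn2real (P x))" by (rule ennreal_leI)
    also have "\<dots> = ennreal K * P x" using that K by (simp add: ennreal_mult less_top)
    finally show ?thesis using int by simp
  qed
  show "AE x in lborel. integrable lborel (\<lambda>y. complex_of_real (\<phi> (x - y)) * u y)"
    using Pfin by eventually_elim (use pt in blast)
  have "(\<integral>\<^sup>+x. ennreal ((cmod (conv \<phi> u x))\<^sup>2) \<partial>lebesgue) \<le> (\<integral>\<^sup>+x. ennreal K * P x \<partial>lborel)"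
    unfolding nn_integral_completion
    by (rule nn_integral_mono_AE, use Pfin in eventually_elim) (use pt in blast)
  also have "\<dots> = ennreal ((K * L2norm u)\<^sup>2)"
    by (simp add: nn_integral_cmult Pint ennreal_mult[symmetric] K power2_eq_square mult_ac)
  finally show "L2 (conv \<phi> u)"
    using L2_if_nn_integral(1)[of "conv \<phi> u" "K * L2norm u"] borel_measurable_conv[OF \<phi>m um]
    by (simp add: K L2norm_nonneg measurable_completion)
qed

theorem FT_conv:
  fixes \<phi> :: "real^'n::finite \<Rightarrow> real"
  assumes \<phi>: "integrable lborel \<phi>" and F: "FT u h"
  shows "FT (conv \<phi> u) (\<lambda>\<xi>. ft (\<lambda>x. complex_of_real (\<phi> x)) \<xi> * h \<xi>)"
proof -
  have \<phi>m[measurable]: "\<phi> \<in> borel_measurable borel" using \<phi> by auto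
  define k where "k x = complex_of_real (\<phi> x)" for x
  have k: "integrable lborel k" unfolding k_def using \<phi> by simp
  note [measurable] = borel_measurable_ft[OF k]
  have [measurable]: "k \<in> borel_measurable borel" unfolding k_def by measurable
  obtain u' where u'[measurable]: "u' \<in> borel_measurable borel" and ae: "AE x in lebesgue. u x = u' x" and Lu': "L2 u'"
    by (rule L2_Borel_version[OF FT_L2(1)[OF F]])
  have F': "FT u' h" by (rule FT_cong_AE[OF F]) (use ae Lu' F in \<open>auto simp: FT_L2\<close>)
  \<comment> \<open>A change of \<open>u\<close> on a null set leaves the convolution intact at
    every point, so this is an equality of functions.\<close>
  have "conv \<phi> u x = conv \<phi> u' x" for x
    unfolding conv_def
  proof (rule integral_cong_AE)
    have [measurable]: "(\<lambda>y. complex_of_real (\<phi> (x - y))) \<in> borel_measurable lebesgue"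
      by (rule measurable_completion) measurable
    note [measurable] = L2_measurable[OF Lu'] L2_measurable[OF FT_L2(1)[OF F]]
    show "(\<lambda>y. complex_of_real (\<phi> (x - y)) * u y) \<in> borel_measurable lebesgue"
      "(\<lambda>y. complex_of_real (\<phi> (x - y)) * u' y) \<in> borel_measurable lebesgue" by measurable
    show "AE y in lebesgue. complex_of_real (\<phi> (x - y)) * u y = complex_of_real (\<phi> (x - y)) * u' y"
      using ae by eventually_elim simp
  qed
  then have cv: "conv \<phi> u = conv \<phi> u'" by (rule ext)
  have "FT (conv \<phi> u') (\<lambda>\<xi>. ft k \<xi> * h \<xi>)"
    unfolding FT_def
  proof (intro conjI allI impI)
    show "L2 (conv \<phi> u')" by (rule young_L1_L2[OF \<phi> u' Lu'])
    show "L2 (\<lambda>\<xi>. ft k \<xi> * h \<xi>)"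
      by (rule L2_mult_bounded[OF FT_L2(2)[OF F] _ ft_bound[OF k]]) (simp add: measurable_completion)
    fix g :: "real^'n \<Rightarrow> complex" assume g: "bcs g"
    have gi: "integrable lborel g" by (rule bcs_integrable[OF g])
    note [measurable] = borel_measurable_ft[OF gi]
    \<comment> \<open>Fubini's majorant: \<open>W\<close> is square integrable by Young and
      \<open>ft g\<close> by Plancherel, so their product is integrable although \<open>ft g\<close>
      alone may fail to be.\<close>
    define W where "W w = (LINT y|lborel. complex_of_real \<bar>\<phi> (w - y)\<bar> * complex_of_real (cmod (u' y)))" for w
    have Wconv: "conv (\<lambda>x. \<bar>\<phi> x\<bar>) (\<lambda>x. complex_of_real (cmod (u' x))) = W"
      unfolding W_def by (rule ext, rule conv_lborel) measurable
    have "L2 (\<lambda>x. complex_of_real (cmod (u' x)))"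
      by (rule L2_bound[OF L2_integrable[OF Lu']]) (auto intro!: measurable_completion)
    then have L2W: "L2 W"
      using young_L1_L2(1)[of "\<lambda>x. \<bar>\<phi> x\<bar>" "\<lambda>x. complex_of_real (cmod (u' x))"] \<phi> unfolding Wconv by simp
    have [measurable]: "W \<in> borel_measurable borel" unfolding W_def by measurable
    have int: "integrable (lborel \<Otimes>\<^sub>M lborel) (\<lambda>(w, y). complex_of_real (\<phi> (w - y)) * u' y * ft g w)"
    proof (rule lborel_pair.Fubini_integrable)
      show "AE w in lborel. integrable lborel (\<lambda>y. case (w, y) of (w, y) \<Rightarrow> complex_of_real (\<phi> (w - y)) * u' y * ft g w)"
        using young_L1_L2(2)[OF \<phi> u' Lu'] by eventually_elim simp
      have eq: "(LINT y|lborel. norm (case (w, y) of (w, y) \<Rightarrow> complex_of_real (\<phi> (w - y)) * u' y * ft g w))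
          = cmod (W w * ft g w)" for w
      proof -
        have "W w = complex_of_real (LINT y|lborel. \<bar>\<phi> (w - y)\<bar> * cmod (u' y))"
          unfolding W_def of_real_mult[symmetric] by (rule integral_complex_of_real)
        moreover have "(LINT y|lborel. \<bar>\<phi> (w - y)\<bar> * cmod (u' y)) \<ge> 0" by (rule integral_nonneg_AE) simp
        ultimately show ?thesis by (simp add: norm_mult)
      qed
      have "integrable lebesgue (\<lambda>w. W w * ft g w)" by (rule L2_mult_integrable[OF L2W plancherel_bcs(1)[OF g]])
      then show "integrable lborel (\<lambda>w. LINT y|lborel. norm (case (w, y) of (w, y) \<Rightarrow> complex_of_real (\<phi> (w - y)) * u' y * ft g w))"
        unfolding eq by (intro integrable_norm) (simp add: integrable_completion)
    qed measurable
    have b: "bcs (\<lambda>\<xi>. ft k \<xi> * g \<xi>)" by (rule bcs_mult_continuous[OF g continuous_on_ft[OF k]])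
    have "(LINT \<xi>|lebesgue. ft k \<xi> * h \<xi> * g \<xi>) = (LINT \<xi>|lebesgue. h \<xi> * (ft k \<xi> * g \<xi>))"
      by (simp add: mult_ac)
    also have "\<dots> = (LINT y|lebesgue. u' y * ft (\<lambda>\<xi>. ft k \<xi> * g \<xi>) y)" by (rule FT_D[OF F' b])
    also have "\<dots> = (LINT y|lborel. u' y * ft (\<lambda>\<xi>. ft k \<xi> * g \<xi>) y)"
      using borel_measurable_ft[OF bcs_integrable[OF b]] by (intro integral_completion) auto
    also have "\<dots> = (LINT y|lborel. LINT w|lborel. complex_of_real (\<phi> (w - y)) * u' y * ft g w)"
    proof (rule Bochner_Integration.integral_cong[OF refl])
      fix y
      have "ft (\<lambda>\<xi>. ft k \<xi> * g \<xi>) y = (LINT x|lborel. k x * ft g (x + y))"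
        by (rule ft_ft_mult[OF k gi])
      also have "\<dots> = (LINT w|lborel. k (- y + w) * ft g ((- y + w) + y))"
        by (rule lborel_integral_isometry(1)[symmetric]) measurable
      finally have "u' y * ft (\<lambda>\<xi>. ft k \<xi> * g \<xi>) y = u' y * (LINT w|lborel. complex_of_real (\<phi> (w - y)) * ft g w)"
        by (simp add: k_def)
      also have "\<dots> = (LINT w|lborel. u' y * (complex_of_real (\<phi> (w - y)) * ft g w))" by simp
      finally show "u' y * ft (\<lambda>\<xi>. ft k \<xi> * g \<xi>) y = (LINT w|lborel. complex_of_real (\<phi> (w - y)) * u' y * ft g w)"
        by (simp only: mult_ac)
    qed
    also have "\<dots> = (LINT w|lborel. LINT y|lborel. complex_of_real (\<phi> (w - y)) * u' y * ft g w)"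
      by (rule lborel_pair.Fubini_integral[OF int])
    also have "\<dots> = (LINT w|lborel. conv \<phi> u' w * ft g w)"
      by (simp add: conv_lborel)
    also have "\<dots> = (LINT w|lebesgue. conv \<phi> u' w * ft g w)"
      using borel_measurable_conv[OF \<phi>m u'] by (intro integral_completion[symmetric]) auto
    finally show "(LINT \<xi>|lebesgue. ft k \<xi> * h \<xi> * g \<xi>) = (LINT w|lebesgue. conv \<phi> u' w * ft g w)" .
  qed
  then show ?thesis unfolding cv k_def[abs_def] .
qed

subsection \<open>A smooth bump function\<close>

text \<open>All derivatives of exp(-1/x), extended by 0 to x <= 0, are combinations of these
  functions; the index counts powers of 1/x.\<close>

definition flat_exp :: "nat \<Rightarrow> real \<Rightarrow> real" where
  "flat_exp k x = (if x > 0 then (1 / x) ^ k * exp (- (1 / x)) else 0)"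

lemma DERIV_flat_exp: "(flat_exp k has_real_derivative (flat_exp (k + 2) x - real k * flat_exp (k + 1) x)) (at x)"
proof -
  consider "x > 0" | "x < 0" | "x = 0" by linarith
  then show ?thesis
  proof cases
    case 1
    have "((\<lambda>x. (1 / x) ^ k * exp (- (1 / x))) has_real_derivative
        (real k * (1 / x) ^ (k - 1) * (- (1 / x\<^sup>2))) * exp (- (1 / x)) + (1 / x) ^ k * (exp (- (1 / x)) * (1 / x\<^sup>2))) (at x)"
      using 1 by (auto intro!: derivative_eq_intros simp: power2_eq_square)
    moreover have "(real k * (1 / x) ^ (k - 1) * (- (1 / x\<^sup>2))) * exp (- (1 / x)) + (1 / x) ^ k * (exp (- (1 / x)) * (1 / x\<^sup>2))
        = flat_exp (k + 2) x - real k * flat_exp (k + 1) x"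
      using 1 by (cases k) (simp_all add: flat_exp_def power2_eq_square field_simps)
    ultimately have "((\<lambda>x. (1 / x) ^ k * exp (- (1 / x))) has_real_derivative (flat_exp (k + 2) x - real k * flat_exp (k + 1) x)) (at x)"
      by simp
    then show ?thesis
    proof (rule has_field_derivative_transform_within_open)
      show "open {0::real<..}" "x \<in> {0<..}" using 1 by auto
    qed (auto simp: flat_exp_def)
  next
    case 2
    have "((\<lambda>x. 0) has_real_derivative 0) (at x)" by simp
    then have "(flat_exp k has_real_derivative 0) (at x)"
    proof (rule has_field_derivative_transform_within_open)
      show "open {..<0::real}" "x \<in> {..<0}" using 2 by auto
    qed (auto simp: flat_exp_def)
    then show ?thesis using 2 by (simp add: flat_exp_def)
  next
    case 3
    have "((\<lambda>h. flat_exp k h / h) \<longlongrightarrow> 0) (at 0)"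
    proof (rule filterlim_split_at)
      show "((\<lambda>h. flat_exp k h / h) \<longlongrightarrow> 0) (at_left 0)"
        by (rule tendsto_eventually) (auto simp: flat_exp_def eventually_at_left_field intro: exI[of _ "-1"])
      \<comment> \<open>The difference quotient at 0 adds one power of 1/h, and with 1/h tending to
        infinity the exponential beats every power.\<close>
      have "((\<lambda>h::real. (inverse h) ^ (k + 1) / exp (inverse h)) \<longlongrightarrow> 0) (at_right 0)"
        by (rule filterlim_compose[OF tendsto_power_div_exp_0 filterlim_inverse_at_top_right])
      then show "((\<lambda>h. flat_exp k h / h) \<longlongrightarrow> 0) (at_right 0)"
      proof (rule Lim_transform_eventually)
        show "\<forall>\<^sub>F h in at_right 0. (inverse h) ^ (k + 1) / exp (inverse h) = flat_exp k h / h"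
          unfolding eventually_at_right_field
          by (auto simp: flat_exp_def exp_minus field_simps intro: exI[of _ 1])
      qed
    qed
    then show ?thesis using 3 by (simp add: DERIV_def flat_exp_def)
  qed
qed

text \<open>Its members vanish outside (0, 1). Closure under differentiation alone shows that all
  iterates of \<open>deriv\<close> on the bump are differentiable, with no formula for them.\<close>

inductive_set bump_span :: "(real \<Rightarrow> real) set" where
  base: "(\<lambda>x. flat_exp j x * flat_exp k (1 - x)) \<in> bump_span"
| add: "f \<in> bump_span \<Longrightarrow> g \<in> bump_span \<Longrightarrow> (\<lambda>x. f x + g x) \<in> bump_span"
| cmult: "f \<in> bump_span \<Longrightarrow> (\<lambda>x. c * f x) \<in> bump_span"

lemma bump_span_DERIV: "f \<in> bump_span \<Longrightarrow> \<exists>f'\<in>bump_span. \<forall>x. (f has_real_derivative f' x) (at x)"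
proof (induction rule: bump_span.induct)
  case (base j k)
  let ?f' = "\<lambda>x. (flat_exp (j + 2) x * flat_exp k (1 - x) + (- real j) * (flat_exp (j + 1) x * flat_exp k (1 - x)))
     + ((-1) * (flat_exp j x * flat_exp (k + 2) (1 - x)) + real k * (flat_exp j x * flat_exp (k + 1) (1 - x)))"
  have "?f' \<in> bump_span" by (intro bump_span.intros)
  moreover have "((\<lambda>x. flat_exp j x * flat_exp k (1 - x)) has_real_derivative ?f' x) (at x)" for x
  proof -
    have "((\<lambda>x. flat_exp k (1 - x)) has_real_derivative - (flat_exp (k + 2) (1 - x) - real k * flat_exp (k + 1) (1 - x))) (at x)"
    proof -
      have g: "((\<lambda>x. 1 - x) has_real_derivative -1) (at x)" by (auto intro!: derivative_eq_intros)
      show ?thesis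
        using DERIV_chain2[where f = "flat_exp k" and g = "\<lambda>x. 1 - x", OF DERIV_flat_exp g] by simp
    qed
    from DERIV_mult[OF DERIV_flat_exp[of j x] this] show ?thesis by (simp add: algebra_simps)
  qed
  ultimately show ?case by (intro bexI[of _ ?f'] allI)
next
  case (add f g)
  then obtain f' g' where "f' \<in> bump_span" "\<forall>x. (f has_real_derivative f' x) (at x)"
    "g' \<in> bump_span" "\<forall>x. (g has_real_derivative g' x) (at x)" by blast
  then show ?case by (intro bexI[of _ "\<lambda>x. f' x + g' x"] allI DERIV_add bump_span.add) auto
next
  case (cmult f c)
  then obtain f' where "f' \<in> bump_span" "\<forall>x. (f has_real_derivative f' x) (at x)" by blast
  then show ?case by (intro bexI[of _ "\<lambda>x. c * f' x"] allI DERIV_cmult bump_span.cmult) auto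
qed

lemma bump_real:
  obtains D :: "nat \<Rightarrow> real \<Rightarrow> real" where
    "\<And>k x. (D k has_real_derivative D (Suc k) x) (at x)"
    "\<And>x. D 0 x \<ge> 0" "\<And>x. D 0 x \<noteq> 0 \<Longrightarrow> 0 < x \<and> x < 1" "D 0 (1/2) > 0"
proof -
  define D where "D k = (deriv ^^ k) (\<lambda>x. flat_exp 0 x * flat_exp 0 (1 - x))" for k
  have step: "deriv f \<in> bump_span \<and> (\<forall>x. (f has_real_derivative deriv f x) (at x))" if f: "f \<in> bump_span" for f
  proof -
    obtain f' where f': "f' \<in> bump_span" "\<forall>x. (f has_real_derivative f' x) (at x)"
      using bump_span_DERIV[OF f] by auto
    then have "deriv f = f'" by (auto intro: DERIV_imp_deriv)
    with f' show ?thesis by simp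
  qed
  have D: "D k \<in> bump_span" for k
    by (induction k) (auto simp: D_def intro: bump_span.base step[THEN conjunct1])
  have "D (Suc k) = deriv (D k)" for k by (simp add: D_def)
  with step[OF D] have "(D k has_real_derivative D (Suc k) x) (at x)" for k x by simp
  moreover have "D 0 x \<ge> 0" "D 0 x \<noteq> 0 \<Longrightarrow> 0 < x \<and> x < 1" "D 0 (1/2) > 0" for x
    by (auto simp: D_def flat_exp_def split: if_splits)
  ultimately show ?thesis by (rule that)
qed

lemma pds_Nil: "pds [] f = f" and pds_Cons: "pds (i # is) f = pd i (pds is f)"
  by (simp_all add: pds_def)

lemma test_fun_exists:
  obtains \<eta> :: "real^'n::finite \<Rightarrow> real" and x\<^sub>0 where "test_fun \<eta>" "\<And>x. \<eta> x \<ge> 0" "\<eta> x\<^sub>0 > 0"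
proof -
  obtain D :: "nat \<Rightarrow> real \<Rightarrow> real" where D: "\<And>k x. (D k has_real_derivative D (Suc k) x) (at x)"
    "\<And>x. D 0 x \<ge> 0" "\<And>x. D 0 x \<noteq> 0 \<Longrightarrow> 0 < x \<and> x < 1" "D 0 (1/2) > 0"
    using bump_real by metis
  \<comment> \<open>Here \<open>m\<close> is a multi-index: \<open>pd i\<close> raises its entry at
    \<open>i\<close> by one, so every iterated partial derivative of the tensor product is again
    some \<open>T m\<close>.\<close>
  define T where "T m x = (\<Prod>j\<in>UNIV. D (m j) (x $ j))" for m :: "'n \<Rightarrow> nat" and x :: "real^'n"
  have cont: "continuous_on UNIV (T m)" for m
  proof -
    have "continuous_on UNIV (D k)" for k
      using D(1) by (meson DERIV_isCont continuous_at_imp_continuous_on)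
    then have "continuous_on UNIV (\<lambda>x::real^'n. D k (x $ j))" for k j
      by (rule continuous_on_compose2) (auto intro: continuous_intros)
    then show ?thesis unfolding T_def by (intro continuous_on_prod)
  qed
  have der: "((\<lambda>t. T m (x + t *\<^sub>R axis i 1)) has_real_derivative T (m(i := Suc (m i))) x) (at 0)" for m i x
  proof -
    have eq: "T m (x + t *\<^sub>R axis i 1) = D (m i) (x $ i + t) * (\<Prod>j\<in>UNIV - {i}. D (m j) (x $ j))" for t
      unfolding T_def by (subst prod.remove[of _ i]) (auto simp: axis_def intro!: prod.cong)
    have eq': "T (m(i := Suc (m i))) x = D (Suc (m i)) (x $ i + 0) * (\<Prod>j\<in>UNIV - {i}. D (m j) (x $ j))"
      unfolding T_def by (subst prod.remove[of _ i]) (auto intro!: prod.cong)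
    have "((\<lambda>t. D (m i) (x $ i + t)) has_real_derivative D (Suc (m i)) (x $ i + 0)) (at 0)"
    proof -
      have g: "((\<lambda>t. x $ i + t) has_real_derivative 1) (at 0)" by (auto intro!: derivative_eq_intros)
      show ?thesis
        using DERIV_chain2[where f = "D (m i)" and g = "\<lambda>t. x $ i + t", OF D(1) g] by simp
    qed
    then show ?thesis unfolding eq eq' by (rule DERIV_cmult_right)
  qed
  have pdT: "pd i (T m) = T (m(i := Suc (m i)))" for i m
    by (rule ext) (simp only: pd_def DERIV_imp_deriv[OF der])
  have "\<exists>m. pds is (T (\<lambda>_. 0)) = T m" for "is"
    by (induction "is") (auto simp: pds_Nil pds_Cons pdT)
  then have sm: "smooth_fun (T (\<lambda>_. 0))"
    unfolding smooth_fun_def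
  proof (intro allI)
    fix "is" :: "'n list"
    obtain m where m: "pds is (T (\<lambda>_. 0)) = T m" using \<open>\<And>is. \<exists>m. pds is (T (\<lambda>_. 0)) = T m\<close> by blast
    show "continuous_on UNIV (pds is (T (\<lambda>_. 0))) \<and>
      (\<forall>i x. (\<lambda>t. pds is (T (\<lambda>_. 0)) (x + t *\<^sub>R axis i 1)) differentiable at 0)"
      unfolding m using cont der real_differentiable_def by blast
  qed
  have "{x. T (\<lambda>_. 0) x \<noteq> 0} \<subseteq> cbox 0 (\<chi> i. 1)"
    using D(3) by (auto simp: T_def mem_box_cart less_imp_le)
  then have "test_fun (T (\<lambda>_. 0))" unfolding test_fun_def using sm bounded_cbox bounded_subset by blast
  moreover have "T (\<lambda>_. 0) x \<ge> 0" for x unfolding T_def using D(2) by (intro prod_nonneg) auto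
  moreover have "T (\<lambda>_. 0) (\<chi> i. 1/2) > 0" unfolding T_def using D(4) by (intro prod_pos) auto
  ultimately show ?thesis by (rule that)
qed

section \<open>Smooth functions along coordinate lines and under affine maps\<close>

lemma smooth_fun_pds_DERIV:
  assumes "smooth_fun f"
  shows "((\<lambda>t. pds is f (x + t *\<^sub>R axis i 1)) has_real_derivative pds (i # is) f (x + s *\<^sub>R axis i 1)) (at s)"
proof -
  have "(\<lambda>t. pds is f ((x + s *\<^sub>R axis i 1) + t *\<^sub>R axis i 1)) differentiable (at 0)"
    using assms unfolding smooth_fun_def by blast
  then have "((\<lambda>t. pds is f ((x + s *\<^sub>R axis i 1) + t *\<^sub>R axis i 1)) has_real_derivative
      pds (i # is) f (x + s *\<^sub>R axis i 1)) (at 0)"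
    unfolding pds_Cons pd_def by (simp add: DERIV_deriv_iff_real_differentiable)
  then have "((\<lambda>t. pds is f (x + (t + s) *\<^sub>R axis i 1)) has_real_derivative
      pds (i # is) f (x + s *\<^sub>R axis i 1)) (at 0)"
    by (simp add: scaleR_left_distrib add_ac)
  then show ?thesis using DERIV_shift[of "\<lambda>t. pds is f (x + t *\<^sub>R axis i 1)" _ 0 s] by simp
qed

lemma smooth_fun_pd_DERIV:
  assumes "smooth_fun f"
  shows "((\<lambda>t. f (x + t *\<^sub>R axis i 1)) has_real_derivative pd i f (x + s *\<^sub>R axis i 1)) (at s)"
  using smooth_fun_pds_DERIV[OF assms, of "[]"] by (simp add: pds_Nil pds_Cons)

lemma smooth_fun_continuous:
  assumes "smooth_fun f" shows "continuous_on UNIV f" "continuous_on UNIV (pd i f)"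
proof -
  have "continuous_on UNIV (pds is f)" for "is" using assms unfolding smooth_fun_def by blast
  from this[of "[]"] this[of "[i]"] show "continuous_on UNIV f" "continuous_on UNIV (pd i f)"
    by (simp_all add: pds_Nil pds_Cons)
qed

text \<open>Serves c = -1, the reflected translates inside a convolution, and positive integers c,
  the dilates of the bump.\<close>

lemma smooth_fun_affine:
  fixes f :: "real^'n::finite \<Rightarrow> real"
  assumes f: "smooth_fun f"
  shows "smooth_fun (\<lambda>x. f (y + c *\<^sub>R x))" "pd i (\<lambda>x. f (y + c *\<^sub>R x)) x = c * pd i f (y + c *\<^sub>R x)"
proof -
  \<comment> \<open>\<open>C\<close> stands for the power of \<open>c\<close> accumulated by the
    earlier derivatives in the induction over the list.\<close>
  have der: "((\<lambda>t. C * pds is f (y + c *\<^sub>R (x + t *\<^sub>R axis i 1))) has_real_derivative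
      C * c * pds (i # is) f (y + c *\<^sub>R x)) (at 0)" for C "is" i x
  proof -
    have "((\<lambda>t. pds is f ((y + c *\<^sub>R x) + (c * t) *\<^sub>R axis i 1)) has_real_derivative
        pds (i # is) f ((y + c *\<^sub>R x) + (c * 0) *\<^sub>R axis i 1) * c) (at 0)"
      by (rule DERIV_chain2[OF smooth_fun_pds_DERIV[OF f]]) (auto intro!: derivative_eq_intros)
    from DERIV_cmult[OF this, of C] show ?thesis by (simp add: scaleR_add_right add_ac mult_ac)
  qed
  have pds: "pds is (\<lambda>x. f (y + c *\<^sub>R x)) = (\<lambda>x. c ^ length is * pds is f (y + c *\<^sub>R x))" for "is"
  proof (induction "is")
    case (Cons i "is")
    show ?case unfolding pds_Cons Cons pd_def[of i "\<lambda>x. c ^ length is * pds is f (y + c *\<^sub>R x)"]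
      using DERIV_imp_deriv[OF der[of "c ^ length is" "is" _ i]] by (auto simp: pds_Cons mult_ac)
  qed (simp add: pds_Nil)
  show "smooth_fun (\<lambda>x. f (y + c *\<^sub>R x))"
    unfolding smooth_fun_def pds
  proof (intro allI conjI)
    fix "is"
    have "continuous_on UNIV (pds is f)" using f unfolding smooth_fun_def by blast
    then have "continuous_on UNIV (\<lambda>x. pds is f (y + c *\<^sub>R x))"
      by (rule continuous_on_compose2) (auto intro!: continuous_intros)
    then show "continuous_on UNIV (\<lambda>x. c ^ length is * pds is f (y + c *\<^sub>R x))" by (intro continuous_intros)
    show "(\<lambda>t. c ^ length is * pds is f (y + c *\<^sub>R (x + t *\<^sub>R axis i 1))) differentiable at 0" for i x
      using der real_differentiable_def by blast
  qed
  show "pd i (\<lambda>x. f (y + c *\<^sub>R x)) x = c * pd i f (y + c *\<^sub>R x)"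
    using pds[of "[i]"] by (simp add: pds_Cons pds_Nil)
qed

lemma test_fun_affine:
  assumes "test_fun f" "c \<noteq> 0" shows "test_fun (\<lambda>x. f (y + c *\<^sub>R x))"
  unfolding test_fun_def
proof
  show "smooth_fun (\<lambda>x. f (y + c *\<^sub>R x))" using assms by (intro smooth_fun_affine) (simp add: test_fun_def)
  obtain B where B: "\<And>z. f z \<noteq> 0 \<Longrightarrow> norm z \<le> B"
    using assms(1) by (auto simp: test_fun_def bounded_iff)
  show "bounded {x. f (y + c *\<^sub>R x) \<noteq> 0}"
    unfolding bounded_iff
  proof (intro exI ballI)
    fix x assume "x \<in> {x. f (y + c *\<^sub>R x) \<noteq> 0}"
    then have "norm (y + c *\<^sub>R x) \<le> B" using B by auto
    then have "norm (c *\<^sub>R x) \<le> B + norm y" using norm_triangle_ineq4[of "y + c *\<^sub>R x" y] by simp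
    then show "norm x \<le> (B + norm y) / \<bar>c\<bar>" using assms(2) by (simp add: field_simps)
  qed
qed

subsection \<open>Weak derivatives on the Fourier side\<close>

text \<open>Averaging \<open>g\<close> over the segment from x to x + e leaves its integral
  unchanged, and each average equals psi(x + e) - psi(x), whose integral vanishes by translation
  invariance. This gives integration by parts without slicing the space into lines.\<close>

lemma integral_directional_derivative:
  fixes \<psi> g :: "real^'n::finite \<Rightarrow> complex" and e :: "real^'n"
  assumes \<psi>: "integrable lborel \<psi>" and g: "bcs g" "continuous_on UNIV g" and e: "norm e \<le> 1"
    and der: "\<And>x s. ((\<lambda>t. \<psi> (x + t *\<^sub>R e)) has_vector_derivative g (x + s *\<^sub>R e)) (at s)"
  shows "(LINT x|lborel. g x) = 0"
proof -
  obtain M R where M: "M > 0" "R > 0" "\<And>x. cmod (g x) \<le> M" "\<And>x. cmod (g x) \<le> M * indicator (cball 0 R) x"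
    using bcs_bound[OF g(1)] by metis
  have [measurable]: "g \<in> borel_measurable borel" "\<psi> \<in> borel_measurable borel"
    using g(1) \<psi> by (auto simp: bcs_def)
  let ?G = "\<lambda>x s. indicator {0..1::real} s *\<^sub>R g (x + s *\<^sub>R e)"
  \<comment> \<open>The radius grows by 1 because a point of the support is displaced by at most |e|
    <= 1.\<close>
  define Q where "Q x s = M * indicator (cball 0 (R + 1)) x * indicator {0..1} s" for x :: "real^'n" and s :: real
  have Q: "Q x s \<ge> 0" for x s using M(1) by (simp add: Q_def)
  have int: "integrable (lborel \<Otimes>\<^sub>M lborel) (\<lambda>(x, s). ?G x s)"
  proof (rule Bochner_Integration.integrable_bound)
    show "integrable (lborel \<Otimes>\<^sub>M lborel) (\<lambda>(x, s). Q x s)"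
    proof (rule lborel_pair.Fubini_integrable)
      show "(\<lambda>(x, s). Q x s) \<in> borel_measurable (lborel \<Otimes>\<^sub>M lborel)" unfolding Q_def by measurable
      have "integrable lborel (\<lambda>x. LINT s|lborel. Q x s)"
        unfolding Q_def integral_mult_right_zero by (intro integrable_mult_left integrable_indicator_cball)
      then show "integrable lborel (\<lambda>x. LINT s|lborel. norm ((\<lambda>(x, s). Q x s) (x, s)))"
        using Q by simp
      show "AE x in lborel. integrable lborel (\<lambda>s. (\<lambda>(x, s). Q x s) (x, s))"
        by (simp add: Q_def)
    qed
    have "norm (?G x s) \<le> Q x s" for x s
    proof (cases "s \<in> {0..1} \<and> g (x + s *\<^sub>R e) \<noteq> 0")
      case True
      then have "x + s *\<^sub>R e \<in> cball 0 R" using M(4)[of "x + s *\<^sub>R e"] by (cases "x + s *\<^sub>R e \<in> cball 0 R") auto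
      moreover have "norm (s *\<^sub>R e) \<le> 1" using True e by (auto intro: mult_le_one)
      ultimately have "norm x \<le> R + 1" using norm_triangle_ineq4[of "x + s *\<^sub>R e" "s *\<^sub>R e"] by auto
      then show ?thesis using True M(3)[of "x + s *\<^sub>R e"] by (simp add: Q_def)
    qed (use Q in \<open>auto simp: indicator_def\<close>)
    then show "AE p in lborel \<Otimes>\<^sub>M lborel. norm (case p of (x, s) \<Rightarrow> ?G x s)
        \<le> norm (case p of (x, s) \<Rightarrow> Q x s)"
      by (auto simp: split_beta intro: order_trans[OF _ abs_ge_self])
  qed measurable
  have "(LINT s|lborel. LINT x|lborel. ?G x s) = (LINT x|lborel. LINT s|lborel. ?G x s)"
    by (rule lborel_pair.Fubini_integral[OF int])
  also have "\<dots> = (LINT x|lborel. \<psi> (x + 1 *\<^sub>R e) - \<psi> (x + 0 *\<^sub>R e))"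
  proof (intro Bochner_Integration.integral_cong[OF refl] integral_FTC_atLeastAtMost)
    fix x
    show "continuous_on {0..1} (\<lambda>s. g (x + s *\<^sub>R e))"
      by (rule continuous_on_compose2[OF g(2)]) (auto intro!: continuous_intros)
  qed (use der in \<open>auto intro: has_vector_derivative_at_within\<close>)
  also have "\<dots> = 0"
    using lborel_integral_isometry(1)[of \<psi> e] lborel_integral_isometry(3)[of \<psi> e] \<psi>
    by (simp add: add.commute)
  finally have *: "(LINT s|lborel. LINT x|lborel. ?G x s) = 0" .
  have "(LINT x|lborel. ?G x s) = indicator {0..1} s *\<^sub>R (LINT x|lborel. g x)" for s
    using lborel_integral_isometry(1)[of g "s *\<^sub>R e"] by (simp add: add.commute)
  with * have "(LINT s|lborel. indicator {0..1::real} s *\<^sub>R (LINT x|lborel. g x)) = 0" by (simp only:)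
  then show ?thesis by simp
qed

lemma test_fun_bcs:
  assumes "test_fun \<phi>" shows "bcs (\<lambda>x. complex_of_real (\<phi> x))" "bcs (\<lambda>x. complex_of_real (pd i \<phi> x))"
proof -
  have sm: "smooth_fun \<phi>" using assms by (simp add: test_fun_def)
  note cont = smooth_fun_continuous[OF sm]
  obtain R where R: "\<And>x. \<phi> x \<noteq> 0 \<Longrightarrow> norm x \<le> R"
    using assms by (auto simp: test_fun_def bounded_iff)
  have b: "bcs (\<lambda>x. complex_of_real (f x))" if c: "continuous_on UNIV f" and z: "\<And>x. f x \<noteq> 0 \<Longrightarrow> norm x \<le> R"
    for f :: "real^'a \<Rightarrow> real"
    unfolding bcs_def
  proof (intro conjI)
    show "(\<lambda>x. complex_of_real (f x)) \<in> borel_measurable borel"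
      using borel_measurable_continuous_onI[OF c] by simp
    show "bounded {x. complex_of_real (f x) \<noteq> 0}" using z by (auto simp: bounded_iff)
    have "bounded (f ` cball 0 R)"
      using c by (intro compact_imp_bounded compact_continuous_image) (auto intro: continuous_on_subset)
    then have "bounded (insert 0 (f ` cball 0 R))" by simp
    then have "bounded (range f)" by (rule bounded_subset) (use z in force)
    then show "bounded (range (\<lambda>x. complex_of_real (f x)))" by (simp add: bounded_iff)
  qed
  show "bcs (\<lambda>x. complex_of_real (\<phi> x))" by (rule b[OF cont(1) R])
  have "pd i \<phi> x = 0" if x: "norm x > R" for x
  proof -
    have "((\<lambda>t. x + t *\<^sub>R axis i 1) \<longlongrightarrow> x + 0 *\<^sub>R axis i 1) (nhds 0)"
      by (intro tendsto_intros filterlim_ident)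
    then have "((\<lambda>t. norm (x + t *\<^sub>R axis i 1)) \<longlongrightarrow> norm x) (nhds 0)"
      using tendsto_norm by fastforce
    then have "\<forall>\<^sub>F t in nhds 0. norm (x + t *\<^sub>R axis i 1) > R" using x by (rule order_tendstoD)
    then have "\<forall>\<^sub>F t in nhds 0. \<phi> (x + t *\<^sub>R axis i 1) = 0"
      by eventually_elim (use R in force)
    then have "deriv (\<lambda>t. \<phi> (x + t *\<^sub>R axis i 1)) 0 = deriv (\<lambda>t. 0) 0" by (intro deriv_cong_ev) auto
    then show ?thesis by (simp add: pd_def)
  qed
  then show "bcs (\<lambda>x. complex_of_real (pd i \<phi> x))"
    by (intro b[OF cont(2)]) (use not_le in blast)
qed

text \<open>Integration by parts, in the form that the partial derivative of the character times phi
  has integral 0.\<close>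

lemma ft_pd:
  assumes "test_fun \<phi>"
  shows "ft (\<lambda>x. complex_of_real (pd i \<phi> x)) \<xi> = 2 * pi * \<i> * (\<xi> $ i) * ft (\<lambda>x. complex_of_real (\<phi> x)) \<xi>"
proof -
  have sm: "smooth_fun \<phi>" using assms by (simp add: test_fun_def)
  note cont = smooth_fun_continuous[OF sm]
  note b = test_fun_bcs[OF assms]
  let ?c = "\<lambda>x. cis (- 2 * pi * (x \<bullet> \<xi>))"
  define \<psi> where "\<psi> x = ?c x * complex_of_real (\<phi> x)" for x
  define w where "w = - 2 * pi * \<i> * (\<xi> $ i)"
  define g where "g x = ?c x * complex_of_real (pd i \<phi> x) + w * (?c x * complex_of_real (\<phi> x))" for x
  have cc: "continuous_on UNIV ?c" by (intro continuous_intros)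
  have b1: "bcs (\<lambda>x. ?c x * complex_of_real (pd i \<phi> x))" "bcs (\<lambda>x. ?c x * complex_of_real (\<phi> x))"
    by (intro bcs_mult_continuous b cc)+
  have "bcs (\<lambda>x. ?c x * complex_of_real (pd i \<phi> x) - (- w) * (?c x * complex_of_real (\<phi> x)))"
    by (intro bcs_diff bcs_cmult b1)
  then have bg: "bcs g" by (simp add: g_def[abs_def])
  have "(LINT x|lborel. g x) = 0"
  proof (rule integral_directional_derivative[of \<psi> g "axis i 1"])
    show "integrable lborel \<psi>" using bcs_integrable[OF b1(2)] by (simp add: \<psi>_def[abs_def])
    show "continuous_on UNIV g" unfolding g_def by (intro continuous_intros cont)
    show "((\<lambda>t. \<psi> (x + t *\<^sub>R axis i 1)) has_vector_derivative g (x + s *\<^sub>R axis i 1)) (at s)" for x s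
    proof -
      have inner: "(x + t *\<^sub>R axis i 1) \<bullet> \<xi> = x \<bullet> \<xi> + t * \<xi> $ i" for t
        by (simp add: inner_add_left inner_axis' )
      have "((\<lambda>t. exp (\<i> * complex_of_real (- 2 * pi * (x \<bullet> \<xi> + t * \<xi> $ i)))) has_vector_derivative
          w * exp (\<i> * complex_of_real (- 2 * pi * (x \<bullet> \<xi> + s * \<xi> $ i)))) (at s)"
      proof -
        have "((\<lambda>z. exp (\<i> * (- 2 * pi * (x \<bullet> \<xi> + z * \<xi> $ i)))) has_field_derivative
           w * exp (\<i> * (- 2 * pi * (x \<bullet> \<xi> + complex_of_real s * \<xi> $ i)))) (at (complex_of_real s))"
          by (auto intro!: derivative_eq_intros simp: w_def)
        from has_vector_derivative_real_field[OF this] show ?thesis by simp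
      qed
      then have 1: "((\<lambda>t. ?c (x + t *\<^sub>R axis i 1)) has_vector_derivative w * ?c (x + s *\<^sub>R axis i 1)) (at s)"
        unfolding inner cis_conv_exp .
      have 2: "((\<lambda>t. complex_of_real (\<phi> (x + t *\<^sub>R axis i 1))) has_vector_derivative complex_of_real (pd i \<phi> (x + s *\<^sub>R axis i 1))) (at s)"
        by (rule has_vector_derivative_of_real[OF smooth_fun_pd_DERIV[OF sm]])
      from has_vector_derivative_mult[OF 1 2] show ?thesis by (simp add: \<psi>_def g_def mult_ac)
    qed
  qed (use bg in auto)
  moreover have "(LINT x|lborel. g x) = ft (\<lambda>x. complex_of_real (pd i \<phi> x)) \<xi> + w * ft (\<lambda>x. complex_of_real (\<phi> x)) \<xi>"
    unfolding g_def ft_def using bcs_integrable[OF b1(1)] bcs_integrable[OF b1(2)]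
    by (simp add: mult.commute[of "complex_of_real _"])
  ultimately show ?thesis by (simp add: w_def add_eq_0_iff)
qed

text \<open>Parseval turns both sides into integrals over frequencies; the minus sign of the weak
  derivative is the conjugation of the imaginary factor in \<open>ft_pd\<close>.\<close>

lemma weak_pd_if_FT:
  assumes u: "FT u h" and v: "FT v (\<lambda>\<xi>. 2 * pi * \<i> * (\<xi> $ i) * h \<xi>)"
  shows "weak_pd i u v"
  unfolding weak_pd_def
proof (intro allI impI)
  fix \<phi> :: "real^'a \<Rightarrow> real" assume \<phi>: "test_fun \<phi>"
  note b = test_fun_bcs[OF \<phi>]
  have "(LINT x|lebesgue. u x * complex_of_real (pd i \<phi> x)) = (LINT x|lebesgue. u x * cnj (complex_of_real (pd i \<phi> x)))"
    by simp
  also have "\<dots> = (LINT \<xi>|lebesgue. h \<xi> * cnj (ft (\<lambda>x. complex_of_real (pd i \<phi> x)) \<xi>))"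
    by (rule FT_parseval[OF u FT_bcs[OF b(2)]])
  also have "\<dots> = (LINT \<xi>|lebesgue. - (2 * pi * \<i> * (\<xi> $ i) * h \<xi> * cnj (ft (\<lambda>x. complex_of_real (\<phi> x)) \<xi>)))"
    by (simp add: ft_pd[OF \<phi>] mult_ac)
  also have "\<dots> = - (LINT \<xi>|lebesgue. 2 * pi * \<i> * (\<xi> $ i) * h \<xi> * cnj (ft (\<lambda>x. complex_of_real (\<phi> x)) \<xi>))"
    by (rule integral_minus)
  also have "\<dots> = - (LINT x|lebesgue. v x * cnj (complex_of_real (\<phi> x)))"
    using FT_parseval[OF v FT_bcs[OF b(1)]] by simp
  finally show "(LINT x|lebesgue. u x * complex_of_real (pd i \<phi> x)) = - (LINT x|lebesgue. v x * complex_of_real (\<phi> x))"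
    by simp
qed

lemma ball_not_null_sets:
  fixes x :: "'a::euclidean_space"
  assumes "r > 0" shows "ball x r \<notin> null_sets lborel"
proof
  assume "ball x r \<in> null_sets lborel"
  then have "negligible (ball x r)" by (simp add: negligible_iff_null_sets null_sets_completionI)
  then show False using assms open_not_negligible[of "ball x r"] by auto
qed

lemma continuous_nonneg_integral_pos:
  fixes f :: "'a::euclidean_space \<Rightarrow> real"
  assumes "continuous_on UNIV f" "\<And>x. f x \<ge> 0" "f x\<^sub>0 > 0" "integrable lborel f"
  shows "(LINT x|lborel. f x) > 0"
proof (rule ccontr)
  assume "\<not> (LINT x|lborel. f x) > 0"
  moreover have "(LINT x|lborel. f x) \<ge> 0" by (rule integral_nonneg_AE) (simp add: assms(2))
  ultimately have "(LINT x|lborel. f x) = 0" by linarith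
  then have ae: "AE x in lborel. f x = 0"
    using integral_nonneg_eq_0_iff_AE[OF assms(4)] assms(2) by simp
  have "open {x. f x > 0}" using open_Collect_less[OF continuous_on_const assms(1)] by simp
  then obtain r where r: "r > 0" "ball x\<^sub>0 r \<subseteq> {x. f x > 0}" using assms(3) by (auto simp: open_contains_ball)
  have "AE x in lborel. x \<notin> ball x\<^sub>0 r" using ae by eventually_elim (use r in auto)
  then have "ball x\<^sub>0 r \<in> null_sets lborel" by (subst AE_iff_null_sets) auto
  then show False using r(1) ball_not_null_sets by blast
qed

text \<open>Dilation shrinks the support until |x . xi| <= 1/6 on it. There the phase is at most 2
  pi / 6 = pi / 3 and its cosine at least 1/2, so the real part of the transform is at least half of
  a positive integral.\<close>

lemma test_fun_ft_nonzero:
  fixes \<xi> :: "real^'n::finite"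
  assumes \<eta>: "test_fun \<eta>" "\<And>x. \<eta> x \<ge> 0" "\<eta> x\<^sub>0 > 0"
  shows "\<exists>m::nat. ft (\<lambda>x. complex_of_real (\<eta> (0 + real (Suc m) *\<^sub>R x))) \<xi> \<noteq> 0"
proof -
  obtain R where R: "R > 0" "\<And>x. \<eta> x \<noteq> 0 \<Longrightarrow> norm x \<le> R"
    using \<eta>(1) by (auto simp: test_fun_def bounded_pos)
  obtain m :: nat where m: "6 * R * norm \<xi> \<le> real m" using real_arch_simple by blast
  define c where "c = real (Suc m)"
  have c: "c > 0" "6 * R * norm \<xi> \<le> c" using m by (auto simp: c_def)
  define f where "f x = \<eta> (0 + c *\<^sub>R x)" for x
  have tf: "test_fun f" unfolding f_def by (rule test_fun_affine[OF \<eta>(1)]) (use c in simp)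
  have cont: "continuous_on UNIV f" using tf by (intro smooth_fun_continuous) (simp add: test_fun_def)
  have ci: "integrable lborel (\<lambda>x. complex_of_real (f x))" by (rule bcs_integrable[OF test_fun_bcs(1)[OF tf]])
  then have fi: "integrable lborel f" by (simp add: complex_of_real_integrable_eq)
  have pos: "(LINT x|lborel. f x) > 0"
    by (rule continuous_nonneg_integral_pos[OF cont _ _ fi, of "(1 / c) *\<^sub>R x\<^sub>0"]) (use \<eta> c in \<open>auto simp: f_def\<close>)
  have int: "integrable lborel (\<lambda>x. complex_of_real (f x) * cis (- 2 * pi * (x \<bullet> \<xi>)))"
    by (rule integrable_mult_cis[OF ci]) measurable
  have "f x * (1/2) \<le> f x * cos (- 2 * pi * (x \<bullet> \<xi>))" for x
  proof (cases "f x = 0")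
    case False
    then have "norm (c *\<^sub>R x) \<le> R" using R(2)[of "c *\<^sub>R x"] by (simp add: f_def)
    then have x: "c * norm x \<le> R" using c by simp
    have "c * \<bar>x \<bullet> \<xi>\<bar> \<le> (c * norm x) * norm \<xi>"
      using mult_left_mono[OF Cauchy_Schwarz_ineq2[of x \<xi>], of c] c(1) by (simp add: mult.assoc)
    also have "\<dots> \<le> R * norm \<xi>" using x by (rule mult_right_mono) simp
    also have "\<dots> \<le> c * (1/6)" using c by simp
    finally have "\<bar>x \<bullet> \<xi>\<bar> \<le> 1/6" using c(1) by simp
    then have "\<bar>2 * pi * (x \<bullet> \<xi>)\<bar> \<le> pi / 3"
      using mult_left_mono[of "\<bar>x \<bullet> \<xi>\<bar>" "1/6" "2 * pi"] by (simp add: abs_mult)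
    then have "cos (pi / 3) \<le> cos \<bar>2 * pi * (x \<bullet> \<xi>)\<bar>" by (intro cos_monotone_0_pi_le) auto
    then have "1/2 \<le> cos (2 * pi * (x \<bullet> \<xi>))" by (simp add: cos_60 cos_abs_real)
    then show ?thesis using \<eta>(2)[of "0 + c *\<^sub>R x"] by (intro mult_left_mono) (auto simp: f_def)
  qed simp
  then have "(LINT x|lborel. f x * (1/2)) \<le> (LINT x|lborel. Re (complex_of_real (f x) * cis (- 2 * pi * (x \<bullet> \<xi>))))"
    using fi int by (intro integral_mono integrable_Re) auto
  also have "\<dots> = Re (ft (\<lambda>x. complex_of_real (f x)) \<xi>)"
    unfolding ft_def by (rule integral_Re[OF int])
  finally have "Re (ft (\<lambda>x. complex_of_real (f x)) \<xi>) > 0" using pos by simp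
  then have "ft (\<lambda>x. complex_of_real (f x)) \<xi> \<noteq> 0" by auto
  then show ?thesis unfolding f_def[abs_def] c_def by blast
qed

text \<open>For each dilate f of the bump the convolution theorem gives ft (pd f) h = ft f k off a
  null set, and \<open>ft_pd\<close> exhibits ft f as a common factor. The dilates being countable,
  one null set serves all, and at each frequency some factor is nonzero and cancels.\<close>

lemma FT_weak_pd:
  fixes u v :: "real^'n::finite \<Rightarrow> complex"
  assumes u: "FT u h" and v: "FT v k" and w: "weak_pd i u v"
  shows "AE \<xi> in lebesgue. k \<xi> = 2 * pi * \<i> * (\<xi> $ i) * h \<xi>"
proof -
  obtain \<eta> :: "real^'n \<Rightarrow> real" and x\<^sub>0 where \<eta>: "test_fun \<eta>" "\<And>x. \<eta> x \<ge> 0" "\<eta> x\<^sub>0 > 0"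
    using test_fun_exists by metis
  define f where "f m x = \<eta> (0 + real (Suc m) *\<^sub>R x)" for m x
  have tf: "test_fun (f m)" for m unfolding f_def by (rule test_fun_affine[OF \<eta>(1)]) simp
  have "AE \<xi> in lebesgue. ft (\<lambda>x. complex_of_real (pd i (f m) x)) \<xi> * h \<xi> = ft (\<lambda>x. complex_of_real (f m x)) \<xi> * k \<xi>" for m
  proof -
    have sm: "smooth_fun (f m)" using tf by (simp add: test_fun_def)
    have "conv (pd i (f m)) u y = conv (f m) v y" for y
    proof -
      \<comment> \<open>As a function of x, f (y - x) turns the weak derivative into convolutions at
        y; the sign from the reflection cancels the sign in \<open>weak_pd\<close>.\<close>
      have "test_fun (\<lambda>x. f m (y + (-1) *\<^sub>R x))" by (rule test_fun_affine[OF tf]) simp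
      then have "(LINT x|lebesgue. u x * complex_of_real (pd i (\<lambda>x. f m (y + (-1) *\<^sub>R x)) x))
          = - (LINT x|lebesgue. v x * complex_of_real (f m (y + (-1) *\<^sub>R x)))"
        using w unfolding weak_pd_def by blast
      moreover have "pd i (\<lambda>x. f m (y + (-1) *\<^sub>R x)) x = - pd i (f m) (y - x)" for x
        using smooth_fun_affine(2)[OF sm, of i y "-1" x] by simp
      ultimately show ?thesis by (simp add: conv_def mult.commute)
    qed
    then have eq: "conv (pd i (f m)) u = conv (f m) v" by (rule ext)
    have "integrable lborel (f m)" "integrable lborel (pd i (f m))"
      using bcs_integrable[OF test_fun_bcs(1)[OF tf[of m]]] bcs_integrable[OF test_fun_bcs(2)[OF tf[of m], of i]] by (simp_all add: complex_of_real_integrable_eq)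
    from FT_conv[OF this(2) u] FT_conv[OF this(1) v] show ?thesis unfolding eq by (rule FT_unique)
  qed
  then have "AE \<xi> in lebesgue. \<forall>m. ft (\<lambda>x. complex_of_real (pd i (f m) x)) \<xi> * h \<xi> = ft (\<lambda>x. complex_of_real (f m x)) \<xi> * k \<xi>"
    by (simp add: AE_all_countable)
  then show ?thesis
  proof eventually_elim
    case (elim \<xi>)
    obtain m where m: "ft (\<lambda>x. complex_of_real (f m x)) \<xi> \<noteq> 0"
      using test_fun_ft_nonzero[OF \<eta>, of \<xi>] unfolding f_def by blast
    have "ft (\<lambda>x. complex_of_real (f m x)) \<xi> * (2 * pi * \<i> * (\<xi> $ i) * h \<xi>) = ft (\<lambda>x. complex_of_real (f m x)) \<xi> * k \<xi>"
      using elim[rule_format, of m] by (simp add: ft_pd[OF tf] mult_ac)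
    with m show ?case by simp
  qed
qed

subsection \<open>The operator as a Fourier multiplier\<close>

definition symb :: "real \<Rightarrow> real \<Rightarrow> real \<Rightarrow> real \<Rightarrow> real^'n::finite \<Rightarrow> real" where
  "symb d c \<alpha> b \<xi> = 4 * pi\<^sup>2 * d * (norm \<xi>)\<^sup>2 + c\<^sup>2 * exp (- pi\<^sup>2 * (norm \<xi>)\<^sup>2 / \<alpha>) - b"

lemma continuous_on_symb: "continuous_on UNIV (symb d c \<alpha> b)"
  unfolding symb_def divide_inverse by (intro continuous_intros)

text \<open>In \<open>opEq\<close> the right-hand side is an arbitrary function determined almost
  everywhere; its measurability comes from completeness of the measure.\<close>

lemma borel_measurable_lebesgue_cong_AE:
  fixes f g :: "real^'n::finite \<Rightarrow> complex"
  assumes g: "g \<in> borel_measurable lebesgue" and ae: "AE x in lebesgue. f x = g x"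
  shows "f \<in> borel_measurable lebesgue"
proof (rule measurableI)
  obtain N where N: "N \<in> null_sets lebesgue" "{x. f x \<noteq> g x} \<subseteq> N"
    using ae by (auto simp: eventually_ae_filter)
  fix A :: "complex set" assume A: "A \<in> sets borel"
  have "f -` A \<inter> N \<in> sets lebesgue"
    using null_sets_completion_subset[of "f -` A \<inter> N" N lborel] N(1) by auto
  moreover have "g -` A - N \<in> sets lebesgue"
    using measurable_sets[OF g A] N(1) by auto
  moreover have "f -` A \<inter> space lebesgue = (f -` A \<inter> N) \<union> (g -` A - N)"
    using N(2) by auto
  ultimately show "f -` A \<inter> space lebesgue \<in> sets lebesgue" by (simp only: sets.Un)
qed simp

lemma L2norm_mono:
  assumes "L2 f" "L2 g" "B \<ge> 0" "\<And>x. cmod (f x) \<le> B * cmod (g x)"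
  shows "L2norm f \<le> B * L2norm g"
proof (rule power2_le_imp_le)
  have "(L2norm f)\<^sup>2 \<le> (LINT x|lebesgue. B\<^sup>2 * (cmod (g x))\<^sup>2)"
    unfolding L2norm_sq
  proof (rule integral_mono)
    show "(cmod (f x))\<^sup>2 \<le> B\<^sup>2 * (cmod (g x))\<^sup>2" for x
      using power_mono[OF assms(4)[of x], of 2] by (simp add: power_mult_distrib)
  qed (use assms in \<open>auto simp: L2_def\<close>)
  then show "(L2norm f)\<^sup>2 \<le> (B * L2norm g)\<^sup>2" by (simp add: L2norm_sq power_mult_distrib)
qed (use assms in \<open>simp add: L2norm_nonneg\<close>)

text \<open>The quotient of \<open>k\<close> by 1 + |xi|^2 is bounded, while (1 + |xi|^2) h is
  square integrable. This covers the multipliers of all first and second derivatives.\<close>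

lemma L2_mult_continuous_le:
  assumes h: "L2 h" "L2 (\<lambda>\<xi>. complex_of_real ((norm \<xi>)\<^sup>2) * h \<xi>)"
    and k: "continuous_on UNIV k" "\<And>\<xi>. cmod (k \<xi>) \<le> C * (1 + (norm \<xi>)\<^sup>2)"
  shows "L2 (\<lambda>\<xi>. k \<xi> * h \<xi>)"
proof -
  have pos: "1 + (norm \<xi>)\<^sup>2 > 0" for \<xi> :: "real^'a" by (simp add: add_pos_nonneg)
  then have nz: "complex_of_real (1 + (norm \<xi>)\<^sup>2) \<noteq> 0" for \<xi> :: "real^'a"
    unfolding of_real_eq_0_iff by (rule less_imp_neq[symmetric])
  have "L2 (\<lambda>\<xi>. (k \<xi> / complex_of_real (1 + (norm \<xi>)\<^sup>2)) * (h \<xi> + complex_of_real ((norm \<xi>)\<^sup>2) * h \<xi>))"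
  proof (rule L2_mult_bounded[OF L2_add[OF h]])
    have "continuous_on UNIV (\<lambda>\<xi>. k \<xi> / complex_of_real (1 + (norm \<xi>)\<^sup>2))"
      using nz by (intro continuous_intros k(1)) auto
    then show "(\<lambda>\<xi>. k \<xi> / complex_of_real (1 + (norm \<xi>)\<^sup>2)) \<in> borel_measurable lebesgue"
      by (intro measurable_completion) (simp add: borel_measurable_continuous_onI)
    show "cmod (k \<xi> / complex_of_real (1 + (norm \<xi>)\<^sup>2)) \<le> C" for \<xi>
      using k(2)[of \<xi>] pos[of \<xi>] by (simp only: norm_divide norm_of_real abs_of_pos pos_divide_le_eq)
  qed
  moreover have "(k \<xi> / complex_of_real (1 + (norm \<xi>)\<^sup>2)) * (h \<xi> + complex_of_real ((norm \<xi>)\<^sup>2) * h \<xi>) = k \<xi> * h \<xi>" for \<xi>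
  proof -
    have "h \<xi> + complex_of_real ((norm \<xi>)\<^sup>2) * h \<xi> = complex_of_real (1 + (norm \<xi>)\<^sup>2) * h \<xi>"
      by (simp add: distrib_right)
    then show ?thesis using nz[of \<xi>] by (simp only: times_divide_eq_left) simp
  qed
  ultimately show ?thesis by simp
qed

lemma FT_operator:
  fixes u :: "real^'n::finite \<Rightarrow> complex"
  assumes "\<alpha> > 0" and u: "FT u h"
    and w: "\<And>i. FT (w i) (\<lambda>\<xi>. 2 * pi * \<i> * (\<xi> $ i) * (2 * pi * \<i> * (\<xi> $ i) * h \<xi>))"
  shows "FT (\<lambda>x. - complex_of_real d * (\<Sum>i\<in>UNIV. w i x) + complex_of_real (c\<^sup>2) * conv (gauss \<alpha>) u x
      - complex_of_real b * u x) (\<lambda>\<xi>. complex_of_real (symb d c \<alpha> b \<xi>) * h \<xi>)"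
proof -
  have "FT (\<lambda>x. - complex_of_real d * (\<Sum>i\<in>UNIV. w i x) + complex_of_real (c\<^sup>2) * conv (gauss \<alpha>) u x
      - complex_of_real b * u x)
    (\<lambda>\<xi>. - complex_of_real d * (\<Sum>i\<in>UNIV. 2 * pi * \<i> * (\<xi> $ i) * (2 * pi * \<i> * (\<xi> $ i) * h \<xi>))
      + complex_of_real (c\<^sup>2) * (ft (\<lambda>x. complex_of_real (gauss \<alpha> x)) \<xi> * h \<xi>) - complex_of_real b * h \<xi>)"
    by (intro FT_diff FT_add FT_cmult FT_sum FT_conv u w integrable_gauss assms finite)
  moreover have "- complex_of_real d * (\<Sum>i\<in>UNIV. 2 * pi * \<i> * (\<xi> $ i) * (2 * pi * \<i> * (\<xi> $ i) * h \<xi>))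
      + complex_of_real (c\<^sup>2) * (ft (\<lambda>x. complex_of_real (gauss \<alpha> x)) \<xi> * h \<xi>) - complex_of_real b * h \<xi>
      = complex_of_real (symb d c \<alpha> b \<xi>) * h \<xi>" for \<xi>
  proof -
    have nrm: "(norm \<xi>)\<^sup>2 = (\<Sum>i\<in>UNIV. (\<xi> $ i)\<^sup>2)"
      unfolding power2_norm_eq_inner inner_vec_def by (simp add: power2_eq_square)
    have eq: "2 * pi * \<i> * (\<xi> $ i) * (2 * pi * \<i> * (\<xi> $ i) * h \<xi>) = - complex_of_real (4 * pi\<^sup>2) * h \<xi> * complex_of_real ((\<xi> $ i)\<^sup>2)" for i
      by (simp add: power2_eq_square)
    have "(\<Sum>i\<in>UNIV. 2 * pi * \<i> * (\<xi> $ i) * (2 * pi * \<i> * (\<xi> $ i) * h \<xi>))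
        = - complex_of_real (4 * pi\<^sup>2) * h \<xi> * complex_of_real ((norm \<xi>)\<^sup>2)"
      unfolding nrm of_real_sum sum_distrib_left by (intro sum.cong refl eq)
    then show ?thesis
      unfolding ft_gauss[OF assms(1)] symb_def by (simp add: algebra_simps)
  qed
  ultimately show ?thesis by simp
qed

lemma opEq_FT:
  fixes u :: "real^'n::finite \<Rightarrow> complex"
  assumes "\<alpha> > 0" "opEq d c (gauss \<alpha>) b u f"
  obtains h where "FT u h" "FT f (\<lambda>\<xi>. complex_of_real (symb d c \<alpha> b \<xi>) * h \<xi>)"
proof -
  obtain v w where H: "H2_with u v w" and f: "AE x in lebesgue. f x =
      - complex_of_real d * (\<Sum>i\<in>UNIV. w i i x) + complex_of_real (c\<^sup>2) * conv (gauss \<alpha>) u x - complex_of_real b * u x"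
    using assms(2) unfolding opEq_def by auto
  obtain h where h: "FT u h" using FT_exists[of u] H by (auto simp: H2_with_def)
  have mult: "(\<lambda>\<xi>. 2 * pi * \<i> * (\<xi> $ i) * k \<xi>) \<in> borel_measurable lebesgue" if "k \<in> borel_measurable lebesgue" for i and k :: "real^'n \<Rightarrow> complex"
  proof -
    have "continuous_on UNIV (\<lambda>\<xi>::real^'n. 2 * pi * \<i> * (\<xi> $ i))" by (intro continuous_intros)
    then have "(\<lambda>\<xi>::real^'n. 2 * pi * \<i> * (\<xi> $ i)) \<in> borel_measurable lebesgue"
      by (intro measurable_completion) (simp add: borel_measurable_continuous_onI)
    then show ?thesis using that by (rule borel_measurable_times)
  qed
  \<comment> \<open>\<open>FT_weak_pd\<close> identifies a transform only almost everywhere;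
    restoring the exact multiplier here lets the step be applied twice, from u to v and from v to
    w.\<close>
  have step: "FT q (\<lambda>\<xi>. 2 * pi * \<i> * (\<xi> $ i) * k \<xi>)" if p: "FT p k" and q: "L2 q" and pq: "weak_pd i p q" for p q i and k :: "real^'n \<Rightarrow> complex"
  proof -
    obtain k' where k': "FT q k'" using FT_exists[OF q] by auto
    have ae: "AE \<xi> in lebesgue. k' \<xi> = 2 * pi * \<i> * (\<xi> $ i) * k \<xi>" by (rule FT_weak_pd[OF p k' pq])
    have "L2 (\<lambda>\<xi>. 2 * pi * \<i> * (\<xi> $ i) * k \<xi>)"
      by (rule L2_cong_AE[OF FT_L2(2)[OF k'] mult ae]) (rule L2_measurable[OF FT_L2(2)[OF p]])
    with k' ae q show ?thesis by (intro FT_cong_AE[OF k']) auto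
  qed
  have "FT (w i i) (\<lambda>\<xi>. 2 * pi * \<i> * (\<xi> $ i) * (2 * pi * \<i> * (\<xi> $ i) * h \<xi>))" for i
  proof (rule step)
    show "FT (v i) (\<lambda>\<xi>. 2 * pi * \<i> * (\<xi> $ i) * h \<xi>)"
      by (rule step[OF h]) (use H in \<open>auto simp: H2_with_def\<close>)
  qed (use H in \<open>auto simp: H2_with_def\<close>)
  from FT_operator[OF assms(1) h this]
  have R: "FT (\<lambda>x. - complex_of_real d * (\<Sum>i\<in>UNIV. w i i x) + complex_of_real (c\<^sup>2) * conv (gauss \<alpha>) u x
      - complex_of_real b * u x) (\<lambda>\<xi>. complex_of_real (symb d c \<alpha> b \<xi>) * h \<xi>)" (is "FT ?R ?k") .
  have f': "AE x in lebesgue. ?R x = f x" using f by eventually_elim simp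
  have "f \<in> borel_measurable lebesgue"
    by (rule borel_measurable_lebesgue_cong_AE[OF L2_measurable[OF FT_L2(1)[OF R]] f])
  from L2_cong_AE[OF FT_L2(1)[OF R] this f'] have "FT f ?k"
    by (intro FT_cong_AE[OF R]) (use f' FT_L2(2)[OF R] in auto)
  with h show ?thesis by (rule that)
qed

lemma opEq_if_FT:
  fixes u :: "real^'n::finite \<Rightarrow> complex"
  assumes "\<alpha> > 0" and u: "FT u h" and f: "FT f (\<lambda>\<xi>. complex_of_real (symb d c \<alpha> b \<xi>) * h \<xi>)"
    and h2: "L2 (\<lambda>\<xi>. complex_of_real ((norm \<xi>)\<^sup>2) * h \<xi>)"
  shows "opEq d c (gauss \<alpha>) b u f"
proof -
  note h = FT_L2(2)[OF u]
  have comp: "\<bar>\<xi> $ i\<bar> \<le> 1 + (norm \<xi>)\<^sup>2" "\<bar>\<xi> $ i\<bar> * \<bar>\<xi> $ j\<bar> \<le> 1 + (norm \<xi>)\<^sup>2" for \<xi> :: "real^'n" and i j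
  proof -
    have "norm \<xi> \<le> 1 + (norm \<xi>)\<^sup>2"
      using zero_le_power2[of "norm \<xi> - 1"] norm_ge_zero[of \<xi>] unfolding power2_diff by (simp, linarith)
    then show "\<bar>\<xi> $ i\<bar> \<le> 1 + (norm \<xi>)\<^sup>2" using component_le_norm_cart[of \<xi> i] by linarith
    have "\<bar>\<xi> $ i\<bar> * \<bar>\<xi> $ j\<bar> \<le> norm \<xi> * norm \<xi>" by (intro mult_mono component_le_norm_cart) auto
    then show "\<bar>\<xi> $ i\<bar> * \<bar>\<xi> $ j\<bar> \<le> 1 + (norm \<xi>)\<^sup>2" by (simp add: power2_eq_square)
  qed
  have "L2 (\<lambda>\<xi>. 2 * pi * \<i> * (\<xi> $ i) * h \<xi>)" for i
    by (rule L2_mult_continuous_le[OF h h2, of _ "2 * pi"])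
       (use comp(1) in \<open>auto intro!: continuous_intros simp: norm_mult\<close>)
  then have "\<forall>i. \<exists>v. FT v (\<lambda>\<xi>. 2 * pi * \<i> * (\<xi> $ i) * h \<xi>)" using FT_surjective by blast
  then obtain v where v: "\<And>i. FT (v i) (\<lambda>\<xi>. 2 * pi * \<i> * (\<xi> $ i) * h \<xi>)" by metis
  have "L2 (\<lambda>\<xi>. (2 * pi * \<i> * (\<xi> $ j) * (2 * pi * \<i> * (\<xi> $ i))) * h \<xi>)" for i j
  proof (rule L2_mult_continuous_le[OF h h2, of _ "4 * pi\<^sup>2"])
    show "cmod (2 * pi * \<i> * (\<xi> $ j) * (2 * pi * \<i> * (\<xi> $ i))) \<le> 4 * pi\<^sup>2 * (1 + (norm \<xi>)\<^sup>2)" for \<xi> :: "real^'n"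
      using mult_left_mono[OF comp(2)[of \<xi> j i], of "4 * pi\<^sup>2"] by (simp add: norm_mult power2_eq_square mult_ac)
  qed (intro continuous_intros)
  then have L: "L2 (\<lambda>\<xi>. 2 * pi * \<i> * (\<xi> $ j) * (2 * pi * \<i> * (\<xi> $ i) * h \<xi>))" for i j
    by (simp only: mult.assoc)
  define w where "w i j = (SOME w. FT w (\<lambda>\<xi>. 2 * pi * \<i> * (\<xi> $ j) * (2 * pi * \<i> * (\<xi> $ i) * h \<xi>)))" for i j
  have w: "FT (w i j) (\<lambda>\<xi>. 2 * pi * \<i> * (\<xi> $ j) * (2 * pi * \<i> * (\<xi> $ i) * h \<xi>))" for i j
    unfolding w_def by (rule someI_ex[OF FT_surjective[OF L]])
  have "H2_with u v w"
    unfolding H2_with_def using FT_L2(1)[OF u] FT_L2(1)[OF v] FT_L2(1)[OF w]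
      weak_pd_if_FT[OF u v] weak_pd_if_FT[OF v w] by blast
  moreover have "AE x in lebesgue. f x = - complex_of_real d * (\<Sum>i\<in>UNIV. w i i x)
      + complex_of_real (c\<^sup>2) * conv (gauss \<alpha>) u x - complex_of_real b * u x"
    by (rule FT_injective[OF f FT_operator[OF assms(1) u w]])
  ultimately show ?thesis unfolding opEq_def by blast
qed

section \<open>From the range of the symbol to the spectrum\<close>

lemma spectrally_stable_if_symb_nonneg:
  assumes "\<alpha> > 0" "d > 0" "b > 0" and nonneg: "\<And>\<xi>::real^'n::finite. symb d c \<alpha> b \<xi> \<ge> 0"
  shows "spectrally_stable d c (gauss \<alpha> :: real^'n \<Rightarrow> real) b"
  unfolding spectrally_stable_def op_spectrum_def
proof (intro subsetI, rule ccontr)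
  fix z assume z: "z \<in> UNIV - resolvent_set d c (gauss \<alpha> :: real^'n \<Rightarrow> real) b" and "z \<notin> {z. Im z = 0 \<and> 0 \<le> Re z}"
  then have nz: "Im z \<noteq> 0 \<or> Re z < 0" by auto
  \<comment> \<open>A positive lower bound for the distance from z to [0, infinity), hence to all
    values of the symbol; a nonzero imaginary part suffices for it.\<close>
  define \<rho> where "\<rho> = (if Im z \<noteq> 0 then \<bar>Im z\<bar> else - Re z)"
  have \<rho>: "\<rho> > 0" using nz by (auto simp: \<rho>_def)
  let ?m = "\<lambda>\<xi>::real^'n. complex_of_real (symb d c \<alpha> b \<xi>)"
  have lower: "cmod (?m \<xi> - z) \<ge> \<rho>" for \<xi>
  proof (cases "Im z = 0")
    case False
    then show ?thesis using abs_Im_le_cmod[of "?m \<xi> - z"] by (simp add: \<rho>_def)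
  next
    case True
    then show ?thesis using complex_Re_le_cmod[of "?m \<xi> - z"] nonneg[of \<xi>] by (simp add: \<rho>_def)
  qed
  have mz: "?m \<xi> - z \<noteq> 0" for \<xi> using lower[of \<xi>] \<rho> by auto
  define K where "K = 4 * pi\<^sup>2 * d"
  have K: "K > 0" using assms by (simp add: K_def)
  \<comment> \<open>From K |xi|^2 <= |m - z| + |z| + b, where |z| + b is absorbed through |m - z| /
    rho >= 1. This quadratic control places the solution in \<open>H2\<close>.\<close>
  define C where "C = 1 / K + ((cmod z + b) / K) / \<rho>"
  have upper: "(norm \<xi>)\<^sup>2 \<le> C * cmod (?m \<xi> - z)" for \<xi>
  proof -
    have "K * (norm \<xi>)\<^sup>2 \<le> symb d c \<alpha> b \<xi> + b" by (simp add: symb_def K_def)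
    also have "symb d c \<alpha> b \<xi> \<le> cmod (?m \<xi> - z) + cmod z"
      using norm_triangle_ineq[of "?m \<xi> - z" z] nonneg[of \<xi>] by simp
    finally have "K * (norm \<xi>)\<^sup>2 \<le> cmod (?m \<xi> - z) + (cmod z + b) * 1" by simp
    also have "\<dots> \<le> cmod (?m \<xi> - z) + (cmod z + b) * (cmod (?m \<xi> - z) / \<rho>)"
      using lower[of \<xi>] \<rho> assms(3) by (intro add_left_mono mult_left_mono) (auto simp: field_simps)
    also have "\<dots> = K * (C * cmod (?m \<xi> - z))" using K \<rho> by (simp add: C_def field_simps)
    finally show ?thesis using K by simp
  qed
  have cont: "continuous_on UNIV (\<lambda>\<xi>. ?m \<xi> - z)" by (intro continuous_intros continuous_on_symb)
  have "z \<in> resolvent_set d c (gauss \<alpha> :: real^'n \<Rightarrow> real) b"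
    unfolding resolvent_set_def
  proof (intro CollectI conjI allI impI)
    fix f :: "real^'n \<Rightarrow> complex" assume "L2 f"
    then obtain k where k: "FT f k" using FT_exists by blast
    define h where "h \<xi> = (1 / (?m \<xi> - z)) * k \<xi>" for \<xi>
    have "L2 h" unfolding h_def
    proof (rule L2_mult_bounded[OF FT_L2(2)[OF k]])
      have "continuous_on UNIV (\<lambda>\<xi>. 1 / (?m \<xi> - z))" using mz by (intro continuous_intros continuous_on_symb) auto
      then show "(\<lambda>\<xi>. 1 / (?m \<xi> - z)) \<in> borel_measurable lebesgue"
        by (intro measurable_completion) (simp add: borel_measurable_continuous_onI)
      show "cmod (1 / (?m \<xi> - z)) \<le> 1 / \<rho>" for \<xi>
        using lower[of \<xi>] \<rho> by (simp add: norm_divide frac_le)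
    qed
    then obtain u where u: "FT u h" using FT_surjective by blast
    have h2: "L2 (\<lambda>\<xi>. complex_of_real ((norm \<xi>)\<^sup>2) * h \<xi>)"
    proof -
      have "L2 (\<lambda>\<xi>. (complex_of_real ((norm \<xi>)\<^sup>2) / (?m \<xi> - z)) * k \<xi>)"
      proof (rule L2_mult_bounded[OF FT_L2(2)[OF k]])
        have "continuous_on UNIV (\<lambda>\<xi>. complex_of_real ((norm \<xi>)\<^sup>2) / (?m \<xi> - z))"
          using mz by (intro continuous_intros continuous_on_symb) auto
        then show "(\<lambda>\<xi>. complex_of_real ((norm \<xi>)\<^sup>2) / (?m \<xi> - z)) \<in> borel_measurable lebesgue"
          by (intro measurable_completion) (simp add: borel_measurable_continuous_onI)
        show "cmod (complex_of_real ((norm \<xi>)\<^sup>2) / (?m \<xi> - z)) \<le> C" for \<xi>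
        proof -
          have "cmod (complex_of_real ((norm \<xi>)\<^sup>2)) = (norm \<xi>)\<^sup>2" unfolding norm_of_real by simp
          then show ?thesis using upper[of \<xi>] mz[of \<xi>] by (simp only: norm_divide) (simp add: divide_le_eq)
        qed
      qed
      then show ?thesis by (simp add: h_def)
    qed
    have "FT (\<lambda>x. f x + z * u x) (\<lambda>\<xi>. k \<xi> + z * h \<xi>)" by (intro FT_add FT_cmult k u)
    moreover have "k \<xi> + z * h \<xi> = ?m \<xi> * h \<xi>" for \<xi>
      using mz[of \<xi>] by (simp add: h_def field_simps)
    ultimately have "FT (\<lambda>x. f x + z * u x) (\<lambda>\<xi>. ?m \<xi> * h \<xi>)" by simp
    from opEq_if_FT[OF assms(1) u this h2]
    show "\<exists>u. opEq d c (gauss \<alpha>) b u (\<lambda>x. f x + z * u x)" by blast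
  next
    show "\<exists>C. \<forall>u f. opEq d c (gauss \<alpha> :: real^'n \<Rightarrow> real) b u f \<longrightarrow> L2norm u \<le> C * L2norm (\<lambda>x. f x - z * u x)"
    proof (intro exI allI impI)
      fix u f :: "real^'n \<Rightarrow> complex" assume "opEq d c (gauss \<alpha>) b u f"
      then obtain h where h: "FT u h" "FT f (\<lambda>\<xi>. ?m \<xi> * h \<xi>)" using opEq_FT[OF assms(1)] by blast
      have F: "FT (\<lambda>x. f x - z * u x) (\<lambda>\<xi>. ?m \<xi> * h \<xi> - z * h \<xi>)" by (intro FT_diff FT_cmult h)
      have "L2norm h \<le> (1 / \<rho>) * L2norm (\<lambda>\<xi>. ?m \<xi> * h \<xi> - z * h \<xi>)"
      proof (rule L2norm_mono)
        show "cmod (h \<xi>) \<le> 1 / \<rho> * cmod (?m \<xi> * h \<xi> - z * h \<xi>)" for \<xi>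
        proof -
          have "cmod (?m \<xi> * h \<xi> - z * h \<xi>) = cmod (?m \<xi> - z) * cmod (h \<xi>)"
            by (simp only: left_diff_distrib[symmetric] norm_mult)
          then show ?thesis
            using mult_right_mono[OF lower[of \<xi>], of "cmod (h \<xi>)"] \<rho> by (simp add: field_simps)
        qed
      qed (use F h \<rho> in \<open>auto simp: FT_L2\<close>)
      then show "L2norm u \<le> (1 / \<rho>) * L2norm (\<lambda>x. f x - z * u x)"
        using FT_norm[OF F] FT_norm[OF h(1)] by simp
    qed
  qed
  with z show False by simp
qed

lemma spectrally_unstable_if_symb_neg:
  fixes \<xi>\<^sub>0 :: "real^'n::finite"
  assumes "\<alpha> > 0" and neg: "symb d c \<alpha> b \<xi>\<^sub>0 < 0"
  shows "spectrally_unstable d c (gauss \<alpha> :: real^'n \<Rightarrow> real) b"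
proof -
  define l where "l = symb d c \<alpha> b \<xi>\<^sub>0"
  let ?m = "\<lambda>\<xi>::real^'n. complex_of_real (symb d c \<alpha> b \<xi>)"
  have "complex_of_real l \<notin> resolvent_set d c (gauss \<alpha> :: real^'n \<Rightarrow> real) b"
  proof
    assume "complex_of_real l \<in> resolvent_set d c (gauss \<alpha> :: real^'n \<Rightarrow> real) b"
    then obtain C where C: "\<And>u f. opEq d c (gauss \<alpha> :: real^'n \<Rightarrow> real) b u f \<Longrightarrow>
        L2norm u \<le> C * L2norm (\<lambda>x. f x - complex_of_real l * u x)"
      unfolding resolvent_set_def by blast
    \<comment> \<open>With |C| epsilon < 1 the supposed bound forces the norm of \<open>h\<close> to
      be 0. The absolute value is taken because nothing fixes the sign of C.\<close>
    define \<epsilon> where "\<epsilon> = 1 / (2 * (\<bar>C\<bar> + 1))"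
    have \<epsilon>: "\<epsilon> > 0" "\<bar>C\<bar> * \<epsilon> < 1" by (auto simp: \<epsilon>_def field_simps)
    obtain r where r: "r > 0" "\<And>\<xi>. dist \<xi> \<xi>\<^sub>0 < r \<Longrightarrow> dist (symb d c \<alpha> b \<xi>) l < \<epsilon>"
      using continuous_on_symb[of d c \<alpha> b] \<epsilon>(1) unfolding continuous_on_iff l_def by (metis UNIV_I)
    \<comment> \<open>The transform of the approximate eigenfunction. Its bounded support makes
      |xi|^2 h square integrable, so the function lies in the domain.\<close>
    define h :: "real^'n \<Rightarrow> complex" where "h = indicator (ball \<xi>\<^sub>0 r)"
    have bh: "bcs h"
      unfolding bcs_def h_def
    proof (intro conjI)
      show "bounded (range (indicator (ball \<xi>\<^sub>0 r) :: real^'n \<Rightarrow> complex))"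
        by (auto simp: bounded_iff indicator_def intro!: exI[of _ 1])
      show "bounded {x. (indicator (ball \<xi>\<^sub>0 r) x :: complex) \<noteq> 0}"
        by (rule bounded_subset[OF bounded_ball[of \<xi>\<^sub>0 r]]) (auto simp: indicator_def)
      show "indicator (ball \<xi>\<^sub>0 r) \<in> borel_measurable borel" by (rule borel_measurable_indicator) simp
    qed
    have bm: "bcs (\<lambda>\<xi>. ?m \<xi> * h \<xi>)" "bcs (\<lambda>\<xi>. complex_of_real ((norm \<xi>)\<^sup>2) * h \<xi>)"
      by (intro bcs_mult_continuous[OF bh] continuous_intros continuous_on_symb)+
    obtain u where u: "FT u h" using FT_surjective[OF bcs_L2[OF bh]] by blast
    obtain f where f: "FT f (\<lambda>\<xi>. ?m \<xi> * h \<xi>)" using FT_surjective[OF bcs_L2[OF bm(1)]] by blast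
    have F: "FT (\<lambda>x. f x - complex_of_real l * u x) (\<lambda>\<xi>. ?m \<xi> * h \<xi> - complex_of_real l * h \<xi>)"
      by (intro FT_diff FT_cmult f u)
    have "L2norm u \<le> C * L2norm (\<lambda>x. f x - complex_of_real l * u x)"
      by (rule C[OF opEq_if_FT[OF assms(1) u f bcs_L2[OF bm(2)]]])
    also have "\<dots> \<le> \<bar>C\<bar> * L2norm (\<lambda>\<xi>. ?m \<xi> * h \<xi> - complex_of_real l * h \<xi>)"
      unfolding FT_norm[OF F] by (intro mult_right_mono L2norm_nonneg) simp
    also have "\<dots> \<le> \<bar>C\<bar> * (\<epsilon> * L2norm h)"
    proof (intro mult_left_mono L2norm_mono)
      show "cmod (?m \<xi> * h \<xi> - complex_of_real l * h \<xi>) \<le> \<epsilon> * cmod (h \<xi>)" for \<xi>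
      proof (cases "\<xi> \<in> ball \<xi>\<^sub>0 r")
        case True
        then have "cmod (?m \<xi> - complex_of_real l) \<le> \<epsilon>"
          using r(2)[of \<xi>] unfolding of_real_diff[symmetric] norm_of_real by (simp add: dist_real_def dist_commute)
        then show ?thesis using True by (simp add: h_def)
      qed (simp add: h_def)
    qed (use F bcs_L2[OF bh] \<epsilon> in \<open>auto simp: FT_L2\<close>)
    finally have "L2norm h \<le> (\<bar>C\<bar> * \<epsilon>) * L2norm h" unfolding FT_norm[OF u] by (simp add: mult.assoc)
    then have "(1 - \<bar>C\<bar> * \<epsilon>) * L2norm h \<le> 0" by (simp add: left_diff_distrib)
    then have "L2norm h = 0" using \<epsilon>(2) L2norm_nonneg[of h] by (simp add: mult_le_0_iff)
    then have "AE \<xi> in lebesgue. h \<xi> = 0" by (rule L2norm_eq_0_AE[OF bcs_L2[OF bh]])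
    then have "AE \<xi> in lebesgue. \<xi> \<notin> ball \<xi>\<^sub>0 r" by eventually_elim (auto simp: h_def)
    then have "ball \<xi>\<^sub>0 r \<in> null_sets lebesgue" by (subst AE_iff_null_sets) auto
    then have "ball \<xi>\<^sub>0 r \<in> null_sets lborel" by (simp add: null_sets_completion_iff)
    with ball_not_null_sets[OF r(1)] show False by blast
  qed
  with neg show ?thesis unfolding spectrally_unstable_def op_spectrum_def l_def by blast
qed

subsection \<open>The sign of the symbol\<close>

lemma symb_sign_iff:
  assumes "\<alpha> > 0"
  shows "(\<forall>\<xi>::real^'n::finite. symb d c \<alpha> b \<xi> \<ge> 0) \<longleftrightarrow> (\<forall>\<rho>\<ge>0. 4 * \<alpha> * d * \<rho> + c\<^sup>2 * exp (- \<rho>) - b \<ge> 0)"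
proof (intro iffI allI impI)
  fix \<rho> :: real assume *: "\<forall>\<xi>::real^'n. symb d c \<alpha> b \<xi> \<ge> 0" and \<rho>: "\<rho> \<ge> 0"
  \<comment> \<open>The length solves pi^2 |xi|^2 / alpha = rho; the direction is immaterial since
    the symbol is radial, and \<open>undefined\<close> just names some coordinate.\<close>
  define \<xi> :: "real^'n" where "\<xi> = sqrt (\<alpha> * \<rho> / pi\<^sup>2) *\<^sub>R axis undefined 1"
  have "(norm \<xi>)\<^sup>2 = \<alpha> * \<rho> / pi\<^sup>2" using assms \<rho> by (simp add: \<xi>_def power_mult_distrib)
  then have "symb d c \<alpha> b \<xi> = 4 * \<alpha> * d * \<rho> + c\<^sup>2 * exp (- \<rho>) - b" using assms by (simp add: symb_def)
  with * show "4 * \<alpha> * d * \<rho> + c\<^sup>2 * exp (- \<rho>) - b \<ge> 0" by metis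
next
  fix \<xi> :: "real^'n" assume *: "\<forall>\<rho>\<ge>0. 4 * \<alpha> * d * \<rho> + c\<^sup>2 * exp (- \<rho>) - b \<ge> 0"
  have "4 * \<alpha> * d * (pi\<^sup>2 * (norm \<xi>)\<^sup>2 / \<alpha>) + c\<^sup>2 * exp (- (pi\<^sup>2 * (norm \<xi>)\<^sup>2 / \<alpha>)) - b \<ge> 0"
    using *[rule_format, of "pi\<^sup>2 * (norm \<xi>)\<^sup>2 / \<alpha>"] assms by fastforce
  then show "symb d c \<alpha> b \<xi> \<ge> 0" using assms by (simp add: symb_def mult_ac)
qed

lemma spectrally_stable_if:
  assumes "\<alpha> > 0" "d > 0" "b > 0" "\<And>\<rho>. \<rho> \<ge> 0 \<Longrightarrow> 4 * \<alpha> * d * \<rho> + c\<^sup>2 * exp (- \<rho>) - b \<ge> 0"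
  shows "spectrally_stable d c (gauss \<alpha> :: real^'n::finite \<Rightarrow> real) b"
  using spectrally_stable_if_symb_nonneg[OF assms(1-3)] symb_sign_iff[OF assms(1), where 'n = 'n] assms(4) by blast

lemma spectrally_unstable_if:
  assumes "\<alpha> > 0" "\<rho> \<ge> 0" "4 * \<alpha> * d * \<rho> + c\<^sup>2 * exp (- \<rho>) - b < 0"
  shows "spectrally_unstable d c (gauss \<alpha> :: real^'n::finite \<Rightarrow> real) b"
proof -
  have "\<not> (\<forall>\<xi>::real^'n. symb d c \<alpha> b \<xi> \<ge> 0)"
    unfolding symb_sign_iff[OF assms(1)] using assms(2,3) by (metis not_le)
  then show ?thesis using spectrally_unstable_if_symb_neg[OF assms(1)] by (metis not_le)
qed

text \<open>The right-hand side minus the left-hand side is the gap between \<open>exp (- \<rho>)\<close> and its tangent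
  at \<open>\<rho> = - ln s\<close>.\<close>

lemma exp_tangent:
  fixes s \<rho> :: real
  assumes "s > 0" shows "s - s * ln s \<le> s * \<rho> + exp (- \<rho>)"
proof -
  have "s * (1 + (- \<rho> - ln s)) \<le> s * exp (- \<rho> - ln s)"
    using assms by (intro mult_left_mono exp_ge_add_one_self) auto
  also have "\<dots> = exp (- \<rho>)" using assms by (simp add: exp_diff)
  finally show ?thesis by (simp add: algebra_simps)
qed

section \<open>The zero s0 and the two constant solutions\<close>

lemma gfun_strict_mono:
  assumes "0 < s" "s < t" "t < 1" shows "gfun a b s < gfun a b t"
  unfolding gfun_def
proof (rule DERIV_pos_imp_increasing[OF assms(2)])
  fix x assume x: "s \<le> x" "x \<le> t"
  then have "((\<lambda>s. - s * ln s + s - b / (c1 a b)\<^sup>2) has_real_derivative - ln x) (at x)"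
    using assms by (auto intro!: derivative_eq_intros)
  moreover have "- ln x > 0" using x assms by simp
  ultimately show "\<exists>y. ((\<lambda>s. - s * ln s + s - b / (c1 a b)\<^sup>2) has_real_derivative y) (at x) \<and> 0 < y" by blast
qed

text \<open>As \<open>s0\<close> is a definite description, both existence and uniqueness must
  precede any use of it: intermediate values give the first, strict monotonicity the second.\<close>

lemma s0_root:
  assumes "b > 0" "b < (c1 a b)\<^sup>2"
  shows "0 < s0 a b" "s0 a b < 1" "gfun a b (s0 a b) = 0"
proof -
  define q where "q = b / (c1 a b)\<^sup>2"
  have q: "0 < q" "q < 1" using assms order.strict_trans[OF assms] by (simp_all add: q_def del: zero_less_power2)
  \<comment> \<open>An explicit point with g(t) < 0, in place of the limit of s ln s at 0. Here g(t)
    = t (1 + 4/q) - q; the bound exp y > y^2 / 2 at y = 4/q gives 8 t < q^2, and 1 + 4/q <= 8/q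
    because q < 1.\<close>
  define t where "t = exp (- (4 / q))"
  have t: "0 < t" "t < 1" using q by (auto simp: t_def)
  have "gfun a b t < 0"
  proof -
    have "4 / q > 0" using q by simp
    then have "(4 / q)\<^sup>2 / 2 < exp (4 / q)" using exp_lower_Taylor_quadratic[of "4 / q"] by linarith
    then have "t * ((4 / q)\<^sup>2 / 2) < t * exp (4 / q)" using t by simp
    also have "\<dots> = 1" by (simp add: t_def exp_minus)
    finally have "t * 8 < q * q" using q by (simp add: power2_eq_square field_simps)
    then have 1: "t * (8 / q) < q" using q by (simp add: field_simps)
    have "t * (1 + 4 / q) \<le> t * (8 / q)" using t q by (intro mult_left_mono) (simp_all add: field_simps)
    with 1 have "t * (1 + 4 / q) < q" by linarith
    moreover have "gfun a b t = t * (1 + 4 / q) - q" by (simp add: gfun_def t_def q_def algebra_simps)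
    ultimately show ?thesis by simp
  qed
  moreover have "gfun a b 1 > 0" using q by (simp add: gfun_def q_def)
  moreover have "continuous_on {t..1} (gfun a b)"
    unfolding gfun_def using t by (intro continuous_intros) auto
  ultimately obtain s where s: "t \<le> s" "s \<le> 1" "gfun a b s = 0"
    using IVT'[of "gfun a b" t 0 1] t by auto
  have s1: "0 < s \<and> s < 1 \<and> gfun a b s = 0" using s t \<open>gfun a b 1 > 0\<close> by (cases "s = 1") auto
  have "\<exists>!s. 0 < s \<and> s < 1 \<and> gfun a b s = 0"
  proof (rule ex1I[of _ s], fact s1)
    fix r assume r: "0 < r \<and> r < 1 \<and> gfun a b r = 0"
    show "r = s"
      using gfun_strict_mono[of r s a b] gfun_strict_mono[of s r a b] r s1 by (cases r s rule: linorder_cases) auto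
  qed
  from theI'[OF this] show "0 < s0 a b" "s0 a b < 1" "gfun a b (s0 a b) = 0" unfolding s0_def by auto
qed

text \<open>Since c1 c2 = b and 0 < c2 < c1, multiplying c2 < c1 by c1 and by c2 gives the two
  inequalities.\<close>

lemma c1_c2_relations:
  assumes "a > 0" "b > 0" "a\<^sup>2 / 4 > b"
  shows "b < (c1 a b)\<^sup>2" "(c2 a b)\<^sup>2 < b"
proof -
  define r where "r = sqrt (a\<^sup>2 / 4 - b)"
  have r: "r > 0" "r\<^sup>2 = a\<^sup>2 / 4 - b" using assms by (auto simp: r_def)
  have c: "c1 a b = a / 2 + r" "c2 a b = a / 2 - r" by (simp_all add: c1_def c2_def r_def)
  have "c1 a b * c2 a b = a\<^sup>2 / 4 - r\<^sup>2" unfolding c by (simp add: power2_eq_square algebra_simps)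
  then have prod: "c1 a b * c2 a b = b" using r(2) by simp
  have less: "c2 a b < c1 a b" using r(1) by (simp add: c)
  have c1: "c1 a b > 0" using r(1) assms(1) by (simp add: c)
  with prod assms(2) have c2: "c2 a b > 0" by (metis zero_less_mult_pos)
  show "b < (c1 a b)\<^sup>2" using mult_strict_left_mono[OF less c1] by (simp add: prod power2_eq_square)
  show "(c2 a b)\<^sup>2 < b" using mult_strict_right_mono[OF less c2] by (simp add: prod power2_eq_square)
qed

theorem theorem4:
  fixes a b d \<alpha> :: real
  assumes "a > 0" and "b > 0" and "d > 0" and "\<alpha> > 0"
    and "a\<^sup>2 / 4 \<ge> b"
  defines "\<phi> \<equiv> (gauss \<alpha> :: real^'n::finite \<Rightarrow> real)"
  shows "(a\<^sup>2 / 4 > b \<longrightarrow>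
            (d \<ge> s0 a b * (c1 a b)\<^sup>2 / (4 * \<alpha>) \<longrightarrow> spectrally_stable d (c1 a b) \<phi> b) \<and>
            (d < s0 a b * (c1 a b)\<^sup>2 / (4 * \<alpha>) \<longrightarrow> spectrally_unstable d (c1 a b) \<phi> b) \<and>
            spectrally_unstable d (c2 a b) \<phi> b)
       \<and> (a\<^sup>2 / 4 = b \<longrightarrow>
            (\<forall>c \<in> {c1 a b, c2 a b}.
               (d \<ge> b / (4 * \<alpha>) \<longrightarrow> spectrally_stable d c \<phi> b) \<and>
               (d < b / (4 * \<alpha>) \<longrightarrow> spectrally_unstable d c \<phi> b)))"
proof (intro conjI impI ballI)
  assume gt: "a\<^sup>2 / 4 > b"
  note c = c1_c2_relations[OF assms(1,2) gt]
  define C where "C = (c1 a b)\<^sup>2"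
  define s where "s = s0 a b"
  have s: "0 < s" "s < 1" and "gfun a b s = 0" using s0_root[OF assms(2) c(1)] by (auto simp: s_def)
  have C: "C > 0" using order.strict_trans[OF assms(2) c(1)] by (simp only: C_def)
  \<comment> \<open>The equation g(s) = 0 says that the minimum of the symbol is exactly 0 when 4
    alpha d = s C.\<close>
  have b: "C * (s - s * ln s) = b"
    using \<open>gfun a b s = 0\<close> C by (simp add: gfun_def C_def[symmetric] field_simps)
  {
    assume "d \<ge> s0 a b * (c1 a b)\<^sup>2 / (4 * \<alpha>)"
    then have d: "s * C \<le> 4 * \<alpha> * d" using assms(4) by (simp add: C_def s_def field_simps)
    show "spectrally_stable d (c1 a b) \<phi> b"
      unfolding \<phi>_def
    proof (rule spectrally_stable_if[OF assms(4,3,2)])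
      fix \<rho> :: real assume \<rho>: "\<rho> \<ge> 0"
      \<comment> \<open>The tangent bound is used at the threshold slope s C; a larger d only raises
        the linear term.\<close>
      have "C * (s - s * ln s) \<le> C * (s * \<rho> + exp (- \<rho>))"
        using C by (intro mult_left_mono exp_tangent s) simp
      moreover have "(s * C) * \<rho> \<le> 4 * \<alpha> * d * \<rho>" using d \<rho> by (rule mult_right_mono)
      ultimately show "0 \<le> 4 * \<alpha> * d * \<rho> + (c1 a b)\<^sup>2 * exp (- \<rho>) - b"
        unfolding C_def[symmetric] b by (simp add: algebra_simps)
    qed
  next
    assume "d < s0 a b * (c1 a b)\<^sup>2 / (4 * \<alpha>)"
    then have d: "4 * \<alpha> * d < s * C" using assms(4) by (simp add: C_def s_def field_simps)
    have l: "- ln s > 0" using s by simp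
    \<comment> \<open>The test point is the minimiser for the threshold rather than for the given d:
      the threshold symbol vanishes there, and a smaller d makes it negative because -ln s >
      0.\<close>
    have "4 * \<alpha> * d * (- ln s) < (s * C) * (- ln s)" using d l by (rule mult_strict_right_mono)
    then have "4 * \<alpha> * d * (- ln s) + (c1 a b)\<^sup>2 * exp (- (- ln s)) - b < 0"
      unfolding C_def[symmetric] using s b by (simp add: algebra_simps)
    then show "spectrally_unstable d (c1 a b) \<phi> b"
      unfolding \<phi>_def using l by (intro spectrally_unstable_if[OF assms(4), of "- ln s"]) auto
  next
    \<comment> \<open>At frequency 0 the symbol equals c2^2 - b, negative whatever d is.\<close>
    show "spectrally_unstable d (c2 a b) \<phi> b"
      unfolding \<phi>_def by (rule spectrally_unstable_if[OF assms(4), of 0]) (use c(2) in auto)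
  }
next
  fix c assume eq: "a\<^sup>2 / 4 = b" and "c \<in> {c1 a b, c2 a b}"
  \<comment> \<open>The square root vanishes, so c1 and c2 both equal a/2.\<close>
  then have c: "c\<^sup>2 = b" by (auto simp: c1_def c2_def power_divide)
  {
    assume "d \<ge> b / (4 * \<alpha>)"
    then have d: "b \<le> 4 * \<alpha> * d" using assms(4) by (simp add: field_simps)
    show "spectrally_stable d c \<phi> b"
      unfolding \<phi>_def
    proof (rule spectrally_stable_if[OF assms(4,3,2)])
      fix \<rho> :: real assume \<rho>: "\<rho> \<ge> 0"
      \<comment> \<open>The tangent of exp(-rho) at rho = 0, the case s = 1.\<close>
      have "b * 1 \<le> b * (\<rho> + exp (- \<rho>))"
        using exp_tangent[of 1 \<rho>] assms(2) by (intro mult_left_mono) auto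
      moreover have "b * \<rho> \<le> 4 * \<alpha> * d * \<rho>" using d \<rho> by (rule mult_right_mono)
      ultimately show "0 \<le> 4 * \<alpha> * d * \<rho> + c\<^sup>2 * exp (- \<rho>) - b"
        unfolding c by (simp add: algebra_simps)
    qed
  next
    assume "d < b / (4 * \<alpha>)"
    \<comment> \<open>Here the threshold minimiser is rho = 0, where the symbol vanishes for every
      d; the negative value has to be sought at the minimiser -ln s of the given d.\<close>
    define s where "s = 4 * \<alpha> * d / b"
    have s: "0 < s" "s < 1" "4 * \<alpha> * d = b * s"
      using \<open>d < b / (4 * \<alpha>)\<close> assms(2-4) by (auto simp: s_def field_simps)
    \<comment> \<open>Strict because equality in ln x <= x - 1 occurs only at x = 1, while 1/s >
      1.\<close>
    have "ln (1 / s) < 1 / s - 1"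
      using ln_le_minus_one[of "1 / s"] ln_eq_minus_one[of "1 / s"] s by (cases "ln (1 / s) = 1 / s - 1") auto
    then have "s * (- ln s) < s * (1 / s - 1)" using s by (intro mult_strict_left_mono) (auto simp: ln_div)
    then have "b * (s * (- ln s) + s - 1) < b * 0" using s assms(2) by (intro mult_strict_left_mono) (auto simp: algebra_simps)
    then have "4 * \<alpha> * d * (- ln s) + c\<^sup>2 * exp (- (- ln s)) - b < 0"
      unfolding c s(3) using s(1) by (simp add: algebra_simps)
    then show "spectrally_unstable d c \<phi> b"
      unfolding \<phi>_def using s by (intro spectrally_unstable_if[OF assms(4), of "- ln s"]) auto
  }
qed

end
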